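(* There exists an algorithm that, given a Wordle instance $\mathrm{WI} = (\Sigma, d, D, W, g)$, determines whether $\mathrm{WI}$ admits a winning strategy in time $O(|\mathrm{WI}|^{O(g)})$ using space $O(g\,|\mathrm{WI}|)$, where $|\mathrm{WI}|$ denotes the size of the encoding of the instance.
   Context: A Wordle instance $\mathrm{WI} = (\Sigma, d, D, W, g)$ consists of a finite alphabet $\Sigma$, a dimension $d \in \mathbf{Z}^+$, a dictionary $D \subseteq \Sigma^d$, a word list $W \subseteq D$, and a game length $g \in \mathbf{Z}^+$, given by explicitly listing these data. For a target word $w \in W$ and a query $u \in D$, the Wordle oracle returns $\Omega_w(u) = r \in \{0,1,2\}^d$ where, for each $i$, $r_i = 2$ if $w_i = u_i$; $r_i = 1$ if otherwise $|\{ j \le i : u_i = u_j,\ u_j \ne w_j\}| \le |\{ j : w_j = u_i,\ w_j \ne u_j\}|$; and $r_i = 0$ otherwise. A strategy is a function that, for every finite sequence of queries and responses $u^1, r^1, \dots, u^{k-1}, r^{k-1}$, specifies a next query $u^k \in D$. Playing against $\Omega_w$ (responses $r^i = \Omega_w(u^i)$), the strategy succeeds in round $k$ if $\Omega_w(u^k) = 22\cdots2$. A strategy is winning if for every $w \in W$ it succeeds in at most $g$ rounds against $\Omega_w$. *)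

theory Defs
  imports Main
begin

section \<open>Wordle\<close>

text \<open>Letters are natural numbers, so that one machine can read instances over every alphabet.\<close>

record wordle =
  alphabet :: "nat set"
  dimension :: nat
  dictionary :: "nat list set"
  word_list :: "nat list set"
  game_length :: nat

definition wordle_instance :: "wordle \<Rightarrow> bool" where
  "wordle_instance WI \<longleftrightarrow>
     finite (alphabet WI) \<and> dimension WI > 0 \<and>
     dictionary WI \<subseteq> {u. length u = dimension WI \<and> set u \<subseteq> alphabet WI} \<and>
     word_list WI \<subseteq> dictionary WI \<and> game_length WI > 0"

definition wordle_oracle :: "nat list \<Rightarrow> nat list \<Rightarrow> nat list" where
  "wordle_oracle w u = map (\<lambda>i.
     if w ! i = u ! i then 2
     else if card {j. j \<le> i \<and> u ! i = u ! j \<and> u ! j \<noteq> w ! j}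
             \<le> card {j. j < length w \<and> w ! j = u ! i \<and> w ! j \<noteq> u ! j} then 1
     else 0) [0..<length u]"

type_synonym history = "(nat list \<times> nat list) list"

definition histories :: "wordle \<Rightarrow> history set" where
  "histories WI = {h. \<forall>(u, r) \<in> set h.
     u \<in> dictionary WI \<and> length r = dimension WI \<and> set r \<subseteq> {0, 1, 2}}"

text \<open>The empty history is a history, so an instance with empty dictionary has no strategy at all.\<close>

definition strategy :: "wordle \<Rightarrow> (history \<Rightarrow> nat list) \<Rightarrow> bool" where
  "strategy WI \<sigma> \<longleftrightarrow> (\<forall>h \<in> histories WI. \<sigma> h \<in> dictionary WI)"

primrec play :: "(history \<Rightarrow> nat list) \<Rightarrow> nat list \<Rightarrow> nat \<Rightarrow> history" where
  "play \<sigma> w 0 = []"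
| "play \<sigma> w (Suc k) = play \<sigma> w k @ [(\<sigma> (play \<sigma> w k), wordle_oracle w (\<sigma> (play \<sigma> w k)))]"

text \<open>Rounds are numbered from 1; the query of round \<open>k\<close> answers the history of length \<open>k - 1\<close>.\<close>

definition succeeds_in_round :: "wordle \<Rightarrow> (history \<Rightarrow> nat list) \<Rightarrow> nat list \<Rightarrow> nat \<Rightarrow> bool" where
  "succeeds_in_round WI \<sigma> w k \<longleftrightarrow>
     wordle_oracle w (\<sigma> (play \<sigma> w (k - 1))) = replicate (dimension WI) 2"

definition winning_strategy :: "wordle \<Rightarrow> (history \<Rightarrow> nat list) \<Rightarrow> bool" where
  "winning_strategy WI \<sigma> \<longleftrightarrow> strategy WI \<sigma> \<and>
     (\<forall>w \<in> word_list WI. \<exists>k \<in> {1..game_length WI}. succeeds_in_round WI \<sigma> w k)"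

section \<open>Encoding of instances\<close>

text \<open>
  Symbols: 0 is the blank, 1 and 2 are the binary digits zero and one, and 3, 4, 5 terminate a
  letter, a word and a field of the instance. Numbers are written in binary, least significant
  digit first and without leading zeros. Since every part is terminated, an encoding determines
  its instance; an instance has one encoding for each order in which its sets can be listed.
\<close>

fun binary :: "nat \<Rightarrow> nat list" where
  "binary n = (if n = 0 then [] else (n mod 2 + 1) # binary (n div 2))"

declare binary.simps [simp del]

definition enc_letters :: "nat list \<Rightarrow> nat list" where
  "enc_letters u = concat (map (\<lambda>a. binary a @ [3]) u)"

definition enc_words :: "nat list list \<Rightarrow> nat list" where
  "enc_words us = concat (map (\<lambda>u. enc_letters u @ [4]) us)"

definition encodes :: "nat list \<Rightarrow> wordle \<Rightarrow> bool" where
  "encodes x WI \<longleftrightarrow> (\<exists>as ds ws.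
     distinct as \<and> set as = alphabet WI \<and>
     distinct ds \<and> set ds = dictionary WI \<and>
     distinct ws \<and> set ws = word_list WI \<and>
     x = enc_letters as @ [5] @ binary (dimension WI) @ [5] @ enc_words ds @ [5] @
         enc_words ws @ [5] @ binary (game_length WI) @ [5])"

section \<open>Deterministic multi-tape Turing machines\<close>

text \<open>
  The states are the numbers below \<open>tm_states\<close>, with start state 0, and the tape symbols are the
  numbers below \<open>tm_symbols\<close>. Only the values of the transition function on such states and on
  lists of \<open>tm_tapes\<close> such symbols matter, so a machine is a finite object.
\<close>

datatype move = MoveLeft | Stay | MoveRight

record tm =
  tm_tapes :: nat
  tm_states :: nat
  tm_symbols :: nat
  tm_accept :: nat
  tm_reject :: nat
  tm_delta :: "nat \<Rightarrow> nat list \<Rightarrow> nat \<times> (nat \<times> move) list"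

text \<open>The bound 6 makes room for the blank and the five input symbols.\<close>

definition turing_machine :: "tm \<Rightarrow> bool" where
  "turing_machine M \<longleftrightarrow>
     tm_tapes M > 0 \<and> tm_states M > 0 \<and> tm_symbols M \<ge> 6 \<and>
     tm_accept M < tm_states M \<and> tm_reject M < tm_states M \<and> tm_accept M \<noteq> tm_reject M \<and>
     (\<forall>q ss. q < tm_states M \<and> length ss = tm_tapes M \<and> set ss \<subseteq> {..<tm_symbols M} \<longrightarrow>
        (case tm_delta M q ss of (q', acts) \<Rightarrow>
           q' < tm_states M \<and> length acts = tm_tapes M \<and> fst ` set acts \<subseteq> {..<tm_symbols M}))"

text \<open>A tape is infinite in both directions and is given by its contents and its head position.\<close>

type_synonym tape = "(int \<Rightarrow> nat) \<times> int"
type_synonym tm_config = "nat \<times> tape list"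

fun tm_read :: "tape \<Rightarrow> nat" where
  "tm_read (f, p) = f p"

fun tm_act :: "nat \<times> move \<Rightarrow> tape \<Rightarrow> tape" where
  "tm_act (s, m) (f, p) =
     (f(p := s), case m of MoveLeft \<Rightarrow> p - 1 | Stay \<Rightarrow> p | MoveRight \<Rightarrow> p + 1)"

definition tm_halted :: "tm \<Rightarrow> tm_config \<Rightarrow> bool" where
  "tm_halted M c \<longleftrightarrow> fst c \<in> {tm_accept M, tm_reject M}"

definition tm_step :: "tm \<Rightarrow> tm_config \<Rightarrow> tm_config" where
  "tm_step M c =
     (if tm_halted M c then c
      else case tm_delta M (fst c) (map tm_read (snd c)) of
        (q', acts) \<Rightarrow> (q', map2 tm_act acts (snd c)))"

definition input_tape :: "nat list \<Rightarrow> tape" where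
  "input_tape x = ((\<lambda>p. if 0 \<le> p \<and> p < int (length x) then x ! nat p else 0), 0)"

definition tm_run :: "tm \<Rightarrow> nat list \<Rightarrow> nat \<Rightarrow> tm_config" where
  "tm_run M x t =
     (tm_step M ^^ t) (0, input_tape x # replicate (tm_tapes M - 1) (input_tape []))"

definition tm_halts :: "tm \<Rightarrow> nat list \<Rightarrow> bool" where
  "tm_halts M x \<longleftrightarrow> (\<exists>t. tm_halted M (tm_run M x t))"

definition tm_accepts :: "tm \<Rightarrow> nat list \<Rightarrow> bool" where
  "tm_accepts M x \<longleftrightarrow> (\<exists>t. fst (tm_run M x t) = tm_accept M)"

text \<open>Time and space are meaningful for halting computations only.\<close>

definition tm_time :: "tm \<Rightarrow> nat list \<Rightarrow> nat" where
  "tm_time M x = (LEAST t. tm_halted M (tm_run M x t))"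

text \<open>Space is the number of cells visited, added up over all tapes, the input tape included.\<close>

definition tm_space :: "tm \<Rightarrow> nat list \<Rightarrow> nat" where
  "tm_space M x =
     (\<Sum>i<tm_tapes M. card ((\<lambda>t. snd (snd (tm_run M x t) ! i)) ` {..tm_time M x}))"

end

theory Submission
  imports Defs
begin

text \<open>
  Whether a winning strategy exists is a game with alternating choices: in each round the player
  chooses a query and the opponent a target whose response is given. After all rounds the player has
  won if no word outside the queries is consistent with all responses. All branches of this game tree
  have length \<open>g\<close>, so it can be evaluated by running through its leaves in lexicographic order with
  short-circuiting, and a leaf is stored by two marked positions in each of \<open>g\<close> copies of the input.

  A Turing machine copies the input \<open>g\<close> times and then only sweeps over these copies from left to
  right, changing marks on a fixed number of tracks, so its space is linear in \<open>g |WI|\<close>. The value of a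
  leaf and the next leaf are definable by first-order formulas with counting over the positions of the
  tape. Such formulas are evaluated by polynomially many sweeps, where each variable is a track, and
  there are at most \<open>|WI| ^ (2 g)\<close> leaves.
\<close>

section \<open>Sweeping programs and their realization by a two-tape machine\<close>

text \<open>The game length is part of the input and written in binary, so it can be exponential in
  \<open>|WI|\<close> and exceeds the number of tracks of any fixed machine. Marks for
  \<open>g\<close> rounds therefore cannot all lie over one copy of the input; with a copy per round
  two marks per copy are enough, and the price of \<open>g |WI|\<close> cells is just what the space
  bound grants. Values of inner nodes are not stored, nor are the words that survive a round. After
  a leaf, the next one depends only on the leaf and its value, and the value of the last leaf
  visited is the value of the game. Letters have codes of various lengths, so the index of a letter
  is not visible in its position; indices and the counts in the oracle are both handled by comparing
  cardinalities, hence the counting formulas. Polynomial factors in \<open>N = g |WI|\<close> are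
  harmless: since \<open>|WI| \<ge> 2\<close>, one has
  \<open>N + 1 \<le> |WI| ^ (2 g)\<close>.\<close>

type_synonym cell = "nat \<times> nat set"
text \<open>The two bits are the state of the sweep: the first one is its answer at the end, the
  second one is scratch memory. No sweep below has to remember more than two facts.\<close>

type_synonym pass = "bool \<times> bool \<Rightarrow> cell \<Rightarrow> (bool \<times> bool) \<times> cell"

fun sweep :: "pass \<Rightarrow> bool \<times> bool \<Rightarrow> cell list \<Rightarrow> (bool \<times> bool) \<times> cell list" where
  "sweep \<delta> q [] = (q, [])"
| "sweep \<delta> q (c # cs) =
     (fst (sweep \<delta> (fst (\<delta> q c)) cs), snd (\<delta> q c) # snd (sweep \<delta> (fst (\<delta> q c)) cs))"

datatype prog = Pass pass | Cond prog prog prog | Loop prog prog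

text \<open>The number counts sweeps; each of them takes time linear in the tape. Tests are programs
  themselves and may change the tape, so a branch or a loop body starts from the tape that the test
  leaves behind.\<close>

inductive exec :: "prog \<Rightarrow> cell list \<Rightarrow> nat \<Rightarrow> cell list \<Rightarrow> bool \<Rightarrow> bool" where
  Pass: "sweep \<delta> (False, False) T = (q, T') \<Longrightarrow> exec (Pass \<delta>) T 1 T' (fst q)"
| Cond: "exec c T n1 T1 v \<Longrightarrow> exec (if v then a else b) T1 n2 T2 w \<Longrightarrow> exec (Cond c a b) T (n1 + n2) T2 w"
| LoopF: "exec c T n T1 False \<Longrightarrow> exec (Loop c a) T n T1 False"
| LoopT: "exec c T n1 T1 True \<Longrightarrow> exec a T1 n2 T2 v \<Longrightarrow> exec (Loop c a) T2 n3 T3 w \<Longrightarrow>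
    exec (Loop c a) T (n1 + n2 + n3) T3 w"

text \<open>
  The control states of the machine are the continuations of the program: the sweep to be made next
  and a stack of what remains to be done after it. Only finitely many of them are reachable.
\<close>

datatype frame = Branch prog prog | Test prog prog | Body prog prog

datatype ctl = Sweep pass "frame list" | Halt bool

fun enter :: "prog \<Rightarrow> frame list \<Rightarrow> ctl" where
  "enter (Pass \<delta>) k = Sweep \<delta> k"
| "enter (Cond c a b) k = enter c (Branch a b # k)"
| "enter (Loop c a) k = enter c (Test c a # k)"

fun resume :: "bool \<Rightarrow> frame list \<Rightarrow> ctl" where
  "resume v [] = Halt v"
| "resume v (Branch a b # k) = enter (if v then a else b) k"
| "resume v (Test c a # k) = (if v then enter a (Body c a # k) else resume False k)"
| "resume v (Body c a # k) = enter c (Test c a # k)"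

text \<open>Recursion on the program makes finiteness evident although loops run arbitrarily long:
  the stack grows only with the nesting depth of the program.\<close>

fun points :: "prog \<Rightarrow> frame list \<Rightarrow> ctl set" where
  "points (Pass \<delta>) k = {Sweep \<delta> k}"
| "points (Cond c a b) k = points c (Branch a b # k) \<union> points a k \<union> points b k"
| "points (Loop c a) k = points c (Test c a # k) \<union> points a (Body c a # k)"

lemma finite_points: "finite (points c k)"
  by (induction c arbitrary: k) auto

lemma enter_points: "enter c k \<in> points c k"
  by (induction c arbitrary: k) auto

text \<open>Every frame pushed by \<open>c\<close> resumes at the entry of a subprogram of
  \<open>c\<close>; only when these frames are used up does control pass to \<open>k\<close>. This
  closure property yields a finite set of machine states.\<close>

lemma resume_points:
  "Sweep \<delta> k' \<in> points c k \<Longrightarrow> resume v k' \<in> points c k \<union> {resume True k, resume False k}"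
proof (induction c arbitrary: k)
  case (Pass x)
  then show ?case by (cases v) auto
next
  case (Cond c a b)
  from Cond.prems consider "Sweep \<delta> k' \<in> points c (Branch a b # k)" | "Sweep \<delta> k' \<in> points a k"
    | "Sweep \<delta> k' \<in> points b k" by auto
  then show ?case
    using Cond.IH(1)[of "Branch a b # k"] Cond.IH(2)[of k] Cond.IH(3)[of k]
      enter_points[of a k] enter_points[of b k]
    by cases auto
next
  case (Loop c a)
  from Loop.prems consider "Sweep \<delta> k' \<in> points c (Test c a # k)" | "Sweep \<delta> k' \<in> points a (Body c a # k)"
    by auto
  then show ?case
    using Loop.IH(1)[of "Test c a # k"] Loop.IH(2)[of "Body c a # k"]
      enter_points[of c "Test c a # k"] enter_points[of a "Body c a # k"]
    by cases auto
qed

fun macro_step :: "ctl \<times> cell list \<Rightarrow> ctl \<times> cell list" where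
  "macro_step (Sweep \<delta> k, T) =
     (resume (fst (fst (sweep \<delta> (False, False) T))) k, snd (sweep \<delta> (False, False) T))"
| "macro_step (Halt v, T) = (Halt v, T)"

text \<open>One macro step per sweep. Each rule of \<open>exec\<close> corresponds to pushing one
  frame, so the induction hypotheses are used with longer stacks and \<open>k\<close> has to stay
  arbitrary.\<close>

lemma macro_steps_exec: "exec c T n T' v \<Longrightarrow> (macro_step ^^ n) (enter c k, T) = (resume v k, T')"
proof (induction arbitrary: k rule: exec.induct)
  case (Pass \<delta> T q T')
  then show ?case by simp
next
  case (Cond c T n1 T1 v a b n2 T2 w)
  have "(macro_step ^^ (n2 + n1)) (enter (Cond c a b) k, T) = (resume w k, T2)"
    using Cond.IH(1)[of "Branch a b # k"] Cond.IH(2)[of k] by (simp add: funpow_add)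
  then show ?case by (simp add: add.commute)
next
  case (LoopF c T n T1 a)
  then show ?case using LoopF.IH[of "Test c a # k"] by simp
next
  case (LoopT c T n1 T1 a n2 T2 v n3 T3 w)
  have "(macro_step ^^ (n3 + (n2 + n1))) (enter (Loop c a) k, T) = (resume w k, T3)"
    using LoopT.IH(1)[of "Test c a # k"] LoopT.IH(2)[of "Body c a # k"] LoopT.IH(3)[of k]
    by (simp add: funpow_add)
  then show ?case by (simp add: ac_simps)
qed

section \<open>Finiteness of the tape alphabet\<close>

definition bounded_pass :: "nat \<Rightarrow> pass \<Rightarrow> bool" where
  "bounded_pass m \<delta> \<longleftrightarrow>
     (\<forall>q c. fst (snd (\<delta> q c)) = fst c \<and> snd (snd (\<delta> q c)) \<subseteq> snd c \<union> {..<m})"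

lemma bounded_pass_mono: "bounded_pass m \<delta> \<Longrightarrow> m \<le> m' \<Longrightarrow> bounded_pass m' \<delta>"
  unfolding bounded_pass_def
  by (metis (no_types, lifting) Un_mono lessThan_subset_iff order_refl order_trans)

fun bounded_prog :: "nat \<Rightarrow> prog \<Rightarrow> bool" where
  "bounded_prog m (Pass \<delta>) \<longleftrightarrow> bounded_pass m \<delta>"
| "bounded_prog m (Cond c a b) \<longleftrightarrow> bounded_prog m c \<and> bounded_prog m a \<and> bounded_prog m b"
| "bounded_prog m (Loop c a) \<longleftrightarrow> bounded_prog m c \<and> bounded_prog m a"

lemma bounded_prog_mono: "bounded_prog m c \<Longrightarrow> m \<le> m' \<Longrightarrow> bounded_prog m' c"
  by (induction c) (auto intro: bounded_pass_mono)

text \<open>There are 36 labels: a symbol below 6 combined with a field number from 0 to 5.\<close>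

definition cells :: "nat \<Rightarrow> cell set" where
  "cells m = {..<36} \<times> Pow {..<m}"

lemma points_bounded:
  "Sweep \<delta> k' \<in> points c k \<Longrightarrow> bounded_prog m c \<Longrightarrow> bounded_pass m \<delta>"
  by (induction c arbitrary: k) auto

lemma sweep_cells:
  assumes "bounded_pass m \<delta>" "set T \<subseteq> cells m"
  shows "set (snd (sweep \<delta> q T)) \<subseteq> cells m"
  using assms(2)
proof (induction T arbitrary: q)
  case Nil
  then show ?case by simp
next
  case (Cons c T)
  have "fst (snd (\<delta> q c)) = fst c" "snd (snd (\<delta> q c)) \<subseteq> snd c \<union> {..<m}"
    using assms(1) unfolding bounded_pass_def by blast+
  then have "snd (\<delta> q c) \<in> cells m"
    using Cons.prems by (cases c; cases "snd (\<delta> q c)") (auto simp: cells_def)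
  then show ?case using Cons by simp
qed

lemma length_sweep [simp]: "length (snd (sweep \<delta> q T)) = length T"
  by (induction T arbitrary: q) auto

section \<open>Tapes, runs and the copying of the input\<close>

definition tape_of :: "nat list \<Rightarrow> int \<Rightarrow> nat" where
  "tape_of xs p = (if 0 \<le> p \<and> p < int (length xs) then xs ! nat p else 0)"

lemma input_tape_eq: "input_tape x = (tape_of x, 0)"
  by (auto simp: input_tape_def tape_of_def)

lemma tape_of_mid [simp]: "tape_of (xs @ a # ys) (int (length xs)) = a"
  by (simp add: tape_of_def)

lemma tape_of_upd [simp]: "(tape_of (xs @ a # ys))(int (length xs) := b) = tape_of (xs @ b # ys)"
  by (rule ext) (auto simp: tape_of_def nth_append nth_Cons' nat_eq_iff)

lemma tape_of_snoc: "(tape_of xs)(int (length xs) := b) = tape_of (xs @ [b])"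
  by (rule ext) (auto simp: tape_of_def nth_append nat_eq_iff)

lemma tape_of_end [simp]: "tape_of xs (int (length xs)) = 0" "tape_of xs (-1) = 0"
  by (auto simp: tape_of_def)

text \<open>The invariant covers all intermediate configurations because the space bound counts
  every head position of the run.\<close>

definition reach :: "('c \<Rightarrow> bool) \<Rightarrow> ('c \<Rightarrow> 'c) \<Rightarrow> nat \<Rightarrow> 'c \<Rightarrow> 'c \<Rightarrow> bool" where
  "reach I f t c c' \<longleftrightarrow> (f ^^ t) c = c' \<and> (\<forall>s\<le>t. I ((f ^^ s) c))"

lemma reach_refl: "I c \<Longrightarrow> reach I f 0 c c"
  by (simp add: reach_def)

lemma reach_trans:
  assumes "reach I f s a b" "reach I f t b c"
  shows "reach I f (s + t) a c"
proof -
  have eq: "(f ^^ (s + r)) a = (f ^^ r) b" for r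
    using assms(1) by (subst add.commute) (simp add: reach_def funpow_add)
  have "I ((f ^^ r) a)" if "r \<le> s + t" for r
  proof (cases "r \<le> s")
    case False
    then have "(f ^^ r) a = (f ^^ (r - s)) b" using eq[of "r - s"] by simp
    then show ?thesis using assms(2) False that by (simp add: reach_def)
  qed (use assms(1) in \<open>simp add: reach_def\<close>)
  then show ?thesis using assms(2) eq[of t] by (simp add: reach_def)
qed

lemma reach_step: "I c \<Longrightarrow> reach I f t (f c) c' \<Longrightarrow> reach I f (Suc t) c c'"
proof -
  assume "I c" and r: "reach I f t (f c) c'"
  moreover have "I (f c)" using r by (force simp: reach_def)
  ultimately have "reach I f 1 c (f c)" by (auto simp: reach_def le_Suc_eq)
  from reach_trans[OF this r] show ?thesis by simp
qed

text \<open>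
  A copying pass moves the input to the end of the second tape and decrements the game length on
  the first tape in place, which works from left to right because the least significant digit comes
  first; \<open>Copy f bo nz\<close> remembers the current field, the pending borrow and whether a nonzero digit
  has been seen.
\<close>

datatype state =
    Copy nat bool bool
  | Rewind
  | Back ctl
  | Run pass "frame list" "bool \<times> bool"
  | Final bool

fun start :: "ctl \<Rightarrow> state" where
  "start (Sweep \<delta> k) = Run \<delta> k (False, False)"
| "start (Halt v) = Final v"

text \<open>Field 4 is the game length, and the symbols 1 and 2 are the digits zero and one. The
  flag \<open>nz\<close> concerns the digits written, so at the end it tells whether the decremented
  number is positive, that is, whether another copy is due. No digit is ever removed, so all copies
  have the same length.\<close>

definition decrement :: "nat \<Rightarrow> bool \<Rightarrow> bool \<Rightarrow> nat \<Rightarrow> nat \<times> bool \<times> bool" where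
  "decrement f bo nz a =
     (if f = 4 \<and> a \<in> {1, 2}
      then if bo then if a = 2 then (1, False, nz) else (2, True, True) else (a, False, nz \<or> a = 2)
      else (a, bo, nz))"

definition next_field :: "nat \<Rightarrow> nat \<Rightarrow> nat" where
  "next_field f a = (if a = 5 then min 5 (Suc f) else f)"

text \<open>
  A label combines a symbol with the number of its field. The digits of the game length change
  during the copying, so all of them get the label of the digit zero to make the copies equal.
\<close>

definition label :: "nat \<Rightarrow> nat \<Rightarrow> nat" where
  "label f a = (if f = 4 \<and> a \<noteq> 5 then 1 else a) + 6 * f"

fun labels :: "nat \<Rightarrow> nat list \<Rightarrow> nat list" where
  "labels f [] = []"
| "labels f (a # as) = label f a # labels (next_field f a) as"

fun decrements :: "nat \<Rightarrow> bool \<Rightarrow> bool \<Rightarrow> nat list \<Rightarrow> nat list" where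
  "decrements f bo nz [] = []"
| "decrements f bo nz (a # as) = (let d = decrement f bo nz a in
     fst d # decrements (next_field f a) (fst (snd d)) (snd (snd d)) as)"

fun nonzero :: "nat \<Rightarrow> bool \<Rightarrow> bool \<Rightarrow> nat list \<Rightarrow> bool" where
  "nonzero f bo nz [] = nz"
| "nonzero f bo nz (a # as) = (let d = decrement f bo nz a in
     nonzero (next_field f a) (fst (snd d)) (snd (snd d)) as)"

lemma length_decrements [simp]: "length (decrements f bo nz xs) = length xs"
  by (induction xs arbitrary: f bo nz) (auto simp: Let_def)

lemma labels_decrements: "labels f (decrements f bo nz xs) = labels f xs"
  by (induction xs arbitrary: f bo nz)
    (auto simp: Let_def label_def next_field_def decrement_def)

lemma decrements_skip:
  assumes "5 \<notin> set A" "f < 4"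
  shows "decrements f bo nz (A @ 5 # r) = A @ 5 # decrements (Suc f) bo nz r"
    and "nonzero f bo nz (A @ 5 # r) = nonzero (Suc f) bo nz r"
  using assms by (induction A) (auto simp: Let_def next_field_def decrement_def)

lemma decrements_fields:
  assumes "5 \<notin> set (A @ B @ C @ D)"
  shows "decrements 0 bo nz (A @ 5 # B @ 5 # C @ 5 # D @ 5 # r) = A @ 5 # B @ 5 # C @ 5 # D @ 5 # decrements 4 bo nz r"
    and "nonzero 0 bo nz (A @ 5 # B @ 5 # C @ 5 # D @ 5 # r) = nonzero 4 bo nz r"
proof -
  have four: "Suc (Suc (Suc (Suc 0))) = 4" by simp
  show "decrements 0 bo nz (A @ 5 # B @ 5 # C @ 5 # D @ 5 # r) = A @ 5 # B @ 5 # C @ 5 # D @ 5 # decrements 4 bo nz r"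
    "nonzero 0 bo nz (A @ 5 # B @ 5 # C @ 5 # D @ 5 # r) = nonzero 4 bo nz r"
    using assms by (simp_all add: decrements_skip four)
qed

text \<open>In contrast to the lists produced by \<open>binary\<close>, zeros at the most
  significant end are allowed here; repeated decrements create them.\<close>

fun digits_value :: "nat list \<Rightarrow> nat" where
  "digits_value [] = 0"
| "digits_value (a # as) = (a - 1) + 2 * digits_value as"

lemma decrements_no_borrow:
  assumes "set ds \<subseteq> {1, 2}"
  shows "decrements 4 False nz (ds @ [5]) = ds @ [5]"
    and "nonzero 4 False nz (ds @ [5]) \<longleftrightarrow> nz \<or> digits_value ds > 0"
  using assms by (induction ds arbitrary: nz) (auto simp: Let_def next_field_def decrement_def)

text \<open>While the borrow is pending, zeros become ones, by
  \<open>2 v - 1 = 1 + 2 (v - 1)\<close>; as the value is positive, some digit one absorbs the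
  borrow, and from there on nothing changes.\<close>

lemma decrements_borrow:
  assumes "set ds \<subseteq> {1, 2}" "digits_value ds > 0"
  shows "\<exists>ds'. decrements 4 True nz (ds @ [5]) = ds' @ [5] \<and> set ds' \<subseteq> {1, 2} \<and>
    digits_value ds' = digits_value ds - 1 \<and>
    (nonzero 4 True nz (ds @ [5]) \<longleftrightarrow> nz \<or> digits_value ds' > 0)"
  using assms
proof (induction ds arbitrary: nz)
  case (Cons a ds)
  show ?case
  proof (cases "a = 2")
    case True
    then show ?thesis using Cons.prems
      by (intro exI[of _ "1 # ds"])
        (auto simp: Let_def next_field_def decrement_def decrements_no_borrow)
  next
    case False
    then have a: "a = 1" using Cons.prems by auto
    then obtain ds' where "decrements 4 True True (ds @ [5]) = ds' @ [5]" "set ds' \<subseteq> {1, 2}"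
      "digits_value ds' = digits_value ds - 1" "nonzero 4 True True (ds @ [5])"
      using Cons.IH[of True] Cons.prems by auto
    then show ?thesis using a Cons.prems
      by (intro exI[of _ "2 # ds'"]) (auto simp: Let_def next_field_def decrement_def)
  qed
qed simp

lemma length_labels [simp]: "length (labels f xs) = length xs"
  by (induction xs arbitrary: f) auto

lemma labels_less: "set xs \<subseteq> {1..5} \<Longrightarrow> f \<le> 5 \<Longrightarrow> set (labels f xs) \<subseteq> {..<36}"
  by (induction xs arbitrary: f) (auto simp: label_def next_field_def)

section \<open>The two-tape machine of a program\<close>

text \<open>Codes of cells are positive, so that the blank 0 delimits the contents of the second
  tape on both sides.\<close>

locale simulation =
  fixes P :: prog and m :: nat and code :: "cell \<Rightarrow> nat" and cell_of :: "nat \<Rightarrow> cell" and K :: nat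
  assumes bounded: "bounded_prog m P"
    and code: "c \<in> cells m \<Longrightarrow> 0 < code c \<and> code c < K \<and> cell_of (code c) = c"
    and cell_of: "0 < b \<Longrightarrow> b < K \<Longrightarrow> cell_of b \<in> cells m"
    and K: "6 \<le> K"
begin

text \<open>\<open>turing_machine\<close> demands legal output for every symbol below
  \<open>K\<close>, also for those that are no input symbols; \<open>min 35\<close> keeps the label,
  and with it the code, in range. The first head stays where it is once the copying is
  finished.\<close>

definition delta :: "state \<Rightarrow> nat list \<Rightarrow> state \<times> (nat \<times> move) list" where
  "delta s ss = (let a = ss ! 0; b = ss ! 1 in case s of
     Copy f bo nz \<Rightarrow>
       if a = 0 then
         if nz then (Rewind, [(a, MoveLeft), (b, Stay)])
         else (Back (enter P []), [(a, Stay), (b, MoveLeft)])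
       else let d = decrement f bo nz a in (Copy (next_field f a) (fst (snd d)) (snd (snd d)),
         [(fst d, MoveRight), (code (min 35 (label f a), {}), MoveRight)])
   | Rewind \<Rightarrow>
       if a = 0 then (Copy 0 True False, [(a, MoveRight), (b, Stay)])
       else (Rewind, [(a, MoveLeft), (b, Stay)])
   | Back j \<Rightarrow>
       if b = 0 then (start j, [(a, Stay), (b, MoveRight)])
       else (Back j, [(a, Stay), (b, MoveLeft)])
   | Run \<delta> k q \<Rightarrow>
       if b = 0 then (Back (resume (fst q) k), [(a, Stay), (b, MoveLeft)])
       else let r = \<delta> q (cell_of b) in (Run \<delta> k (fst r), [(a, Stay), (code (snd r), MoveRight)])
   | Final v \<Rightarrow> (Final v, [(a, Stay), (b, Stay)]))"

definition controls :: "ctl set" where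
  "controls = points P [] \<union> {Halt True, Halt False}"

definition states :: "state set" where
  "states = (\<lambda>(f, bo, nz). Copy f bo nz) ` ({..5} \<times> UNIV \<times> UNIV) \<union> {Rewind} \<union> Back ` controls \<union>
     {Run \<delta> k q | \<delta> k q. Sweep \<delta> k \<in> controls} \<union> range Final"

lemma finite_states: "finite states"
proof -
  have fin: "finite controls" by (simp add: controls_def finite_points)
  have "{Run \<delta> k q | \<delta> k q. Sweep \<delta> k \<in> controls} \<subseteq>
    (\<lambda>(j, q). case j of Sweep \<delta> k \<Rightarrow> Run \<delta> k q | Halt v \<Rightarrow> Final v) ` (controls \<times> UNIV)"
    by (force split: ctl.splits)
  then have "finite {Run \<delta> k q | \<delta> k q. Sweep \<delta> k \<in> controls}"
    by (rule finite_subset) (simp add: fin)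
  then show ?thesis by (simp add: states_def fin)
qed

lemma Copy_states: "Copy f bo nz \<in> states \<longleftrightarrow> f \<le> 5"
  by (auto simp: states_def image_iff)

lemma Rewind_states: "Rewind \<in> states"
  by (auto simp: states_def)

lemma Back_states: "Back j \<in> states \<longleftrightarrow> j \<in> controls"
  by (auto simp: states_def)

lemma Run_states: "Run \<delta> k q \<in> states \<longleftrightarrow> Sweep \<delta> k \<in> controls"
  by (auto simp: states_def)

lemma Final_states: "Final v \<in> states"
  by (simp add: states_def)

lemma start_states: "j \<in> controls \<Longrightarrow> start j \<in> states"
  by (cases j) (auto simp: Run_states Final_states)

lemma resume_controls: "Sweep \<delta> k \<in> controls \<Longrightarrow> resume v k \<in> controls"
  using resume_points[of \<delta> k P "[]" v] by (auto simp: controls_def)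

lemma enter_controls: "enter P [] \<in> controls"
  by (simp add: controls_def enter_points)

lemma delta_states: "s \<in> states \<Longrightarrow> fst (delta s ss) \<in> states"
  by (cases s) (simp_all add: delta_def Let_def Copy_states Rewind_states Back_states Run_states
      Final_states start_states resume_controls enter_controls next_field_def)

lemma controls_cells:
  assumes "Sweep \<delta> k \<in> controls" "c \<in> cells m"
  shows "snd (\<delta> q c) \<in> cells m"
proof -
  have "bounded_pass m \<delta>"
    using assms(1) points_bounded[OF _ bounded] by (auto simp: controls_def)
  then show ?thesis using sweep_cells[of m \<delta> "[c]" q] assms(2) by simp
qed

lemma delta_symbols:
  assumes "s \<in> states" "ss ! 0 < K" "ss ! 1 < K"
  shows "length (snd (delta s ss)) = 2" "fst ` set (snd (delta s ss)) \<subseteq> {..<K}"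
proof -
  have lab: "code (min 35 (label f a), {}) < K" for f a
    using code[of "(min 35 (label f a), {})"] by (auto simp: cells_def)
  have dec: "fst (decrement f bo nz (ss ! 0)) < K" for f bo nz
    using assms(2) K by (auto simp: decrement_def)
  have sym: "code (snd (\<delta> q (cell_of (ss ! 1)))) < K" if "s = Run \<delta> k q" "ss ! 1 > 0" for \<delta> k q
    using controls_cells[of \<delta> k "cell_of (ss ! 1)" q] assms that code cell_of
    by (simp add: Run_states)
  show "length (snd (delta s ss)) = 2"
    by (cases s) (simp_all add: delta_def Let_def)
  show "fst ` set (snd (delta s ss)) \<subseteq> {..<K}"
    using assms(2,3) lab dec sym
    by (cases s) (simp_all add: delta_def Let_def)
qed

definition step :: "state \<times> tape list \<Rightarrow> state \<times> tape list" where
  "step c = (if fst c \<in> range Final then c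
     else (fst (delta (fst c) (map tm_read (snd c))),
       map2 tm_act (snd (delta (fst c) (map tm_read (snd c)))) (snd c)))"

lemma step_Final: "fst c = Final v \<Longrightarrow> step c = c"
  by (simp add: step_def)

text \<open>A head leaves its data only onto the blank next to either end, hence the lower bound -1
  and later the counts \<open>n + 2\<close> and \<open>N + 2\<close> of visited cells.\<close>

fun within :: "nat \<Rightarrow> nat \<Rightarrow> state \<times> tape list \<Rightarrow> bool" where
  "within n N (s, ts) \<longleftrightarrow> length ts = 2 \<and>
     snd (ts ! 0) \<in> {- 1..int n} \<and> snd (ts ! 1) \<in> {- 1..int N}"

abbreviation steps :: "nat \<Rightarrow> nat \<Rightarrow> nat \<Rightarrow> state \<times> tape list \<Rightarrow> state \<times> tape list \<Rightarrow> bool" where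
  "steps n N \<equiv> reach (within n N) step"

lemma step_intro:
  assumes "within n N c" "step c = c'" "steps n N t c' c''"
  shows "steps n N (Suc t) c c''"
  using reach_step[of "within n N" c step t c''] assms by simp

lemma copy_steps:
  assumes "set ys \<subseteq> {1..5}" "f \<le> 5" "length xs + length ys \<le> n" "length zs + length ys \<le> N"
  shows "\<exists>f' bo'. steps n N (length ys)
    (Copy f bo nz, [(tape_of (xs @ ys), int (length xs)), (tape_of zs, int (length zs))])
    (Copy f' bo' (nonzero f bo nz ys),
      [(tape_of (xs @ decrements f bo nz ys), int (length xs + length ys)),
       (tape_of (zs @ map (\<lambda>b. code (b, {})) (labels f ys)), int (length zs + length ys))])"
  using assms
proof (induction ys arbitrary: f bo nz xs zs)
  case Nil
  then show ?case by (auto intro!: exI reach_refl)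
next
  case (Cons a ys)
  define d where "d = decrement f bo nz a"
  have f: "next_field f a \<le> 5" "label f a \<le> 35" "a \<noteq> 0"
    using Cons.prems by (auto simp: next_field_def label_def)
  obtain f' bo' where
    *: "steps n N (length ys)
     (Copy (next_field f a) (fst (snd d)) (snd (snd d)),
       [(tape_of ((xs @ [fst d]) @ ys), int (length (xs @ [fst d]))),
        (tape_of (zs @ [code (label f a, {})]), int (length (zs @ [code (label f a, {})])))])
     (Copy f' bo' (nonzero (next_field f a) (fst (snd d)) (snd (snd d)) ys),
       [(tape_of ((xs @ [fst d]) @ decrements (next_field f a) (fst (snd d)) (snd (snd d)) ys),
          int (length (xs @ [fst d]) + length ys)),
        (tape_of ((zs @ [code (label f a, {})]) @ map (\<lambda>b. code (b, {})) (labels (next_field f a) ys)),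
          int (length (zs @ [code (label f a, {})]) + length ys))])"
    using Cons.IH[of "next_field f a" "xs @ [fst d]" "zs @ [code (label f a, {})]" "fst (snd d)" "snd (snd d)"]
      Cons.prems f
    by (auto simp del: append_assoc)
  have st: "step (Copy f bo nz, [(tape_of (xs @ a # ys), int (length xs)), (tape_of zs, int (length zs))]) =
     (Copy (next_field f a) (fst (snd d)) (snd (snd d)),
       [(tape_of ((xs @ [fst d]) @ ys), int (length (xs @ [fst d]))),
        (tape_of (zs @ [code (label f a, {})]), int (length (zs @ [code (label f a, {})])))])"
    using f by (auto simp: step_def delta_def d_def Let_def tape_of_snoc min_def)
  have "within n N (Copy f bo nz, [(tape_of (xs @ a # ys), int (length xs)), (tape_of zs, int (length zs))])"
    using Cons.prems by simp
  from step_intro[OF this st *] show ?case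
    by (intro exI[of _ f'] exI[of _ bo']) (simp add: Let_def d_def[symmetric])
qed

text \<open>From cell \<open>k - 1\<close>, \<open>k\<close> moves to the left reach the blank at
  -1, and one more step turns around there.\<close>

lemma rewind_steps:
  assumes "0 \<notin> set xs" "k \<le> length xs" "length xs \<le> n" "q \<in> {- 1..int N}"
  shows "steps n N (k + 1) (Rewind, [(tape_of xs, int k - 1), (h, q)])
    (Copy 0 True False, [(tape_of xs, 0), (h, q)])"
  using assms(2)
proof (induction k)
  case 0
  have "step (Rewind, [(tape_of xs, int 0 - 1), (h, q)]) = (Copy 0 True False, [(tape_of xs, 0), (h, q)])"
    by (simp add: step_def delta_def image_iff) (auto simp: tape_of_def)
  then show ?case
    using assms by (intro step_intro[OF _ _ reach_refl] | simp)+
next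
  case (Suc k)
  have "tape_of xs (int k) \<noteq> 0"
    using assms(1) Suc.prems by (simp add: tape_of_def) (metis nth_mem Suc_le_eq not_gr_zero)
  then have "step (Rewind, [(tape_of xs, int (Suc k) - 1), (h, q)]) = (Rewind, [(tape_of xs, int k - 1), (h, q)])"
    by (simp add: step_def delta_def image_iff)
  from step_intro[OF _ this, of n N "k + 1"] show ?case
    using assms Suc by simp
qed

lemma back_steps:
  assumes "0 \<notin> set xs" "k \<le> length xs" "length xs \<le> N" "q \<in> {- 1..int n}"
  shows "steps n N (k + 1) (Back j, [(h, q), (tape_of xs, int k - 1)]) (start j, [(h, q), (tape_of xs, 0)])"
  using assms(2)
proof (induction k)
  case 0
  have "step (Back j, [(h, q), (tape_of xs, int 0 - 1)]) = (start j, [(h, q), (tape_of xs, 0)])"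
    by (simp add: step_def delta_def image_iff) (auto simp: tape_of_def)
  then show ?case
    using assms by (intro step_intro[OF _ _ reach_refl] | simp)+
next
  case (Suc k)
  have "tape_of xs (int k) \<noteq> 0"
    using assms(1) Suc.prems by (simp add: tape_of_def) (metis nth_mem Suc_le_eq not_gr_zero)
  then have "step (Back j, [(h, q), (tape_of xs, int (Suc k) - 1)]) = (Back j, [(h, q), (tape_of xs, int k - 1)])"
    by (simp add: step_def delta_def image_iff)
  from step_intro[OF _ this, of n N "k + 1"] show ?case
    using assms Suc by simp
qed

lemma run_steps:
  assumes "Sweep \<delta> k \<in> controls" "set ys \<subseteq> cells m" "length xs + length ys \<le> N" "p \<in> {- 1..int n}"
  shows "steps n N (length ys)
    (Run \<delta> k q, [(h, p), (tape_of (map code (xs @ ys)), int (length xs))])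
    (Run \<delta> k (fst (sweep \<delta> q ys)),
      [(h, p), (tape_of (map code (xs @ snd (sweep \<delta> q ys))), int (length xs + length ys))])"
  using assms(2,3)
proof (induction ys arbitrary: q xs)
  case Nil
  then show ?case using assms(4) by (auto intro!: reach_refl)
next
  case (Cons c ys)
  define r where "r = \<delta> q c"
  have c: "0 < code c" "cell_of (code c) = c" using code[of c] Cons.prems by auto
  have *: "steps n N (length ys)
    (Run \<delta> k (fst r), [(h, p), (tape_of (map code ((xs @ [snd r]) @ ys)), int (length (xs @ [snd r])))])
    (Run \<delta> k (fst (sweep \<delta> (fst r) ys)),
      [(h, p), (tape_of (map code ((xs @ [snd r]) @ snd (sweep \<delta> (fst r) ys))),
        int (length (xs @ [snd r]) + length ys))])"
    using Cons.IH[of "xs @ [snd r]" "fst r"] Cons.prems by (simp del: append_assoc)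
  have st: "step (Run \<delta> k q, [(h, p), (tape_of (map code (xs @ c # ys)), int (length xs))]) =
    (Run \<delta> k (fst r), [(h, p), (tape_of (map code ((xs @ [snd r]) @ ys)), int (length (xs @ [snd r])))])"
    using c tape_of_mid[of "map code xs" "code c" "map code ys"]
      tape_of_upd[of "map code xs" "code c" "map code ys" "code (snd r)"]
    by (auto simp: step_def delta_def r_def Let_def)
  have "within n N (Run \<delta> k q, [(h, p), (tape_of (map code (xs @ c # ys)), int (length xs))])"
    using Cons.prems assms(4) by simp
  from step_intro[OF this st *] show ?case
    by (simp add: r_def[symmetric])
qed

text \<open>The time \<open>2 N + 2\<close> consists of \<open>N\<close> steps for the sweep, one
  for turning at the right end and \<open>N + 1\<close> for the way back.\<close>

lemma macro_step_steps:
  assumes "j \<in> controls" "set T \<subseteq> cells m" "length T = N" "p \<in> {- 1..int n}"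
  shows "\<exists>t\<le>2 * N + 2. steps n N t (start j, [(h, p), (tape_of (map code T), 0)])
    (start (fst (macro_step (j, T))), [(h, p), (tape_of (map code (snd (macro_step (j, T)))), 0)])"
    and "fst (macro_step (j, T)) \<in> controls" "set (snd (macro_step (j, T))) \<subseteq> cells m"
    "length (snd (macro_step (j, T))) = N"
proof -
  have "(\<exists>t\<le>2 * N + 2. steps n N t (start j, [(h, p), (tape_of (map code T), 0)])
    (start (fst (macro_step (j, T))), [(h, p), (tape_of (map code (snd (macro_step (j, T)))), 0)])) \<and>
    fst (macro_step (j, T)) \<in> controls \<and> set (snd (macro_step (j, T))) \<subseteq> cells m \<and>
    length (snd (macro_step (j, T))) = N"
  proof (cases j)
    case (Halt v)
    then show ?thesis using assms by (auto intro!: reach_refl exI[of _ 0])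
  next
    case (Sweep \<delta> k)
    define q where "q = fst (sweep \<delta> (False, False) T)"
    define T' where "T' = snd (sweep \<delta> (False, False) T)"
    have len: "length T' = N" by (simp add: T'_def assms)
    have T': "set T' \<subseteq> cells m"
      unfolding T'_def using sweep_cells[OF points_bounded[OF _ bounded] assms(2)] assms(1) Sweep
      by (auto simp: controls_def)
    have nz: "0 \<notin> set (map code T')" using T' code by fastforce
    have 1: "steps n N N (Run \<delta> k (False, False), [(h, p), (tape_of (map code T), 0)])
      (Run \<delta> k q, [(h, p), (tape_of (map code T'), int N)])"
      using run_steps[of \<delta> k T "[]" N p n "(False, False)" h] assms Sweep by (simp add: q_def T'_def)
    have "step (Run \<delta> k q, [(h, p), (tape_of (map code T'), int N)]) =
      (Back (resume (fst q) k), [(h, p), (tape_of (map code T'), int N - 1)])"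
      using tape_of_end(1)[of "map code T'"] len
      by (simp add: step_def delta_def image_iff) (auto simp: tape_of_def)
    then have 2: "steps n N (Suc (N + 1)) (Run \<delta> k q, [(h, p), (tape_of (map code T'), int N)])
      (start (resume (fst q) k), [(h, p), (tape_of (map code T'), 0)])"
      using back_steps[of "map code T'" N N p n "resume (fst q) k" h] nz len assms(4)
      by (intro step_intro) auto
    have "steps n N (2 * N + 2) (Run \<delta> k (False, False), [(h, p), (tape_of (map code T), 0)])
      (start (resume (fst q) k), [(h, p), (tape_of (map code T'), 0)])"
      using reach_trans[OF 1 2] by (simp add: mult_2)
    moreover have "resume (fst q) k \<in> controls"
      using assms(1) Sweep resume_controls by simp
    ultimately show ?thesis using Sweep T' len by (auto simp: q_def T'_def)
  qed
  then show "\<exists>t\<le>2 * N + 2. steps n N t (start j, [(h, p), (tape_of (map code T), 0)])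
    (start (fst (macro_step (j, T))), [(h, p), (tape_of (map code (snd (macro_step (j, T)))), 0)])"
    "fst (macro_step (j, T)) \<in> controls" "set (snd (macro_step (j, T))) \<subseteq> cells m"
    "length (snd (macro_step (j, T))) = N"
    by - (elim conjE, assumption)+
qed

lemma exec_steps:
  assumes "exec P T r T' v" "set T \<subseteq> cells m" "length T = N" "p \<in> {- 1..int n}"
  shows "\<exists>t\<le>r * (2 * N + 2). \<exists>ts. steps n N t (start (enter P []), [(h, p), (tape_of (map code T), 0)]) (Final v, ts)"
proof -
  have "\<exists>t\<le>i * (2 * N + 2). steps n N t (start j, [(h, p), (tape_of (map code U), 0)])
      (start (fst ((macro_step ^^ i) (j, U))), [(h, p), (tape_of (map code (snd ((macro_step ^^ i) (j, U)))), 0)])"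
    if "j \<in> controls" "set U \<subseteq> cells m" "length U = N" for i j U
    using that
  proof (induction i arbitrary: j U)
    case 0
    then show ?case using assms(4) by (auto intro!: reach_refl)
  next
    case (Suc i)
    define j' where "j' = fst (macro_step (j, U))"
    define U' where "U' = snd (macro_step (j, U))"
    note m = macro_step_steps[OF Suc.prems assms(4)]
    obtain t where t: "t \<le> 2 * N + 2" "steps n N t (start j, [(h, p), (tape_of (map code U), 0)])
      (start j', [(h, p), (tape_of (map code U'), 0)])"
      using m(1) unfolding j'_def U'_def by blast
    obtain t' where t': "t' \<le> i * (2 * N + 2)" "steps n N t' (start j', [(h, p), (tape_of (map code U'), 0)])
      (start (fst ((macro_step ^^ i) (j', U'))), [(h, p), (tape_of (map code (snd ((macro_step ^^ i) (j', U')))), 0)])"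
      using Suc.IH[of j' U'] m unfolding j'_def U'_def by blast
    have "(macro_step ^^ i) (j', U') = (macro_step ^^ Suc i) (j, U)"
      by (simp add: j'_def U'_def funpow_swap1)
    then show ?case using reach_trans[OF t(2) t'(2)] t(1) t'(1) by (intro exI[of _ "t + t'"]) auto
  qed
  from this[where i = r and j = "enter P []" and U = T] show ?thesis
    using macro_steps_exec[OF assms(1), of "[]"] assms(2,3) enter_controls by auto
qed

lemma code_labels:
  assumes "set xs \<subseteq> {1..5}" "f \<le> 5"
  shows "0 \<notin> set (map (\<lambda>b. code (b, {})) (labels f xs))"
proof -
  have "code (b, {}) \<noteq> 0" if "b \<in> set (labels f xs)" for b
    using code[of "(b, {})"] labels_less[OF assms] that by (auto simp: cells_def)
  then show ?thesis by fastforce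
qed

text \<open>Induction on the number of copies still to be made. The digits \<open>ds\<close> change
  from copy to copy and \<open>zs\<close> collects the copies made so far, but the labels stay the
  same. A copy takes \<open>n\<close> steps; it is followed by \<open>n + 2\<close> steps of
  rewinding, or after the last copy by \<open>N + 2\<close> steps on the second tape.\<close>

lemma copies_steps:
  assumes x: "x = A @ 5 # B @ 5 # C @ 5 # D @ 5 # ds @ [5]"
    and A: "5 \<notin> set (A @ B @ C @ D)" "set (A @ B @ C @ D) \<subseteq> {1..5}" "set ds \<subseteq> {1, 2}"
    and g: "digits_value ds = Suc g" and n: "length x = n" and N: "length zs + Suc g * n = N"
    and zs: "0 \<notin> set zs"
  shows "\<exists>h. \<exists>t\<le>Suc g * (2 * n + 2) + N. steps n N t
    (Copy 0 True False, [(tape_of x, 0), (tape_of zs, int (length zs))])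
    (start (enter P []), [(h, int n),
      (tape_of (zs @ map (\<lambda>b. code (b, {})) (concat (replicate (Suc g) (labels 0 x)))), 0)])"
  using x A(3) g n N zs
proof (induction g arbitrary: ds x zs)
  case (0 ds x zs)
  let ?zs = "zs @ map (\<lambda>b. code (b, {})) (labels 0 x)"
  have xs: "set x \<subseteq> {1..5}" using 0 A by auto
  have "decrements 0 True False x = A @ 5 # B @ 5 # C @ 5 # D @ 5 # decrements 4 True False (ds @ [5])"
    "nonzero 0 True False x \<longleftrightarrow> nonzero 4 True False (ds @ [5])"
    using decrements_fields[OF A(1)] by (simp_all add: 0)
  then have "\<not> nonzero 0 True False x"
    using decrements_borrow[of ds False] 0 by auto
  then obtain f bo where c: "steps n N n
    (Copy 0 True False, [(tape_of x, 0), (tape_of zs, int (length zs))])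
    (Copy f bo False, [(tape_of (decrements 0 True False x), int n), (tape_of ?zs, int N)])"
    using copy_steps[OF xs, of 0 "[]" n zs N True False] 0 by auto
  have z: "0 \<notin> set ?zs"
    using code_labels[OF xs, of 0] 0 by simp
  have l: "length ?zs = N" "length (decrements 0 True False x) = n" using 0 by auto
  have "steps n N (Suc (N + 1))
    (Copy f bo False, [(tape_of (decrements 0 True False x), int n), (tape_of ?zs, int N)])
    (start (enter P []), [(tape_of (decrements 0 True False x), int n), (tape_of ?zs, 0)])"
  proof (rule step_intro)
    show "step (Copy f bo False, [(tape_of (decrements 0 True False x), int n), (tape_of ?zs, int N)]) =
      (Back (enter P []), [(tape_of (decrements 0 True False x), int n), (tape_of ?zs, int N - 1)])"
      using tape_of_end(1)[of "decrements 0 True False x"] tape_of_end(1)[of ?zs] unfolding l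
      by (simp add: step_def delta_def image_iff fun_upd_idem)
  qed (use back_steps[OF z, of N N "int n"] l in auto)
  from reach_trans[OF c this] show ?case
    by (intro exI conjI) (auto simp: 0)
next
  case (Suc g ds x zs)
  let ?zs = "zs @ map (\<lambda>b. code (b, {})) (labels 0 x)"
  define y where "y = decrements 0 True False x"
  have xs: "set x \<subseteq> {1..5}" using Suc.prems A by auto
  have "decrements 0 True False x = A @ 5 # B @ 5 # C @ 5 # D @ 5 # decrements 4 True False (ds @ [5])"
    "nonzero 0 True False x \<longleftrightarrow> nonzero 4 True False (ds @ [5])"
    using decrements_fields[OF A(1)] by (simp_all add: Suc.prems(1))
  then obtain ds' where ds': "y = A @ 5 # B @ 5 # C @ 5 # D @ 5 # ds' @ [5]" "set ds' \<subseteq> {1, 2}"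
      "digits_value ds' = Suc g" "nonzero 0 True False x"
    using decrements_borrow[of ds False] Suc.prems by (auto simp: y_def)
  have z: "0 \<notin> set ?zs"
    using code_labels[OF xs, of 0] Suc.prems by simp
  have l: "length ?zs = length zs + n" "length y = n" using Suc.prems by (auto simp: y_def)
  have y0: "0 \<notin> set y" using ds' A(2) by auto
  obtain f bo where c: "steps n N n
    (Copy 0 True False, [(tape_of x, 0), (tape_of zs, int (length zs))])
    (Copy f bo True, [(tape_of y, int n), (tape_of ?zs, int (length ?zs))])"
    using copy_steps[OF xs, of 0 "[]" n zs N True False] Suc.prems ds'(4) by (auto simp: y_def)
  have r: "steps n N (Suc (n + 1)) (Copy f bo True, [(tape_of y, int n), (tape_of ?zs, int (length ?zs))])
    (Copy 0 True False, [(tape_of y, 0), (tape_of ?zs, int (length ?zs))])"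
  proof (rule step_intro)
    show "step (Copy f bo True, [(tape_of y, int n), (tape_of ?zs, int (length ?zs))]) =
      (Rewind, [(tape_of y, int n - 1), (tape_of ?zs, int (length ?zs))])"
      using tape_of_end(1)[of y] tape_of_end(1)[of ?zs] unfolding l(2)
      by (simp add: step_def delta_def image_iff fun_upd_idem)
  qed (use rewind_steps[OF y0, of n n "int (length ?zs)" N] l Suc.prems(5) in auto)
  have "labels 0 y = labels 0 x" by (simp add: y_def labels_decrements)
  then obtain h t where t: "t \<le> Suc g * (2 * n + 2) + N" "steps n N t
    (Copy 0 True False, [(tape_of y, 0), (tape_of ?zs, int (length ?zs))])
    (start (enter P []), [(h, int n),
      (tape_of (?zs @ map (\<lambda>b. code (b, {})) (concat (replicate (Suc g) (labels 0 x)))), 0)])"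
    using Suc.IH[OF ds'(1-3) l(2), of ?zs] z l(1) Suc.prems(5) by auto
  from reach_trans[OF reach_trans[OF c r] t(2)] t(1) show ?case
    by (intro exI[of _ h] exI[of _ "n + Suc (n + 1) + t"]) auto
qed

lemma realization:
  "\<exists>M. turing_machine M \<and> tm_tapes M = 2 \<and>
    (\<forall>x n N t v ts. steps n N t (Copy 0 True False, [input_tape x, input_tape []]) (Final v, ts) \<longrightarrow>
      tm_halts M x \<and> (tm_accepts M x \<longleftrightarrow> v) \<and> tm_time M x \<le> t \<and> tm_space M x \<le> (n + 2) + (N + 2))"
proof -
  define s0 where "s0 = Copy 0 True False"
  have s0: "s0 \<in> states" by (simp add: s0_def Copy_states)
  obtain qs' where qs': "set qs' = states - {s0}" "distinct qs'"
    using finite_distinct_list[of "states - {s0}"] finite_states by auto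
  \<comment> \<open>A Turing machine starts in state 0, so the initial state has to head the
    enumeration.\<close>
  define qs where "qs = s0 # qs'"
  have qs: "set qs = states" "distinct qs" "qs ! 0 = s0"
    using qs' s0 by (auto simp: qs_def)
  define idx where "idx s = (THE i. i < length qs \<and> qs ! i = s)" for s
  have idx: "idx s < length qs \<and> qs ! idx s = s" if "s \<in> states" for s
    unfolding idx_def
    by (rule theI') (use that qs in \<open>auto simp: in_set_conv_nth nth_eq_iff_index_eq\<close>)
  have idx_inj: "idx s = idx s' \<longleftrightarrow> s = s'" if "s \<in> states" "s' \<in> states" for s s'
    using idx that by metis
  have idx0: "idx s0 = 0"
    using idx[OF s0] qs by (metis gr_implies_not0 length_greater_0_conv nth_eq_iff_index_eq list.size(3))
  define M where "M = \<lparr>tm_tapes = 2, tm_states = length qs, tm_symbols = K,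
    tm_accept = idx (Final True), tm_reject = idx (Final False),
    tm_delta = \<lambda>i ss. (idx (fst (delta (qs ! i) ss)), snd (delta (qs ! i) ss))\<rparr>"
  have "turing_machine M"
    unfolding turing_machine_def
  proof (intro conjI allI impI)
    fix i ss
    assume i: "i < tm_states M \<and> length ss = tm_tapes M \<and> set ss \<subseteq> {..<tm_symbols M}"
    then have q: "qs ! i \<in> states" using qs(1) by (auto simp: M_def)
    have "ss ! j \<in> {..<K}" if "j < 2" for j
      using i that by (intro subsetD[of "set ss" "{..<K}"] nth_mem) (auto simp: M_def)
    then have "ss ! 0 < K" "ss ! 1 < K" by simp_all
    from delta_symbols[OF q this] show
      "case tm_delta M i ss of (q', acts) \<Rightarrow>
         q' < tm_states M \<and> length acts = tm_tapes M \<and> fst ` set acts \<subseteq> {..<tm_symbols M}"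
      using idx[OF delta_states[OF q]] by (simp add: M_def)
  qed (use idx[OF Final_states] idx_inj[OF Final_states Final_states] K in
      \<open>auto simp: M_def qs_def\<close>)
  moreover have "tm_halts M x \<and> (tm_accepts M x \<longleftrightarrow> v) \<and> tm_time M x \<le> t \<and> tm_space M x \<le> (n + 2) + (N + 2)"
    if r: "steps n N t (Copy 0 True False, [input_tape x, input_tape []]) (Final v, ts)" for x n N t v ts
  proof -
    define c where "c = (s0, [input_tape x, input_tape []])"
    have stay: "fst ((step ^^ i) c) \<in> states" for i
      by (induction i) (auto simp: c_def s0 step_def delta_states)
    have run: "tm_run M x i = (idx (fst ((step ^^ i) c)), snd ((step ^^ i) c))" for i
    proof (induction i)
      case 0
      then show ?case by (simp add: tm_run_def c_def idx0 M_def)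
    next
      case (Suc i)
      define d where "d = (step ^^ i) c"
      have d: "fst d \<in> states" using stay[of i] by (simp add: d_def)
      have h: "tm_halted M (idx (fst d), snd d) \<longleftrightarrow> fst d \<in> range Final"
      proof -
        have "fst d \<in> range Final \<longleftrightarrow> fst d = Final True \<or> fst d = Final False"
          by (auto simp: UNIV_bool)
        then show ?thesis
          using idx_inj[OF d Final_states] by (simp add: tm_halted_def M_def)
      qed
      have "tm_run M x (Suc i) = tm_step M (tm_run M x i)"
        by (simp add: tm_run_def)
      also have "\<dots> = tm_step M (idx (fst d), snd d)" by (simp add: Suc.IH d_def)
      also have "\<dots> = (idx (fst (step d)), snd (step d))"
        using idx[OF d] by (simp add: tm_step_def h step_def, simp add: M_def)
      finally show ?case by (simp add: d_def)
    qed
    have fin: "(step ^^ t) c = (Final v, ts)"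
      and wi: "\<And>s. s \<le> t \<Longrightarrow> within n N ((step ^^ s) c)"
      using r by (auto simp: reach_def c_def s0_def)
    have fin': "(step ^^ (i + t)) c = (Final v, ts)" for i
      by (induction i) (simp_all add: fin step_Final)
    have halted: "tm_halted M (tm_run M x t)"
      unfolding run fin by (cases v) (simp_all add: tm_halted_def M_def)
    then have "tm_halts M x" by (auto simp: tm_halts_def)
    have time: "tm_time M x \<le> t"
      unfolding tm_time_def by (rule Least_le, rule halted)
    have "tm_accepts M x \<longleftrightarrow> v"
    proof
      assume "tm_accepts M x"
      then obtain i where i: "fst (tm_run M x i) = idx (Final True)" by (auto simp: tm_accepts_def M_def)
      then have "fst ((step ^^ i) c) = Final True"
        using run idx_inj[OF stay Final_states] by simp
      \<comment> \<open>Acceptance may be witnessed at any time \<open>i\<close>; as final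
        configurations persist, the states at the times \<open>i\<close> and \<open>t\<close> agree
        with the one at \<open>t + i\<close>.\<close>
      moreover have "(step ^^ (j + i)) c = (step ^^ i) c" if "fst ((step ^^ i) c) = Final True" for j
        by (induction j) (use that in \<open>simp_all add: step_Final\<close>)
      ultimately have "fst ((step ^^ (t + i)) c) = Final True" by simp
      then show v using fin'[of i] by (simp add: add.commute)
    next
      assume v
      then show "tm_accepts M x"
        using run[of t] fin by (auto simp: tm_accepts_def M_def intro!: exI[of _ t])
    qed
    have "card ((\<lambda>s. snd (snd (tm_run M x s) ! i)) ` {..tm_time M x}) \<le> B + 2"
      if "i < 2" "B = (if i = 0 then n else N)" for i B
    proof -
      have "snd (snd ((step ^^ s) c) ! i) \<in> {-1..int B}" if "s \<le> t" for s
      proof -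
        have "i = 0 \<or> i = 1" using \<open>i < 2\<close> by auto
        then show ?thesis
          using wi[OF that] \<open>B = _\<close> by (cases "(step ^^ s) c") auto
      qed
      then have "(\<lambda>s. snd (snd (tm_run M x s) ! i)) ` {..tm_time M x} \<subseteq> {-1..int B}"
        using time by (auto simp: run simp del: atLeastAtMost_iff)
      from card_mono[OF _ this] show ?thesis by simp
    qed
    from this[of 0 n] this[of 1 N] have "tm_space M x \<le> (n + 2) + (N + 2)"
      by (simp add: tm_space_def M_def numeral_2_eq_2)
    with \<open>tm_halts M x\<close> time \<open>tm_accepts M x \<longleftrightarrow> v\<close> show ?thesis by blast
  qed
  ultimately show ?thesis by (intro exI[of _ M]) (auto simp: M_def)
qed

end

theorem sweeping_machine:
  assumes "bounded_prog m P"
  shows "\<exists>M. turing_machine M \<and> (\<forall>x A B C D ds r T v.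
    x = A @ 5 # B @ 5 # C @ 5 # D @ 5 # ds @ [5] \<and>
    5 \<notin> set (A @ B @ C @ D) \<and> set (A @ B @ C @ D) \<subseteq> {1..5} \<and> set ds \<subseteq> {1, 2} \<and> 0 < digits_value ds \<and>
    exec P (map (\<lambda>b. (b, {})) (concat (replicate (digits_value ds) (labels 0 x)))) r T v \<longrightarrow>
    tm_halts M x \<and> (tm_accepts M x \<longleftrightarrow> v) \<and>
    tm_time M x \<le> digits_value ds * (2 * length x + 2) + digits_value ds * length x
      + r * (2 * (digits_value ds * length x) + 2) \<and>
    tm_space M x \<le> (length x + 2) + (digits_value ds * length x + 2))"
proof -
  have fin: "finite (cells m)" by (simp add: cells_def)
  obtain h where h: "bij_betw h (cells m) {0..<card (cells m)}"
    using ex_bij_betw_finite_nat[OF fin] by blast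
  define K where "K = Suc (card (cells m))"
  have "(\<lambda>b. (b, {})) ` {..<36} \<subseteq> cells m" by (auto simp: cells_def)
  from card_mono[OF fin this] have K: "6 \<le> K"
    by (simp add: K_def card_image inj_on_def)
  \<comment> \<open>The cells are numbered from 0; \<open>Suc\<close> reserves the symbol 0 for the
    blank.\<close>
  interpret simulation P m "\<lambda>c. Suc (h c)" "\<lambda>b. inv_into (cells m) h (b - 1)" K
  proof
    fix c assume c: "c \<in> cells m"
    then have "h c < card (cells m)" using h by (auto simp: bij_betw_def)
    then show "0 < Suc (h c) \<and> Suc (h c) < K \<and> inv_into (cells m) h (Suc (h c) - 1) = c"
      using h c by (simp add: K_def bij_betw_inv_into_left)
  next
    fix b assume "0 < b" "b < K"
    then have "b - 1 \<in> h ` cells m" using h by (auto simp: K_def bij_betw_def)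
    then show "inv_into (cells m) h (b - 1) \<in> cells m" by (rule inv_into_into)
  qed (use assms K in auto)
  obtain M where M: "turing_machine M" and
    sim: "\<And>x n N t v ts. steps n N t (Copy 0 True False, [input_tape x, input_tape []]) (Final v, ts) \<Longrightarrow>
      tm_halts M x \<and> (tm_accepts M x \<longleftrightarrow> v) \<and> tm_time M x \<le> t \<and> tm_space M x \<le> (n + 2) + (N + 2)"
    using realization by blast
  show ?thesis
  proof (intro exI[of _ M] conjI[OF M] allI impI, elim conjE)
    fix x A B C D ds r T v
    assume x: "x = A @ 5 # B @ 5 # C @ 5 # D @ 5 # ds @ [5]"
      and A: "5 \<notin> set (A @ B @ C @ D)" "set (A @ B @ C @ D) \<subseteq> {1..5}" "set ds \<subseteq> {1, 2}"
      and g: "0 < digits_value ds"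
      and ex: "exec P (map (\<lambda>b. (b, {})) (concat (replicate (digits_value ds) (labels 0 x)))) r T v"
    define n where "n = length x"
    define g' where "g' = digits_value ds - 1"
    have g': "digits_value ds = Suc g'" using g by (simp add: g'_def)
    define N where "N = Suc g' * n"
    let ?T = "map (\<lambda>b. (b, {})) (concat (replicate (Suc g') (labels 0 x))) :: cell list"
    have len: "length ?T = N" by (simp add: N_def n_def length_concat sum_list_replicate)
    have "set x \<subseteq> {1..5}" using x A by auto
    then have "set (labels 0 x) \<subseteq> {..<36}" by (rule labels_less) simp
    then have T: "set ?T \<subseteq> cells m" by (auto simp: cells_def)
    obtain h1 t1 where 1: "t1 \<le> Suc g' * (2 * n + 2) + N"
      "steps n N t1 (Copy 0 True False, [(tape_of x, 0), (tape_of [], 0)])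
        (start (enter P []), [(h1, int n), (tape_of (map (\<lambda>c. Suc (h c)) ?T), 0)])"
      using copies_steps[OF x A g' n_def[symmetric], of "[]" N] by (auto simp: N_def o_def map_concat)
    obtain t2 ts where 2: "t2 \<le> r * (2 * N + 2)"
      "steps n N t2 (start (enter P []), [(h1, int n), (tape_of (map (\<lambda>c. Suc (h c)) ?T), 0)]) (Final v, ts)"
      using exec_steps[OF ex[unfolded g'] T len, of "int n" n h1] by auto
    from sim[OF reach_trans[OF 1(2) 2(2), folded input_tape_eq]] 1(1) 2(1)
    show "tm_halts M x \<and> (tm_accepts M x \<longleftrightarrow> v) \<and>
      tm_time M x \<le> digits_value ds * (2 * length x + 2) + digits_value ds * length x
        + r * (2 * (digits_value ds * length x) + 2) \<and>
      tm_space M x \<le> (length x + 2) + (digits_value ds * length x + 2)"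
      unfolding g' n_def[symmetric] N_def[symmetric] by linarith
  qed
qed

section \<open>Evaluation of counting formulas by sweeps\<close>

text \<open>The transposed view of the tape: for each track the set of its marked positions.
  Positions beyond the end are invisible, so a mark that is shifted off the tape simply
  disappears.\<close>

definition cells_of :: "nat list \<Rightarrow> (nat \<Rightarrow> nat set) \<Rightarrow> cell list" where
  "cells_of B F = map (\<lambda>i. (B ! i, {v. i \<in> F v})) [0..<length B]"

lemma length_cells_of [simp]: "length (cells_of B F) = length B"
  by (simp add: cells_of_def)

lemma sweep_eqI:
  assumes "length T' = length T"
    and "\<And>i. i < length T \<Longrightarrow> \<delta> (S i) (T ! i) = (S (Suc i), T' ! i)"
  shows "sweep \<delta> (S 0) T = (S (length T), T')"
  using assms
proof (induction T arbitrary: S T')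
  case (Cons c T)
  then obtain c' U where T': "T' = c' # U" by (cases T') auto
  have "sweep \<delta> ((\<lambda>i. S (Suc i)) 0) T = ((\<lambda>i. S (Suc i)) (length T), U)"
    by (rule Cons.IH) (use Cons.prems T' in force)+
  moreover have "\<delta> (S 0) c = (S 1, c')"
    using Cons.prems(2)[of 0] T' by simp
  ultimately show ?case by (simp add: T')
qed simp

text \<open>Verifying a sweep reduces to guessing its state \<open>S i\<close> before cell
  \<open>i\<close>; afterwards each cell is checked on its own.\<close>

lemma exec_PassI:
  assumes "S 0 = (False, False)"
    and "\<And>i. i < length B \<Longrightarrow> \<delta> (S i) (B ! i, {v. i \<in> F v}) = (S (Suc i), (B ! i, {v. i \<in> F' v}))"
    and "fst (S (length B)) = r"
  shows "exec (Pass \<delta>) (cells_of B F) 1 (cells_of B F') r"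
proof -
  have "sweep \<delta> (S 0) (cells_of B F) = (S (length (cells_of B F)), cells_of B F')"
    by (rule sweep_eqI) (use assms in \<open>auto simp: cells_of_def\<close>)
  then show ?thesis using exec.Pass[of \<delta> "cells_of B F"] assms by simp
qed

definition exists_pass :: "(cell \<Rightarrow> bool) \<Rightarrow> pass" where
  "exists_pass f q c = ((fst q \<or> f c, False), c)"

lemma exec_exists_pass:
  "exec (Pass (exists_pass f)) (cells_of B F) 1 (cells_of B F) (\<exists>i<length B. f (B ! i, {v. i \<in> F v}))"
  by (rule exec_PassI[where S = "\<lambda>i. (\<exists>j<i. f (B ! j, {v. j \<in> F v}), False)"])
    (auto simp: exists_pass_def less_Suc_eq)

definition less_pass :: "nat \<Rightarrow> nat \<Rightarrow> pass" where
  "less_pass v w q c = ((fst q \<or> snd q \<and> w \<in> snd c, snd q \<or> v \<in> snd c), c)"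

lemma exec_less_pass:
  "exec (Pass (less_pass v w)) (cells_of B F) 1 (cells_of B F) (\<exists>q<length B. \<exists>p<q. p \<in> F v \<and> q \<in> F w)"
  by (rule exec_PassI[where S = "\<lambda>i. (\<exists>q<i. \<exists>p<q. p \<in> F v \<and> q \<in> F w, \<exists>p<i. p \<in> F v)"])
    (auto simp: less_pass_def less_Suc_eq)

definition const_pass :: "bool \<Rightarrow> pass" where
  "const_pass b q c = ((b, False), c)"

lemma exec_const_pass:
  "B \<noteq> [] \<or> \<not> b \<Longrightarrow> exec (Pass (const_pass b)) (cells_of B F) 1 (cells_of B F) b"
  by (rule exec_PassI[where S = "\<lambda>i. (i > 0 \<and> b, False)"]) (auto simp: const_pass_def)

definition init_pass :: "nat \<Rightarrow> nat \<Rightarrow> pass" where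
  "init_pass k a q c = ((True, True),
     (fst c, (if snd q then snd c - {k} else insert k (snd c)) - {a}))"

lemma exec_init_pass:
  "k \<noteq> a \<Longrightarrow> B \<noteq> [] \<Longrightarrow>
     exec (Pass (init_pass k a)) (cells_of B F) 1 (cells_of B (F(k := {0}, a := {}))) True"
  by (rule exec_PassI[where S = "\<lambda>i. (i > 0, i > 0)"]) (auto simp: init_pass_def)

definition shift_pass :: "nat \<Rightarrow> pass" where
  "shift_pass k q c = ((True, k \<in> snd c), (fst c, if snd q then insert k (snd c) else snd c - {k}))"

lemma exec_shift_pass:
  "B \<noteq> [] \<Longrightarrow> exec (Pass (shift_pass k)) (cells_of B F) 1 (cells_of B (F(k := Suc ` F k))) True"
  by (rule exec_PassI[where S = "\<lambda>i. (i > 0, i \<in> Suc ` F k)"]) (auto simp: shift_pass_def)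

definition add_pass :: "nat \<Rightarrow> nat \<Rightarrow> pass" where
  "add_pass a k q c = (q, (fst c, if k \<in> snd c then insert a (snd c) else snd c))"

lemma exec_add_pass:
  "exec (Pass (add_pass a k)) (cells_of B F) 1 (cells_of B (F(a := F a \<union> F k))) False"
  by (rule exec_PassI[where S = "\<lambda>i. (False, False)"]) (auto simp: add_pass_def)

definition drop_pass :: "nat \<Rightarrow> nat \<Rightarrow> pass" where
  "drop_pass a b q c = ((fst q \<or> a \<in> snd c, snd q \<or> b \<in> snd c),
     (fst c, snd c - (if fst q then {} else {a}) - (if snd q then {} else {b})))"

lemma exec_drop_pass:
  assumes "a \<noteq> b"
  shows "exec (Pass (drop_pass a b)) (cells_of B F) 1
    (cells_of B (F(a := {p \<in> F a. \<exists>q<p. q \<in> F a}, b := {p \<in> F b. \<exists>q<p. q \<in> F b}))) (\<exists>p<length B. p \<in> F a)"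
  by (rule exec_PassI[where S = "\<lambda>i. (\<exists>p<i. p \<in> F a, \<exists>p<i. p \<in> F b)"])
    (use assms in \<open>auto simp: drop_pass_def less_Suc_eq\<close>)

definition copy_pass :: "nat \<Rightarrow> nat \<Rightarrow> nat \<Rightarrow> nat \<Rightarrow> pass" where
  "copy_pass a a' b b' q c = (q, (fst c, snd c - {a', b'}
     \<union> (if a \<in> snd c then {a'} else {}) \<union> (if b \<in> snd c then {b'} else {})))"

lemma exec_copy_pass:
  "a' \<noteq> b' \<Longrightarrow> exec (Pass (copy_pass a a' b b')) (cells_of B F) 1 (cells_of B (F(a' := F a, b' := F b))) False"
  by (rule exec_PassI[where S = "\<lambda>i. (False, False)"]) (auto simp: copy_pass_def)

definition boundable :: "prog \<Rightarrow> bool" where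
  "boundable c \<longleftrightarrow> (\<exists>m. bounded_prog m c)"

lemma boundable_Cond: "boundable c \<Longrightarrow> boundable a \<Longrightarrow> boundable b \<Longrightarrow> boundable (Cond c a b)"
  unfolding boundable_def
proof (elim exE)
  fix m1 m2 m3 assume "bounded_prog m1 c" "bounded_prog m2 a" "bounded_prog m3 b"
  then have "bounded_prog (m1 + m2 + m3) (Cond c a b)"
    by (auto intro: bounded_prog_mono)
  then show "\<exists>m. bounded_prog m (Cond c a b)" by blast
qed

lemma boundable_Loop: "boundable c \<Longrightarrow> boundable a \<Longrightarrow> boundable (Loop c a)"
  unfolding boundable_def
proof (elim exE)
  fix m1 m2 assume "bounded_prog m1 c" "bounded_prog m2 a"
  then have "bounded_prog (m1 + m2) (Loop c a)"
    by (auto intro: bounded_prog_mono)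
  then show "\<exists>m. bounded_prog m (Loop c a)" by blast
qed

lemma boundable_Pass:
  "boundable (Pass (exists_pass f))" "boundable (Pass (less_pass v w))" "boundable (Pass (const_pass b))"
  "boundable (Pass (init_pass k a))" "boundable (Pass (shift_pass k))" "boundable (Pass (add_pass a k))"
  "boundable (Pass (drop_pass a b'))" "boundable (Pass (copy_pass c c' d d'))"
  unfolding boundable_def bounded_prog.simps bounded_pass_def
  by (auto simp: exists_pass_def less_pass_def const_pass_def init_pass_def drop_pass_def
      intro: exI[of _ 0] exI[of _ "Suc k"],
      auto simp: shift_pass_def add_pass_def copy_pass_def intro: exI[of _ "Suc k"] exI[of _ "Suc a"]
      exI[of _ "Suc (c' + d')"])

lemmas boundable = boundable_Cond boundable_Loop boundable_Pass

abbreviation seq :: "prog \<Rightarrow> prog \<Rightarrow> prog" where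
  "seq a b \<equiv> Cond a b b"

lemma exec_seq: "exec a T n1 T1 v \<Longrightarrow> exec b T1 n2 T2 w \<Longrightarrow> exec (seq a b) T (n1 + n2) T2 w"
  using exec.Cond[of a T n1 T1 v b b] by simp

section \<open>Loops over positions and comparison of cardinalities\<close>

text \<open>A for-loop: the only mark on track \<open>k\<close> is the loop variable. It walks to
  the right until it falls off the tape, while track \<open>a\<close> accumulates the positions at
  which \<open>c\<close> answers yes.\<close>

definition collect :: "nat \<Rightarrow> nat \<Rightarrow> prog \<Rightarrow> prog" where
  "collect k a c = seq (Pass (init_pass k a))
     (Loop (Pass (exists_pass (\<lambda>d. k \<in> snd d)))
       (Cond c (seq (Pass (add_pass a k)) (Pass (shift_pass k))) (Pass (shift_pass k))))"

text \<open>The answer of \<open>c\<close> must not depend on track \<open>a\<close>, which is only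
  partly filled during the loop. An iteration costs one test, at most \<open>t\<close> sweeps for
  \<open>c\<close> and at most two for recording and shifting; the 2 stands for the initialization
  and the last test.\<close>

lemma exec_collect:
  assumes c: "\<And>F. \<exists>F' n. exec c (cells_of B F) n (cells_of B F') (P F) \<and> n \<le> t \<and> (\<forall>v<l. F' v = F v)"
    and P: "\<And>F F'. \<forall>v<l. v \<noteq> a \<longrightarrow> F v = F' v \<Longrightarrow> P F = P F'"
    and "k < l" "a < l" "k \<noteq> a" "B \<noteq> []"
  shows "\<exists>F' n. exec (collect k a c) (cells_of B F) n (cells_of B F') False \<and> n \<le> 2 + length B * (t + 3) \<and>
    (\<forall>v<l. v \<noteq> k \<longrightarrow> v \<noteq> a \<longrightarrow> F' v = F v) \<and> F' a = {p. p < length B \<and> P (F(k := {p}))}"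
proof -
  let ?test = "Pass (exists_pass (\<lambda>d. k \<in> snd d))"
  let ?body = "Cond c (seq (Pass (add_pass a k)) (Pass (shift_pass k))) (Pass (shift_pass k))"
  \<comment> \<open>Loop invariant: the mark is at \<open>p\<close> and track \<open>a\<close> is
    correct below \<open>p\<close>. The value \<open>p = length B\<close> means that the mark has
    left the tape.\<close>
  have loop: "\<exists>F' n. exec (Loop ?test ?body) (cells_of B F1) n (cells_of B F') False \<and> n \<le> 1 + (length B - p) * (t + 3) \<and>
    (\<forall>v<l. v \<noteq> k \<longrightarrow> v \<noteq> a \<longrightarrow> F' v = F v) \<and> F' a = {p. p < length B \<and> P (F(k := {p}))}"
    if "p \<le> length B" "F1 k = {p}" "\<forall>v<l. v \<noteq> k \<longrightarrow> v \<noteq> a \<longrightarrow> F1 v = F v"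
      "F1 a = {q. q < p \<and> P (F(k := {q}))}" for p F1
    using that
  proof (induction "length B - p" arbitrary: p F1)
    case 0
    then have p: "p = length B" by simp
    have "exec ?test (cells_of B F1) 1 (cells_of B F1) False"
      using exec_exists_pass[of "\<lambda>d. k \<in> snd d" B F1] 0 by simp
    from exec.LoopF[OF this] show ?case using 0 p by (intro exI[of _ F1] exI[of _ 1]) auto
  next
    case (Suc d)
    have p: "p < length B" using Suc.hyps by simp
    have test: "exec ?test (cells_of B F1) 1 (cells_of B F1) True"
      using exec_exists_pass[of "\<lambda>d. k \<in> snd d" B F1] Suc.prems p by simp
    obtain F2 n where F2: "exec c (cells_of B F1) n (cells_of B F2) (P F1)" "n \<le> t" "\<forall>v<l. F2 v = F1 v"
      using c by blast
    have PF: "P F1 = P (F(k := {p}))"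
      using Suc.prems by (intro P) auto
    have "\<exists>F3 n'. exec ?body (cells_of B F1) n' (cells_of B F3) True \<and> n' \<le> t + 2 \<and> F3 k = {Suc p} \<and>
      (\<forall>v<l. v \<noteq> k \<longrightarrow> v \<noteq> a \<longrightarrow> F3 v = F v) \<and> F3 a = {q. q < Suc p \<and> P (F(k := {q}))}"
    proof (cases "P F1")
      case True
      let ?F = "F2(a := F2 a \<union> F2 k)"
      have "exec (seq (Pass (add_pass a k)) (Pass (shift_pass k))) (cells_of B F2) (1 + 1) (cells_of B (?F(k := Suc ` ?F k))) True"
        by (rule exec_seq[OF exec_add_pass exec_shift_pass[OF assms(6)]])
      then have "exec ?body (cells_of B F1) (n + (1 + 1)) (cells_of B (?F(k := Suc ` ?F k))) True"
        using F2(1) True by (intro exec.Cond) auto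
      then show ?thesis
        using F2 assms(3-5) Suc.prems PF True
        by (intro exI[of _ "?F(k := Suc ` ?F k)"] exI[of _ "n + (1 + 1)"]) (auto simp: less_Suc_eq)
    next
      case False
      have "exec (Pass (shift_pass k)) (cells_of B F2) 1 (cells_of B (F2(k := Suc ` F2 k))) True"
        by (intro exec_shift_pass assms)
      then have "exec ?body (cells_of B F1) (n + 1) (cells_of B (F2(k := Suc ` F2 k))) True"
        using F2(1) False by (intro exec.Cond) auto
      then show ?thesis
        using F2 assms(3-5) Suc.prems PF False
        by (intro exI[of _ "F2(k := Suc ` F2 k)"] exI[of _ "n + 1"]) (auto simp: less_Suc_eq)
    qed
    then obtain F3 n' where F3: "exec ?body (cells_of B F1) n' (cells_of B F3) True" "n' \<le> t + 2" "F3 k = {Suc p}"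
      "\<forall>v<l. v \<noteq> k \<longrightarrow> v \<noteq> a \<longrightarrow> F3 v = F v" "F3 a = {q. q < Suc p \<and> P (F(k := {q}))}"
      by blast
    have d: "d = length B - Suc p" using Suc.hyps(2) by simp
    obtain F' n'' where F': "exec (Loop ?test ?body) (cells_of B F3) n'' (cells_of B F') False"
      "n'' \<le> 1 + (length B - Suc p) * (t + 3)"
      "\<forall>v<l. v \<noteq> k \<longrightarrow> v \<noteq> a \<longrightarrow> F' v = F v" "F' a = {p. p < length B \<and> P (F(k := {p}))}"
      using Suc.hyps(1)[OF d, of F3] F3 p by auto
    have "length B - p = Suc (length B - Suc p)" using p by simp
    then have "1 + n' + n'' \<le> 1 + (length B - p) * (t + 3)"
      using F3(2) F'(2) by simp
    with exec.LoopT[OF test F3(1) F'(1)] F' show ?case by blast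
  qed
  let ?F = "F(k := {0}, a := {})"
  obtain F' n where F': "exec (Loop ?test ?body) (cells_of B ?F) n (cells_of B F') False"
    "n \<le> 1 + length B * (t + 3)"
    "\<forall>v<l. v \<noteq> k \<longrightarrow> v \<noteq> a \<longrightarrow> F' v = F v" "F' a = {p. p < length B \<and> P (F(k := {p}))}"
    using loop[of 0 ?F] assms(5) by auto
  have "exec (collect k a c) (cells_of B F) (1 + n) (cells_of B F') False"
    unfolding collect_def by (rule exec_seq[OF exec_init_pass[OF assms(5,6)] F'(1)])
  then show ?thesis using F' by (intro exI[of _ F'] exI[of _ "1 + n"]) auto
qed

text \<open>Finite control cannot count, so the marks of both tracks are cancelled in pairs until
  one track is exhausted; \<open>a\<close> is then empty iff it had at most as many marks as
  \<open>b\<close>. Both tracks are destroyed.\<close>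

definition compare_tracks :: "nat \<Rightarrow> nat \<Rightarrow> prog" where
  "compare_tracks a b = seq
     (Loop (Cond (Pass (exists_pass (\<lambda>d. a \<in> snd d))) (Pass (exists_pass (\<lambda>d. b \<in> snd d))) (Pass (const_pass False)))
       (Pass (drop_pass a b)))
     (Cond (Pass (exists_pass (\<lambda>d. a \<in> snd d))) (Pass (const_pass False)) (Pass (const_pass True)))"

lemma card_drop_least:
  fixes A :: "nat set"
  assumes "finite A"
  shows "card {p \<in> A. \<exists>q<p. q \<in> A} = card A - 1"
proof (cases "A = {}")
  case False
  have "(\<exists>q<p. q \<in> A) \<longleftrightarrow> p \<noteq> Min A" if "p \<in> A" for p
    using Min_in[OF assms False] Min_le[OF assms that] Min_le[OF assms]
    by (metis le_neq_implies_less less_le_not_le)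
  then have "{p \<in> A. \<exists>q<p. q \<in> A} = A - {Min A}"
    using Min_in[OF assms False] by auto
  then show ?thesis using assms False by simp
qed simp

lemma exec_compare_tracks:
  assumes "a \<noteq> b" "B \<noteq> []" "F a \<subseteq> {..<length B}" "F b \<subseteq> {..<length B}"
  shows "\<exists>F' n. exec (compare_tracks a b) (cells_of B F) n (cells_of B F') (card (F a) \<le> card (F b)) \<and>
    n \<le> 3 * length B + 4 \<and> (\<forall>v. v \<noteq> a \<longrightarrow> v \<noteq> b \<longrightarrow> F' v = F v)"
proof -
  let ?a = "Pass (exists_pass (\<lambda>d. a \<in> snd d))"
  let ?b = "Pass (exists_pass (\<lambda>d. b \<in> snd d))"
  let ?test = "Cond ?a ?b (Pass (const_pass False))"
  have ea: "exec (Pass (exists_pass (\<lambda>d. c \<in> snd d))) (cells_of B F) 1 (cells_of B F) (F c \<noteq> {})"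
    if "F c \<subseteq> {..<length B}" for F c
  proof -
    have "(\<exists>i<length B. c \<in> snd (B ! i, {v. i \<in> F v})) \<longleftrightarrow> F c \<noteq> {}" using that by auto
    then show ?thesis using exec_exists_pass[of "\<lambda>d. c \<in> snd d" B F] by simp
  qed
  have test: "exec ?test (cells_of B F) 2 (cells_of B F) (F a \<noteq> {} \<and> F b \<noteq> {})"
    if "F a \<subseteq> {..<length B}" "F b \<subseteq> {..<length B}" for F
  proof -
    have "exec (if F a \<noteq> {} then ?b else Pass (const_pass False)) (cells_of B F) 1 (cells_of B F) (F a \<noteq> {} \<and> F b \<noteq> {})"
      using ea[of F b] that exec_const_pass[of B False F] by auto
    from exec.Cond[OF ea[of F a] this] that show ?thesis by (simp add: numeral_2_eq_2)
  qed
  have "\<exists>F' n. exec (Loop ?test (Pass (drop_pass a b))) (cells_of B F) n (cells_of B F') False \<and>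
    n \<le> 3 * card (F a) + 2 \<and> (\<forall>v. v \<noteq> a \<longrightarrow> v \<noteq> b \<longrightarrow> F' v = F v) \<and> F' a \<subseteq> {..<length B} \<and>
    (F' a = {} \<longleftrightarrow> card (F a) \<le> card (F b))"
    using assms(3,4)
  proof (induction "card (F a)" arbitrary: F rule: less_induct)
    case less
    have fin: "finite (F a)" "finite (F b)" using less.prems finite_subset by blast+
    show ?case
    proof (cases "F a \<noteq> {} \<and> F b \<noteq> {}")
      case False
      then have eq: "(F a \<noteq> {} \<and> F b \<noteq> {}) = False" by simp
      from exec.LoopF[OF test[OF less.prems, unfolded eq]] show ?thesis
        using False less.prems fin by (intro exI[of _ F] exI[of _ 2]) auto
    next
      case True
      then have eq: "(F a \<noteq> {} \<and> F b \<noteq> {}) = True" by simp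
      note t = test[OF less.prems, unfolded eq]
      let ?F = "F(a := {p \<in> F a. \<exists>q<p. q \<in> F a}, b := {p \<in> F b. \<exists>q<p. q \<in> F b})"
      have ca: "card (?F a) = card (F a) - 1" "card (?F b) = card (F b) - 1"
        using card_drop_least fin assms(1) by auto
      have pos: "card (F a) > 0" "card (F b) > 0" using True fin by (auto simp: card_gt_0_iff)
      have "?F a \<subseteq> {..<length B}" "?F b \<subseteq> {..<length B}" using less.prems assms(1) by auto
      then obtain F' n where F': "exec (Loop ?test (Pass (drop_pass a b))) (cells_of B ?F) n (cells_of B F') False"
        "n \<le> 3 * card (?F a) + 2" "\<forall>v. v \<noteq> a \<longrightarrow> v \<noteq> b \<longrightarrow> F' v = ?F v" "F' a \<subseteq> {..<length B}"
        "F' a = {} \<longleftrightarrow> card (?F a) \<le> card (?F b)"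
        using less.hyps[of ?F] ca pos by auto
      have "2 + 1 + n \<le> 3 * card (F a) + 2" using F'(2) ca pos by linarith
      moreover have "F' a = {} \<longleftrightarrow> card (F a) \<le> card (F b)" using F'(5) ca pos by linarith
      ultimately show ?thesis
        using exec.LoopT[OF t exec_drop_pass[OF assms(1)] F'(1)] F'(3,4)
        by (intro exI[of _ F'] exI[of _ "2 + 1 + n"] conjI) auto
    qed
  qed
  then obtain F' n where F': "exec (Loop ?test (Pass (drop_pass a b))) (cells_of B F) n (cells_of B F') False"
    "n \<le> 3 * card (F a) + 2" "\<forall>v. v \<noteq> a \<longrightarrow> v \<noteq> b \<longrightarrow> F' v = F v" "F' a \<subseteq> {..<length B}"
    "F' a = {} \<longleftrightarrow> card (F a) \<le> card (F b)" by blast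
  have "exec (Cond ?a (Pass (const_pass False)) (Pass (const_pass True))) (cells_of B F') (1 + 1) (cells_of B F')
    (card (F a) \<le> card (F b))"
  proof (rule exec.Cond[OF ea[where F = F' and c = a, OF F'(4)]])
    show "exec (if F' a \<noteq> {} then Pass (const_pass False) else Pass (const_pass True)) (cells_of B F') 1
      (cells_of B F') (card (F a) \<le> card (F b))"
      using F'(5) exec_const_pass[of B "F' a = {}" F'] assms(2) by (cases "F' a = {}") auto
  qed
  from exec_seq[OF F'(1) this] have "exec (compare_tracks a b) (cells_of B F) (n + (1 + 1)) (cells_of B F') (card (F a) \<le> card (F b))"
    by (simp add: compare_tracks_def)
  moreover have "card (F a) \<le> length B"
    using card_mono[OF _ assms(3)] by simp
  ultimately show ?thesis using F'(2,3) by (intro exI[of _ F'] exI[of _ "n + (1 + 1)"]) auto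
qed

section \<open>Counting formulas and their evaluation\<close>

text \<open>\<open>CardLe\<close> is the only quantifier; existence is the special case of not
  having at most as many solutions as an unsatisfiable formula.\<close>

datatype form = Base "nat \<Rightarrow> bool" nat | In nat nat | Less nat nat | Neg form | Conj form form | CardLe form form

text \<open>
  Variables denote sets of positions; the ones bound by \<open>CardLe\<close> denote singletons. The level \<open>k\<close>
  is the first fresh variable and the one that \<open>CardLe\<close> binds.
\<close>

fun sat :: "nat list \<Rightarrow> nat \<Rightarrow> (nat \<Rightarrow> nat set) \<Rightarrow> form \<Rightarrow> bool" where
  "sat B k E (Base f v) \<longleftrightarrow> (\<exists>p<length B. p \<in> E v \<and> f (B ! p))"
| "sat B k E (In v w) \<longleftrightarrow> (\<exists>p<length B. p \<in> E v \<and> p \<in> E w)"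
| "sat B k E (Less v w) \<longleftrightarrow> (\<exists>q<length B. \<exists>p<q. p \<in> E v \<and> q \<in> E w)"
| "sat B k E (Neg f) \<longleftrightarrow> \<not> sat B k E f"
| "sat B k E (Conj f g) \<longleftrightarrow> sat B k E f \<and> sat B k E g"
| "sat B k E (CardLe f g) \<longleftrightarrow> card {p. p < length B \<and> sat B (Suc k) (E(k := {p})) f}
     \<le> card {p. p < length B \<and> sat B (Suc k) (E(k := {p})) g}"

fun wf_form :: "nat \<Rightarrow> form \<Rightarrow> bool" where
  "wf_form k (Base f v) \<longleftrightarrow> v < k"
| "wf_form k (In v w) \<longleftrightarrow> v < k \<and> w < k"
| "wf_form k (Less v w) \<longleftrightarrow> v < k \<and> w < k"
| "wf_form k (Neg f) \<longleftrightarrow> wf_form k f"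
| "wf_form k (Conj f g) \<longleftrightarrow> wf_form k f \<and> wf_form k g"
| "wf_form k (CardLe f g) \<longleftrightarrow> wf_form (Suc k) f \<and> wf_form (Suc k) g"

lemma sat_cong: "wf_form k f \<Longrightarrow> \<forall>v<k. E v = E' v \<Longrightarrow> sat B k E f \<longleftrightarrow> sat B k E' f"
proof (induction f arbitrary: k E E')
  case (Base f v)
  then have "E v = E' v" by simp
  then show ?case by (simp only: sat.simps)
next
  case (In v w)
  then have "E v = E' v" "E w = E' w" by simp_all
  then show ?case by (simp only: sat.simps)
next
  case (Less v w)
  then have "E v = E' v" "E w = E' w" by simp_all
  then show ?case by (simp only: sat.simps)
next
  case (Neg f)
  then show ?case using Neg.IH[of k E E'] by (simp only: sat.simps wf_form.simps)
next
  case (Conj f g)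
  then show ?case using Conj.IH(1)[of k E E'] Conj.IH(2)[of k E E']
    by (simp only: sat.simps wf_form.simps)
next
  case (CardLe f g)
  have upd: "\<forall>v<Suc k. (E(k := {p})) v = (E'(k := {p})) v" for p
    using CardLe.prems(2) by (simp add: less_Suc_eq)
  have wf: "wf_form (Suc k) f" "wf_form (Suc k) g" using CardLe.prems(1) by simp_all
  show ?case
    by (simp only: sat.simps CardLe.IH(1)[OF wf(1) upd] CardLe.IH(2)[OF wf(2) upd])
qed

text \<open>
  Variable \<open>v\<close> lives on track \<open>3 * v\<close>; the tracks \<open>3 * k + 1\<close> and \<open>3 * k + 2\<close> hold the two sets that
  a formula \<open>CardLe\<close> at level \<open>k\<close> compares.
\<close>

fun checker :: "nat \<Rightarrow> form \<Rightarrow> prog" where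
  "checker k (Base f v) = Pass (exists_pass (\<lambda>c. 3 * v \<in> snd c \<and> f (fst c)))"
| "checker k (In v w) = Pass (exists_pass (\<lambda>c. 3 * v \<in> snd c \<and> 3 * w \<in> snd c))"
| "checker k (Less v w) = Pass (less_pass (3 * v) (3 * w))"
| "checker k (Neg f) = Cond (checker k f) (Pass (const_pass False)) (Pass (const_pass True))"
| "checker k (Conj f g) = Cond (checker k f) (checker k g) (Pass (const_pass False))"
| "checker k (CardLe f g) = seq (collect (3 * k) (3 * k + 1) (checker (Suc k) f))
     (seq (collect (3 * k) (3 * k + 2) (checker (Suc k) g)) (compare_tracks (3 * k + 1) (3 * k + 2)))"

text \<open>Each quantifier multiplies by the tape length, so a fixed formula costs polynomially
  many sweeps, of degree at most its quantifier depth plus one.\<close>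

fun cost :: "form \<Rightarrow> nat \<Rightarrow> nat" where
  "cost (Neg f) N = cost f N + 1"
| "cost (Conj f g) N = cost f N + cost g N + 1"
| "cost (CardLe f g) N = N * (cost f N + 3) + N * (cost g N + 3) + 3 * N + 8"
| "cost _ N = 1"

lemma boundable_checker: "boundable (checker k f)"
proof (induction f arbitrary: k)
  case (CardLe f g)
  then show ?case
    unfolding checker.simps collect_def compare_tracks_def by (intro boundable)
qed (simp_all add: boundable)

text \<open>That the tracks below \<open>3 * k\<close> survive keeps the free variables available to
  the second conjunct and to later iterations of an enclosing loop.\<close>

lemma exec_checker:
  assumes "B \<noteq> []"
  shows "wf_form k f \<Longrightarrow> \<exists>F' n. exec (checker k f) (cells_of B F) n (cells_of B F') (sat B k (\<lambda>v. F (3 * v)) f) \<and>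
    n \<le> cost f (length B) \<and> (\<forall>v<3 * k. F' v = F v)"
proof (induction f arbitrary: k F)
  case (Base f v)
  then show ?case
    using exec_exists_pass[of "\<lambda>c. 3 * v \<in> snd c \<and> f (fst c)" B F] by (auto intro!: exI[of _ F])
next
  case (In v w)
  then show ?case
    using exec_exists_pass[of "\<lambda>c. 3 * v \<in> snd c \<and> 3 * w \<in> snd c" B F] by (auto intro!: exI[of _ F])
next
  case (Less v w)
  then show ?case
    using exec_less_pass[of "3 * v" "3 * w" B F] by (auto intro!: exI[of _ F])
next
  case (Neg f)
  define s where "s = sat B k (\<lambda>v. F (3 * v)) f"
  obtain F' n where F': "exec (checker k f) (cells_of B F) n (cells_of B F') s"
    "n \<le> cost f (length B)" "\<forall>v<3 * k. F' v = F v"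
    using Neg.IH[of k F] Neg.prems unfolding s_def by auto
  have "exec (if s then Pass (const_pass False) else Pass (const_pass True)) (cells_of B F') 1 (cells_of B F') (\<not> s)"
    using exec_const_pass[of B "\<not> s" F'] assms by (cases s) auto
  from exec.Cond[OF F'(1) this] show ?case using F' by (auto simp: s_def[symmetric])
next
  case (Conj f g)
  define s where "s = sat B k (\<lambda>v. F (3 * v)) f"
  obtain F' n where F': "exec (checker k f) (cells_of B F) n (cells_of B F') s"
    "n \<le> cost f (length B)" "\<forall>v<3 * k. F' v = F v"
    using Conj.IH(1)[of k F] Conj.prems unfolding s_def by auto
  have g: "sat B k (\<lambda>v. F' (3 * v)) g = sat B k (\<lambda>v. F (3 * v)) g"
    using Conj.prems F'(3) by (intro sat_cong) auto
  obtain F'' n' where F'': "exec (checker k g) (cells_of B F') n' (cells_of B F'') (sat B k (\<lambda>v. F (3 * v)) g)"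
    "n' \<le> cost g (length B)" "\<forall>v<3 * k. F'' v = F' v"
    using Conj.IH(2)[of k F'] Conj.prems unfolding g by auto
  show ?case
  proof (cases s)
    case True
    then have "exec (checker k (Conj f g)) (cells_of B F) (n + n') (cells_of B F'') (sat B k (\<lambda>v. F (3 * v)) g)"
      using F'(1) F''(1) by (auto intro: exec.Cond)
    then show ?thesis using True F' F'' by (auto simp: s_def intro!: exI[of _ F''] exI[of _ "n + n'"])
  next
    case False
    then have "exec (checker k (Conj f g)) (cells_of B F) (n + 1) (cells_of B F') False"
      using exec.Cond[OF F'(1), of "checker k g" "Pass (const_pass False)" 1 "cells_of B F'" False]
        exec_const_pass[of B False F'] by simp
    then show ?thesis using False F' by (auto simp: s_def intro!: exI[of _ F'] exI[of _ "n + 1"])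
  qed
next
  case (CardLe f g)
  let ?P = "\<lambda>h F. sat B (Suc k) (\<lambda>v. F (3 * v)) h"
  \<comment> \<open>Variables live on multiples of 3, so the auxiliary tracks
    \<open>3 * k + 1\<close> and \<open>3 * k + 2\<close> do not influence the truth of the
    bodies.\<close>
  have P: "?P h F = ?P h F'" if "\<forall>v<3 * Suc k. v \<noteq> a \<longrightarrow> F v = F' v" "a \<in> {3 * k + 1, 3 * k + 2}" "h \<in> {f, g}" for F F' a h
  proof (rule sat_cong)
    show "\<forall>v<Suc k. F (3 * v) = F' (3 * v)"
    proof (intro allI impI)
      fix v assume "v < Suc k"
      then have "3 * v < 3 * Suc k" "3 * v \<noteq> a" using that(2) by (auto, presburger+)
      then show "F (3 * v) = F' (3 * v)" using that(1) by auto
    qed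
  qed (use CardLe.prems that in auto)
  have upd: "?P h (F(3 * k := {p})) = sat B (Suc k) ((\<lambda>v. F (3 * v))(k := {p})) h" for h F p
    by (rule arg_cong[where f = "\<lambda>E. sat B (Suc k) E h"]) auto
  obtain F1 n1 where F1: "exec (collect (3 * k) (3 * k + 1) (checker (Suc k) f)) (cells_of B F) n1 (cells_of B F1) False"
    "n1 \<le> 2 + length B * (cost f (length B) + 3)" "\<forall>v<3 * Suc k. v \<noteq> 3 * k \<longrightarrow> v \<noteq> 3 * k + 1 \<longrightarrow> F1 v = F v"
    "F1 (3 * k + 1) = {p. p < length B \<and> ?P f (F(3 * k := {p}))}"
    using exec_collect[of "checker (Suc k) f" B "?P f" "cost f (length B)" "3 * Suc k" "3 * k + 1" "3 * k" F,
        OF _ P[where a = "3 * k + 1"]] CardLe.IH(1)[of "Suc k"] CardLe.prems assms by auto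
  obtain F2 n2 where F2: "exec (collect (3 * k) (3 * k + 2) (checker (Suc k) g)) (cells_of B F1) n2 (cells_of B F2) False"
    "n2 \<le> 2 + length B * (cost g (length B) + 3)" "\<forall>v<3 * Suc k. v \<noteq> 3 * k \<longrightarrow> v \<noteq> 3 * k + 2 \<longrightarrow> F2 v = F1 v"
    "F2 (3 * k + 2) = {p. p < length B \<and> ?P g (F1(3 * k := {p}))}"
    using exec_collect[of "checker (Suc k) g" B "?P g" "cost g (length B)" "3 * Suc k" "3 * k + 2" "3 * k" F1,
        OF _ P[where a = "3 * k + 2"]] CardLe.IH(2)[of "Suc k"] CardLe.prems assms by auto
  \<comment> \<open>The first loop has spoiled the tracks \<open>3 * k\<close> and
    \<open>3 * k + 1\<close>; the second loop sets \<open>3 * k\<close> anew, and \<open>g\<close>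
    does not look at the other one.\<close>
  have F1g: "?P g (F1(3 * k := {p})) = ?P g (F(3 * k := {p}))" for p
    using F1(3) by (intro P[of "3 * k + 1"]) auto
  have r: "(card (F2 (3 * k + 1)) \<le> card (F2 (3 * k + 2))) = sat B k (\<lambda>v. F (3 * v)) (CardLe f g)"
  proof -
    have "F2 (3 * k + 1) = F1 (3 * k + 1)" using F2(3) by auto
    then show ?thesis by (simp only: F1(4) F2(4) upd F1g[unfolded upd] sat.simps)
  qed
  obtain F3 n3 where F3: "exec (compare_tracks (3 * k + 1) (3 * k + 2)) (cells_of B F2) n3 (cells_of B F3)
      (sat B k (\<lambda>v. F (3 * v)) (CardLe f g))"
    "n3 \<le> 3 * length B + 4" "\<forall>v. v \<noteq> 3 * k + 1 \<longrightarrow> v \<noteq> 3 * k + 2 \<longrightarrow> F3 v = F2 v"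
    using exec_compare_tracks[of "3 * k + 1" "3 * k + 2" B F2, unfolded r] F2 F1 assms by auto
  from exec_seq[OF F1(1) exec_seq[OF F2(1) F3(1)]] F1(2,3) F2(2,3) F3(2,3) show ?case
    by (intro exI[of _ F3] exI[of _ "n1 + (n2 + n3)"]) auto
qed

section \<open>Polynomial bounds\<close>

definition poly_bounded :: "(nat \<Rightarrow> nat) \<Rightarrow> bool" where
  "poly_bounded f \<longleftrightarrow> (\<exists>C e. \<forall>N. f N \<le> C * (N + 1) ^ e)"

lemma poly_bounded_const: "poly_bounded (\<lambda>N. c)"
  unfolding poly_bounded_def by (intro exI[of _ c] exI[of _ 0]) simp

lemma poly_bounded_id: "poly_bounded (\<lambda>N. N)"
  unfolding poly_bounded_def by (intro exI[of _ 1]) simp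

lemma poly_bounded_add:
  assumes "poly_bounded f" "poly_bounded g"
  shows "poly_bounded (\<lambda>N. f N + g N)"
proof -
  obtain C e where C: "\<And>N. f N \<le> C * (N + 1) ^ e" using assms(1) by (auto simp: poly_bounded_def)
  obtain C' e' where C': "\<And>N. g N \<le> C' * (N + 1) ^ e'" using assms(2) by (auto simp: poly_bounded_def)
  have "f N + g N \<le> (C + C') * (N + 1) ^ (e + e')" for N
  proof -
    have "C * (N + 1) ^ e \<le> C * (N + 1) ^ (e + e')" "C' * (N + 1) ^ e' \<le> C' * (N + 1) ^ (e + e')"
      by (rule mult_le_mono2, rule power_increasing; simp)+
    from add_mono[OF order_trans[OF C this(1)] order_trans[OF C' this(2)]] show ?thesis
      by (simp only: distrib_right)
  qed
  then show ?thesis unfolding poly_bounded_def by blast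
qed

lemma poly_bounded_mult:
  assumes "poly_bounded f" "poly_bounded g"
  shows "poly_bounded (\<lambda>N. f N * g N)"
proof -
  obtain C e where C: "\<And>N. f N \<le> C * (N + 1) ^ e" using assms(1) by (auto simp: poly_bounded_def)
  obtain C' e' where C': "\<And>N. g N \<le> C' * (N + 1) ^ e'" using assms(2) by (auto simp: poly_bounded_def)
  have "f N * g N \<le> (C * C') * (N + 1) ^ (e + e')" for N
    using mult_le_mono[OF C[of N] C'[of N]] by (simp add: power_add ac_simps)
  then show ?thesis unfolding poly_bounded_def by blast
qed

lemmas poly_bounded_intros = poly_bounded_const poly_bounded_id poly_bounded_add poly_bounded_mult

lemma poly_bounded_cost: "poly_bounded (cost f)"
proof -
  have "poly_bounded (\<lambda>N. cost f N)"
    by (induction f) (simp_all only: cost.simps, (intro poly_bounded_intros; assumption)+)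
  then show ?thesis .
qed

section \<open>Evaluation on marks and replacement of marks\<close>

definition marks :: "nat set \<Rightarrow> nat set \<Rightarrow> nat \<Rightarrow> nat set" where
  "marks X Y = (\<lambda>_. {})(0 := X, 1 := Y)"

text \<open>Both formulas refer to the old marks, so the new sets are gathered on the tracks 7 and 8
  before the tracks 0 and 3 are overwritten. Track 6 carries variable 2, the position under
  test.\<close>

definition update :: "form \<Rightarrow> form \<Rightarrow> prog" where
  "update f g = seq (collect 6 7 (checker 3 f)) (seq (collect 6 8 (checker 3 g)) (Pass (copy_pass 7 0 8 3)))"

lemma boundable_update: "boundable (update f g)"
  by (auto simp: update_def collect_def intro!: boundable boundable_checker)

lemma exec_check:
  assumes "B \<noteq> []" "wf_form 2 f"
  shows "\<exists>F' n. exec (checker 2 f) (cells_of B F) n (cells_of B F') (sat B 2 (marks (F 0) (F 3)) f) \<and>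
    n \<le> cost f (length B) \<and> F' 0 = F 0 \<and> F' 3 = F 3"
proof -
  have "sat B 2 (\<lambda>v. F (3 * v)) f = sat B 2 (marks (F 0) (F 3)) f"
    by (rule sat_cong[OF assms(2)]) (auto simp: marks_def less_2_cases_iff)
  moreover obtain F' n where "exec (checker 2 f) (cells_of B F) n (cells_of B F') (sat B 2 (\<lambda>v. F (3 * v)) f)"
    "n \<le> cost f (length B)" "\<forall>v<3 * 2. F' v = F v"
    using exec_checker[OF assms, of F] by blast
  ultimately show ?thesis by (intro exI[of _ F'] exI[of _ n]) auto
qed

lemma exec_update:
  assumes "B \<noteq> []" "wf_form 3 f" "wf_form 3 g"
  shows "\<exists>F' n. exec (update f g) (cells_of B F) n (cells_of B F') False \<and>
    n \<le> length B * (cost f (length B) + 3) + length B * (cost g (length B) + 3) + 5 \<and>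
    F' 0 = {p. p < length B \<and> sat B 3 ((marks (F 0) (F 3))(2 := {p})) f} \<and>
    F' 3 = {p. p < length B \<and> sat B 3 ((marks (F 0) (F 3))(2 := {p})) g}"
proof -
  let ?P = "\<lambda>h F. sat B 3 (\<lambda>v. F (3 * v)) h"
  have P: "?P h F = ?P h F'" if "\<forall>v<9. v \<noteq> a \<longrightarrow> F v = F' v" "a \<in> {7, 8}" "h \<in> {f, g}" for F F' a h
  proof (rule sat_cong)
    show "\<forall>v<3. F (3 * v) = F' (3 * v)"
    proof (intro allI impI)
      fix v :: nat assume "v < 3"
      then have "3 * v < 9" "3 * v \<noteq> a" using that(2) by (auto, presburger+)
      then show "F (3 * v) = F' (3 * v)" using that(1) by auto
    qed
  qed (use assms that in auto)
  have upd: "?P h (F(6 := {p})) = sat B 3 ((marks (F 0) (F 3))(2 := {p})) h" if "h \<in> {f, g}" for h F p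
    by (rule sat_cong) (use that assms in \<open>auto simp: marks_def numeral_3_eq_3 less_Suc_eq\<close>)
  obtain F1 n1 where F1: "exec (collect 6 7 (checker 3 f)) (cells_of B F) n1 (cells_of B F1) False"
    "n1 \<le> 2 + length B * (cost f (length B) + 3)" "\<forall>v<9. v \<noteq> 6 \<longrightarrow> v \<noteq> 7 \<longrightarrow> F1 v = F v"
    "F1 7 = {p. p < length B \<and> ?P f (F(6 := {p}))}"
    using exec_collect[of "checker 3 f" B "?P f" "cost f (length B)" 9 7 6 F, OF _ P[where a = 7]]
      exec_checker[of B 3 f] assms by auto
  obtain F2 n2 where F2: "exec (collect 6 8 (checker 3 g)) (cells_of B F1) n2 (cells_of B F2) False"
    "n2 \<le> 2 + length B * (cost g (length B) + 3)" "\<forall>v<9. v \<noteq> 6 \<longrightarrow> v \<noteq> 8 \<longrightarrow> F2 v = F1 v"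
    "F2 8 = {p. p < length B \<and> ?P g (F1(6 := {p}))}"
    using exec_collect[of "checker 3 g" B "?P g" "cost g (length B)" 9 8 6 F1, OF _ P[where a = 8]]
      exec_checker[of B 3 g] assms by auto
  have "exec (update f g) (cells_of B F) (n1 + (n2 + 1)) (cells_of B (F2(0 := F2 7, 3 := F2 8))) False"
    unfolding update_def by (rule exec_seq[OF F1(1) exec_seq[OF F2(1) exec_copy_pass]]) simp
  moreover have "F2 7 = {p. p < length B \<and> sat B 3 ((marks (F 0) (F 3))(2 := {p})) f}"
    using F2(3) F1(4) upd by simp
  moreover have "F2 8 = {p. p < length B \<and> sat B 3 ((marks (F 0) (F 3))(2 := {p})) g}"
    using F2(4) F1(3) upd[of g F1] by simp
  ultimately show ?thesis using F1(2) F2(2)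
    by (intro exI[of _ "F2(0 := F2 7, 3 := F2 8)"] exI[of _ "n1 + (n2 + 1)"]) auto
qed

section \<open>The game and the exploration of its tree\<close>

text \<open>\<open>S\<close> consists of the targets that fit all responses so far and have not been
  queried. The opponent may also give a response that no member of \<open>S\<close> gives; this
  leaves the empty set, harmless as long as there is some query. For an empty dictionary and a
  positive number of rounds the value is false, in accordance with the lack of strategies.\<close>

fun win :: "nat list set \<Rightarrow> nat list set \<Rightarrow> nat \<Rightarrow> nat list set \<Rightarrow> bool" where
  "win D W 0 S \<longleftrightarrow> S = {}"
| "win D W (Suc k) S \<longleftrightarrow>
     (\<exists>u\<in>D. \<forall>w\<in>W. win D W k {v \<in> S. wordle_oracle v u = wordle_oracle w u \<and> v \<noteq> u})"

lemma length_oracle [simp]: "length (wordle_oracle w u) = length u"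
  by (simp add: wordle_oracle_def)

lemma set_oracle: "set (wordle_oracle w u) \<subseteq> {0, 1, 2}"
  by (auto simp: wordle_oracle_def)

lemma oracle_all_green:
  assumes "length w = d" "length u = d"
  shows "wordle_oracle w u = replicate d 2 \<longleftrightarrow> w = u"
proof
  assume eq: "wordle_oracle w u = replicate d 2"
  show "w = u"
  proof (rule nth_equalityI)
    fix i assume "i < length w"
    then have "wordle_oracle w u ! i = 2" "i < length u" using eq assms by simp_all
    then show "w ! i = u ! i" by (auto simp: wordle_oracle_def split: if_splits)
  qed (use assms in simp)
next
  assume "w = u"
  then show "wordle_oracle w u = replicate d 2"
    using assms by (intro nth_equalityI) (auto simp: wordle_oracle_def)
qed

lemma length_play [simp]: "length (play \<sigma> w k) = k"
  by (induction k) auto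

lemma set_play: "i < k \<Longrightarrow> (\<sigma> (play \<sigma> w i), wordle_oracle w (\<sigma> (play \<sigma> w i))) \<in> set (play \<sigma> w k)"
  by (induction k) (auto simp: less_Suc_eq)

lemma winning_imp_win:
  assumes WI: "wordle_instance WI" and \<sigma>: "winning_strategy WI \<sigma>"
  shows "win (dictionary WI) (word_list WI) (game_length WI) (word_list WI)"
proof -
  let ?D = "dictionary WI" and ?W = "word_list WI" and ?g = "game_length WI"
  have len: "\<And>u. u \<in> ?D \<Longrightarrow> length u = dimension WI" and sub: "?W \<subseteq> ?D"
    using WI by (auto simp: wordle_instance_def)
  have query: "\<sigma> h \<in> ?D" if "h \<in> histories WI" for h
    using \<sigma> that by (auto simp: winning_strategy_def strategy_def)
  have hist: "play \<sigma> v k \<in> histories WI" for v k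
  proof (induction k)
    case (Suc k)
    then show ?case using query[OF Suc] len set_oracle by (auto simp: histories_def)
  qed (simp add: histories_def)
  \<comment> \<open>The survivors of \<open>h\<close> are the unqueried targets against which the
    strategy produces exactly \<open>h\<close>. The claim covers histories that arise in no play as
    well, since the responses in \<open>win\<close> may come from different targets; there the set
    is empty.\<close>
  have "win ?D ?W k {v \<in> ?W. play \<sigma> v (length h) = h \<and> (\<forall>(u, r)\<in>set h. v \<noteq> u)}"
    if "h \<in> histories WI" "length h + k = ?g" for h k
    using that
  proof (induction k arbitrary: h)
    case 0
    \<comment> \<open>A successful round \<open>k\<close> queries \<open>v\<close> itself, as answer
      to the history of length \<open>k - 1\<close>, so \<open>v\<close> occurs as a query in
      \<open>h\<close>.\<close>
    have no_survivor: False if v: "v \<in> ?W" "play \<sigma> v ?g = h" "\<forall>(u, r)\<in>set h. v \<noteq> u" for v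
    proof -
      obtain k where k: "k \<in> {1..?g}" "succeeds_in_round WI \<sigma> v k"
        using \<sigma> v(1) by (auto simp: winning_strategy_def)
      have "\<sigma> (play \<sigma> v (k - 1)) = v"
        using k(2) oracle_all_green[of v "dimension WI"] query[OF hist] len v(1) sub
        by (auto simp: succeeds_in_round_def)
      moreover have "k - 1 < ?g" using k(1) by auto
      ultimately show False using set_play[of "k - 1" ?g \<sigma> v] v(2,3) by fastforce
    qed
    have "length h = ?g" using 0 by simp
    with no_survivor show ?case by simp blast
  next
    case (Suc k)
    let ?u = "\<sigma> h"
    have u: "?u \<in> ?D" using query Suc.prems by blast
    have "win ?D ?W k {v \<in> {v \<in> ?W. play \<sigma> v (length h) = h \<and> (\<forall>(u, r)\<in>set h. v \<noteq> u)}.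
      wordle_oracle v ?u = wordle_oracle w ?u \<and> v \<noteq> ?u}" if "w \<in> ?W" for w
    proof -
      let ?h = "h @ [(?u, wordle_oracle w ?u)]"
      have "?h \<in> histories WI"
        using Suc.prems(1) u len set_oracle[of w ?u] by (auto simp: histories_def)
      moreover have "{v \<in> {v \<in> ?W. play \<sigma> v (length h) = h \<and> (\<forall>(u, r)\<in>set h. v \<noteq> u)}.
          wordle_oracle v ?u = wordle_oracle w ?u \<and> v \<noteq> ?u} =
        {v \<in> ?W. play \<sigma> v (length ?h) = ?h \<and> (\<forall>(u, r)\<in>set ?h. v \<noteq> u)}"
        by auto
      ultimately show ?thesis using Suc.IH[of ?h] Suc.prems(2) by simp
    qed
    then show ?case using u by auto
  qed
  from this[of "[]" ?g] show ?thesis by (simp add: histories_def)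
qed

lemma win_imp_winning:
  assumes WI: "wordle_instance WI"
    and win: "win (dictionary WI) (word_list WI) (game_length WI) (word_list WI)"
  shows "\<exists>\<sigma>. winning_strategy WI \<sigma>"
proof -
  let ?D = "dictionary WI" and ?W = "word_list WI" and ?g = "game_length WI"
  have len: "\<And>u. u \<in> ?D \<Longrightarrow> length u = dimension WI" and sub: "?W \<subseteq> ?D" and g: "?g > 0"
    using WI by (auto simp: wordle_instance_def)
  \<comment> \<open>As \<open>game_length\<close> is positive, the outermost level of
    \<open>win\<close> provides a query.\<close>
  have D: "\<exists>u. u \<in> ?D" using win g by (cases ?g) auto
  define S where "S h = {v \<in> ?W. \<forall>(u, r)\<in>set h. wordle_oracle v u = r \<and> v \<noteq> u}" for h :: history
  define good where "good h u \<longleftrightarrow> u \<in> ?D \<and>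
    (\<forall>w\<in>?W. win ?D ?W (?g - length h - 1) {v \<in> S h. wordle_oracle v u = wordle_oracle w u \<and> v \<noteq> u})" for h u
  \<comment> \<open>The default serves histories without a good query: a strategy has to answer
    these with a dictionary word too.\<close>
  define \<sigma> where "\<sigma> h = (if \<exists>u. good h u then SOME u. good h u else SOME u. u \<in> ?D)" for h
  have good: "good h (\<sigma> h)" if "\<exists>u. good h u" for h
    using that by (simp add: \<sigma>_def someI_ex)
  have "strategy WI \<sigma>"
    unfolding strategy_def
  proof
    fix h
    show "\<sigma> h \<in> ?D"
    proof (cases "\<exists>u. good h u")
      case True
      then show ?thesis using good by (simp add: good_def)
    next
      case False
      then show ?thesis using someI_ex[OF D] by (simp add: \<sigma>_def)
    qed
  qed
  moreover have "\<exists>k\<in>{1..?g}. succeeds_in_round WI \<sigma> w k" if w: "w \<in> ?W" for w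
  proof (rule ccontr)
    assume no: "\<not> ?thesis"
    \<comment> \<open>A target never queried remains a survivor, while the player keeps a winning
      position; after all rounds this contradicts the emptiness of the survivors.\<close>
    have "w \<in> S (play \<sigma> w j) \<and> win ?D ?W (?g - j) (S (play \<sigma> w j))" if "j \<le> ?g" for j
      using that
    proof (induction j)
      case 0
      then show ?case using w win by (simp add: S_def)
    next
      case (Suc j)
      define h where "h = play \<sigma> w j"
      have IH: "w \<in> S h" "win ?D ?W (?g - j) (S h)" using Suc by (auto simp: h_def)
      have eq: "?g - j = Suc (?g - length h - 1)" using Suc.prems by (simp add: h_def)
      have "\<exists>u. good h u" using IH(2) unfolding eq by (auto simp: good_def)
      from good[OF this] have u: "\<sigma> h \<in> ?D"
        "win ?D ?W (?g - length h - 1) {v \<in> S h. wordle_oracle v (\<sigma> h) = wordle_oracle w (\<sigma> h) \<and> v \<noteq> \<sigma> h}"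
        using w by (auto simp: good_def)
      have "\<not> succeeds_in_round WI \<sigma> w (Suc j)" using no Suc.prems by auto
      then have "w \<noteq> \<sigma> h"
        using oracle_all_green[of w "dimension WI" "\<sigma> h"] u(1) len w sub
        by (auto simp: succeeds_in_round_def h_def)
      moreover have "S (play \<sigma> w (Suc j)) = {v \<in> S h. wordle_oracle v (\<sigma> h) = wordle_oracle w (\<sigma> h) \<and> v \<noteq> \<sigma> h}"
        by (auto simp: S_def h_def)
      ultimately show ?case using u(2) IH(1) by (simp add: h_def)
    qed
    from this[of ?g] show False by auto
  qed
  ultimately show ?thesis by (auto simp: winning_strategy_def)
qed

lemma winning_strategy_iff_win:
  "wordle_instance WI \<Longrightarrow> (\<exists>\<sigma>. winning_strategy WI \<sigma>) \<longleftrightarrow>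
    win (dictionary WI) (word_list WI) (game_length WI) (word_list WI)"
  using winning_imp_win win_imp_winning by blast

section \<open>The game tree over tape positions\<close>

type_synonym path = "nat \<Rightarrow> nat \<times> nat"

fun tree_value :: "nat \<Rightarrow> (path \<Rightarrow> bool) \<Rightarrow> nat \<Rightarrow> path \<Rightarrow> bool" where
  "tree_value n leaf 0 \<pi> \<longleftrightarrow> leaf \<pi>"
| "tree_value n leaf (Suc b) \<pi> \<longleftrightarrow> (\<exists>p<n. \<forall>q<n. tree_value n leaf b (\<pi>(b := (p, q))))"

text \<open>
  A path chooses a query position and a target position in each round; coordinate 0 is the last
  round. Positions that start no word are allowed: a bad query position makes the leaf false, and
  otherwise a bad target position makes it true. As the dictionary is nonempty as soon as there is
  a good query position, this does not change the value of the game.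
\<close>

definition game_leaf ::
  "nat \<Rightarrow> (nat \<Rightarrow> bool) \<Rightarrow> (nat \<Rightarrow> bool) \<Rightarrow> (nat \<Rightarrow> nat list) \<Rightarrow> nat list set \<Rightarrow> path \<Rightarrow> bool" where
  "game_leaf g dst wst word W \<pi> \<longleftrightarrow> (\<forall>b<g. dst (fst (\<pi> b))) \<and> ((\<forall>b<g. wst (snd (\<pi> b))) \<longrightarrow>
     \<not> (\<exists>t\<in>W. \<forall>b<g. word (fst (\<pi> b)) \<noteq> t \<and>
        wordle_oracle (word (snd (\<pi> b))) (word (fst (\<pi> b))) = wordle_oracle t (word (fst (\<pi> b)))))"

text \<open>Different positions may hold the same word, and many hold none. The former is harmless
  because only the images under \<open>word\<close> matter; for the latter, a player who chooses a
  bad position loses, provided that the query is judged before the target.\<close>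

lemma tree_value_game:
  assumes D: "word ` {p. p < n \<and> dst p} = D" and W: "word ` {q. q < n \<and> wst q} = W" and n: "n > 0"
  shows "tree_value n (game_leaf g dst wst word W) g \<pi> \<longleftrightarrow> win D W g W"
proof -
  let ?val = "tree_value n (game_leaf g dst wst word W)"
  \<comment> \<open>A bad query position that is already fixed falsifies all leaves below;
    \<open>n > 0\<close> gives the opponent a move at every level.\<close>
  have badP: "\<not> ?val b \<pi>" if "b \<le> c" "c < g" "\<not> dst (fst (\<pi> c))" for b c \<pi>
    using that
  proof (induction b arbitrary: \<pi>)
    case (Suc b)
    then show ?case using n by (auto intro!: exI[of _ 0])
  qed (auto simp: game_leaf_def)
  \<comment> \<open>With a bad target position fixed, the player only has to avoid bad query
    positions in the remaining rounds, which a nonempty dictionary permits.\<close>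
  have badQ: "?val b \<pi>" if "b \<le> c" "c < g" "\<not> wst (snd (\<pi> c))" "\<forall>c. b \<le> c \<and> c < g \<longrightarrow> dst (fst (\<pi> c))" "D \<noteq> {}" for b c \<pi>
    using that
  proof (induction b arbitrary: \<pi>)
    case (Suc b)
    obtain p where p: "p < n" "dst p" using D Suc.prems(5) by auto
    have "?val b (\<pi>(b := (p, q)))" for q
      by (rule Suc.IH) (use Suc.prems p in auto)
    then show ?case using p by auto
  qed (auto simp: game_leaf_def)
  \<comment> \<open>With \<open>b\<close> rounds left the coordinates from \<open>b\<close> on are
    fixed; they determine the survivors.\<close>
  have "?val b \<pi> \<longleftrightarrow> win D W b {t \<in> W. \<forall>c. b \<le> c \<and> c < g \<longrightarrow> word (fst (\<pi> c)) \<noteq> t \<and>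
      wordle_oracle (word (snd (\<pi> c))) (word (fst (\<pi> c))) = wordle_oracle t (word (fst (\<pi> c)))}"
    if "b \<le> g" "\<forall>c. b \<le> c \<and> c < g \<longrightarrow> dst (fst (\<pi> c)) \<and> wst (snd (\<pi> c))" for b \<pi>
    using that
  proof (induction b arbitrary: \<pi>)
    case 0
    then show ?case by (auto simp: game_leaf_def)
  next
    case (Suc b)
    let ?S = "\<lambda>b \<pi>. {t \<in> W. \<forall>c. b \<le> c \<and> c < g \<longrightarrow> word (fst (\<pi> c)) \<noteq> t \<and>
      wordle_oracle (word (snd (\<pi> c))) (word (fst (\<pi> c))) = wordle_oracle t (word (fst (\<pi> c)))}"
    have step: "?val b (\<pi>(b := (p, q))) \<longleftrightarrow>
        win D W b {v \<in> ?S (Suc b) \<pi>. wordle_oracle v (word p) = wordle_oracle (word q) (word p) \<and> v \<noteq> word p}"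
      if "dst p" "wst q" for p q
    proof -
      have S: "?S b (\<pi>(b := (p, q))) =
          {v \<in> ?S (Suc b) \<pi>. wordle_oracle v (word p) = wordle_oracle (word q) (word p) \<and> v \<noteq> word p}"
      proof -
        have "(\<forall>c. b \<le> c \<and> c < g \<longrightarrow> R c) \<longleftrightarrow> R b \<and> (\<forall>c. Suc b \<le> c \<and> c < g \<longrightarrow> R c)" for R
          using Suc.prems(1) by (metis Suc_leD Suc_le_eq le_neq_implies_less order_refl)
        then show ?thesis by auto
      qed
      have ok: "\<forall>c. b \<le> c \<and> c < g \<longrightarrow> dst (fst ((\<pi>(b := (p, q))) c)) \<and> wst (snd ((\<pi>(b := (p, q))) c))"
        using Suc.prems that by auto
      have "b \<le> g" using Suc.prems(1) by simp
      from Suc.IH[OF this ok] show ?thesis unfolding S .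
    qed
    have row: "(\<forall>q<n. ?val b (\<pi>(b := (p, q)))) \<longleftrightarrow> dst p \<and> (\<forall>w\<in>W. win D W b
        {v \<in> ?S (Suc b) \<pi>. wordle_oracle v (word p) = wordle_oracle w (word p) \<and> v \<noteq> word p})"
      if "p < n" for p
    proof (cases "dst p")
      case True
      have "?val b (\<pi>(b := (p, q)))" if "\<not> wst q" for q
        by (rule badQ[of b b]) (use Suc.prems True that D \<open>p < n\<close> in auto)
      then have "(\<forall>q<n. ?val b (\<pi>(b := (p, q)))) \<longleftrightarrow> (\<forall>q\<in>{q. q < n \<and> wst q}. ?val b (\<pi>(b := (p, q))))"
        by auto
      also have "\<dots> \<longleftrightarrow> (\<forall>q\<in>{q. q < n \<and> wst q}. win D W b
        {v \<in> ?S (Suc b) \<pi>. wordle_oracle v (word p) = wordle_oracle (word q) (word p) \<and> v \<noteq> word p})"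
        using step[OF True] by (intro ball_cong refl) blast
      also have "\<dots> \<longleftrightarrow> (\<forall>w\<in>W. win D W b
        {v \<in> ?S (Suc b) \<pi>. wordle_oracle v (word p) = wordle_oracle w (word p) \<and> v \<noteq> word p})"
        unfolding W[symmetric] by blast
      finally show ?thesis using True by blast
    next
      case False
      then have "\<not> ?val b (\<pi>(b := (p, 0)))"
        using Suc.prems by (intro badP[of b b]) auto
      then show ?thesis using False n by blast
    qed
    have "?val (Suc b) \<pi> \<longleftrightarrow> (\<exists>p\<in>{p. p < n \<and> dst p}. \<forall>w\<in>W. win D W b
        {v \<in> ?S (Suc b) \<pi>. wordle_oracle v (word p) = wordle_oracle w (word p) \<and> v \<noteq> word p})"
      using row by auto
    also have "\<dots> \<longleftrightarrow> win D W (Suc b) (?S (Suc b) \<pi>)"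
      unfolding win.simps D[symmetric] by blast
    finally show ?case .
  qed
  from this[of g \<pi>] show ?thesis by (simp add: not_le[symmetric] cong: conj_cong)
qed

section \<open>Search through the leaves with short-circuiting\<close>

text \<open>
  The search reads a path as a counter whose least significant coordinate is 0. At a true leaf the
  lowest target position that is not the last one is advanced, at a false leaf the lowest such query
  position, and everything below is reset.
\<close>

definition full :: "nat \<Rightarrow> bool \<Rightarrow> path \<Rightarrow> nat \<Rightarrow> bool" where
  "full n v \<pi> b \<longleftrightarrow> Suc (if v then snd (\<pi> b) else fst (\<pi> b)) = n"

definition advance :: "nat \<Rightarrow> bool \<Rightarrow> path \<Rightarrow> path" where
  "advance n v \<pi> b =
     (if \<forall>c<b. full n v \<pi> c
      then if full n v \<pi> b then (0, 0)
        else if v then (fst (\<pi> b), Suc (snd (\<pi> b))) else (Suc (fst (\<pi> b)), 0)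
      else \<pi> b)"

abbreviation next_path :: "nat \<Rightarrow> (path \<Rightarrow> bool) \<Rightarrow> path \<Rightarrow> path" where
  "next_path n leaf \<pi> \<equiv> advance n (leaf \<pi>) \<pi>"

text \<open>The search leaves the subtree of the \<open>b\<close> lowest coordinates exactly when
  all of these are full with respect to the current leaf value, and this leaf value is then the
  value of the whole subtree. Therefore no value of an inner node has to be remembered.\<close>

definition explores :: "nat \<Rightarrow> (path \<Rightarrow> bool) \<Rightarrow> nat \<Rightarrow> nat \<Rightarrow> path \<Rightarrow> path \<Rightarrow> bool \<Rightarrow> bool" where
  "explores n leaf b k \<pi> \<pi>' v \<longleftrightarrow> \<pi>' = (next_path n leaf ^^ k) \<pi> \<and>
     (\<forall>i<k. \<exists>c<b. \<not> full n (leaf ((next_path n leaf ^^ i) \<pi>)) ((next_path n leaf ^^ i) \<pi>) c) \<and>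
     (\<forall>c\<ge>b. \<pi>' c = \<pi> c) \<and> leaf \<pi>' = v \<and> (\<forall>c<b. full n v \<pi>' c)"

text \<open>Between the two explorations lies a single advance. All coordinates below
  \<open>b\<close> are full and \<open>b\<close> is not, so it changes nothing above
  \<open>b\<close>; it accounts for the \<open>Suc\<close>.\<close>

lemma explores_trans:
  assumes 1: "explores n leaf b k \<pi> \<pi>' v" and nf: "\<not> full n v \<pi>' b"
    and 2: "explores n leaf (Suc b) l (next_path n leaf \<pi>') \<pi>'' w"
  shows "explores n leaf (Suc b) (k + Suc l) \<pi> \<pi>'' w"
proof -
  let ?f = "next_path n leaf"
  have \<pi>': "\<pi>' = (?f ^^ k) \<pi>" and v: "leaf \<pi>' = v" using 1 by (auto simp: explores_def)
  have it: "(?f ^^ (k + i)) \<pi> = (?f ^^ i) \<pi>'" for i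
    by (subst add.commute) (simp add: funpow_add \<pi>')
  have shift: "(?f ^^ Suc i) \<pi>' = (?f ^^ i) (?f \<pi>')" for i
    by (induction i) simp_all
  have "\<exists>c<Suc b. \<not> full n (leaf ((?f ^^ i) \<pi>)) ((?f ^^ i) \<pi>) c" if i: "i < k + Suc l" for i
  proof -
    consider "i < k" | "i = k" | j where "i = k + Suc j" "j < l"
      using i by (metis add_less_cancel_left less_antisym less_iff_Suc_add not_less_eq add_Suc_right nat_less_le)
    then show ?thesis
    proof cases
      case 1
      then show ?thesis using assms(1) unfolding explores_def by (meson less_SucI)
    next
      case 2
      then show ?thesis using nf v \<pi>' by blast
    next
      case 3
      then show ?thesis using assms(3) unfolding 3(1) it shift by (auto simp: explores_def)
    qed
  qed
  moreover have "\<pi>'' = (?f ^^ (k + Suc l)) \<pi>"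
    using 2 unfolding it shift by (simp add: explores_def)
  moreover have "\<pi>'' c = \<pi> c" if "c \<ge> Suc b" for c
  proof -
    have "\<pi>'' c = ?f \<pi>' c" using 2 that by (auto simp: explores_def)
    also have "\<dots> = \<pi>' c" using nf v that by (auto simp: advance_def)
    also have "\<dots> = \<pi> c" using 1 that by (auto simp: explores_def)
    finally show ?thesis .
  qed
  moreover have "leaf \<pi>'' = w \<and> (\<forall>c<Suc b. full n w \<pi>'' c)"
    using 2 unfolding explores_def by blast
  ultimately show ?thesis unfolding explores_def by blast
qed

text \<open>Coordinate \<open>b\<close> runs through at most \<open>n * n\<close> pairs, each with
  an exploration of the lower coordinates; every such exploration visits at most
  \<open>n ^ (2 * b)\<close> leaves.\<close>

lemma exploration:
  assumes "\<forall>c<b. \<pi> c = (0, 0)" "n > 0"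
  shows "\<exists>k<n ^ (2 * b). \<exists>\<pi>'. explores n leaf b k \<pi> \<pi>' (tree_value n leaf b \<pi>)"
  using assms(1)
proof (induction b arbitrary: \<pi>)
  case 0
  then show ?case by (auto simp: explores_def)
next
  case (Suc b)
  let ?N = "n ^ (2 * b)"
  let ?val = "\<lambda>p q. tree_value n leaf b (\<pi>(b := (p, q)))"
  have N: "?N > 0" using assms(2) by simp
  \<comment> \<open>Induction on the pairs that follow \<open>(p, q)\<close>. The value reported is
    that of the remaining alternatives: either row \<open>p\<close> is true from \<open>q\<close>
    on, or some later row is true throughout.\<close>
  have "\<exists>k<Suc ((n - 1 - p) * n + (n - 1 - q)) * ?N. \<exists>\<pi>'. explores n leaf (Suc b) k (\<pi>(b := (p, q))) \<pi>'
      ((\<forall>q'. q \<le> q' \<and> q' < n \<longrightarrow> ?val p q') \<or> (\<exists>p'. p < p' \<and> p' < n \<and> (\<forall>q'<n. ?val p' q')))"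
    if "p < n" "q < n" for p q
    using that
  proof (induction "(n - 1 - p) * n + (n - 1 - q)" arbitrary: p q rule: less_induct)
    case less
    let ?\<pi> = "\<pi>(b := (p, q))"
    let ?goal = "(\<forall>q'. q \<le> q' \<and> q' < n \<longrightarrow> ?val p q') \<or> (\<exists>p'. p < p' \<and> p' < n \<and> (\<forall>q'<n. ?val p' q'))"
    let ?m = "(n - 1 - p) * n + (n - 1 - q)"
    have zero_upd: "\<forall>c<b. ?\<pi> c = (0, 0)" using Suc.prems by simp
    obtain k \<pi>' where k: "k < ?N" and ex: "explores n leaf b k ?\<pi> \<pi>' (?val p q)"
      using Suc.IH[OF zero_upd] by blast
    have b: "\<pi>' b = (p, q)" and above: "\<And>c. c > b \<Longrightarrow> \<pi>' c = \<pi> c" and lf: "leaf \<pi>' = ?val p q"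
      and fl: "\<And>c. c < b \<Longrightarrow> full n (?val p q) \<pi>' c"
      using ex by (auto simp: explores_def)
    have zero: "\<pi> c = (0, 0)" if "c < b" for c using Suc.prems that by auto
    \<comment> \<open>If coordinate \<open>b\<close> is full as well, the larger subtree is
      finished: after a true last target of the row, or after a false target in the last
      row.\<close>
    have stop: "\<exists>k<Suc ?m * ?N. \<exists>\<pi>'. explores n leaf (Suc b) k ?\<pi> \<pi>' ?goal"
      if "full n (?val p q) \<pi>' b" "?goal = ?val p q"
    proof -
      have "explores n leaf (Suc b) k ?\<pi> \<pi>' ?goal"
        using ex that unfolding explores_def by (auto simp: less_Suc_eq)
      moreover have "k < Suc ?m * ?N" using k by (simp add: trans_less_add1)
      ultimately show ?thesis by blast
    qed
    \<comment> \<open>Otherwise the advance resets the lower coordinates and moves to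
      \<open>(p', q')\<close>, the next target after a true value and the start of the next row
      after a false one. Skipped pairs cannot affect the remaining value.\<close>
    have go: "\<exists>k<Suc ?m * ?N. \<exists>\<pi>'. explores n leaf (Suc b) k ?\<pi> \<pi>' ?goal"
      if nf: "\<not> full n (?val p q) \<pi>' b" and nx: "next_path n leaf \<pi>' = \<pi>(b := (p', q'))"
        and m: "(n - 1 - p') * n + (n - 1 - q') < ?m" "p' < n" "q' < n"
        and goal: "?goal \<longleftrightarrow> (\<forall>q''. q' \<le> q'' \<and> q'' < n \<longrightarrow> ?val p' q'') \<or> (\<exists>p''. p' < p'' \<and> p'' < n \<and> (\<forall>q''<n. ?val p'' q''))"
      for p' q'
    proof -
      let ?m' = "(n - 1 - p') * n + (n - 1 - q')"
      obtain l \<pi>'' where l: "l < Suc ?m' * ?N" "explores n leaf (Suc b) l (\<pi>(b := (p', q'))) \<pi>'' ?goal"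
        using less.hyps[OF m] unfolding goal by blast
      have "Suc ?m' * ?N \<le> ?m * ?N" using m(1) by (intro mult_le_mono1) simp
      then have "k + Suc l < Suc ?m * ?N" using k l(1) by simp
      with explores_trans[OF ex nf l(2)[folded nx]] show ?thesis by blast
    qed
    show ?case
    proof (cases "?val p q")
      case True
      show ?thesis
      proof (cases "Suc q = n")
        case True
        with \<open>?val p q\<close> have "?goal"
          by (metis le_antisym less_Suc_eq_le)
        with \<open>?val p q\<close> True show ?thesis by (intro stop) (simp_all add: full_def b)
      next
        case False
        have nf: "\<not> full n (?val p q) \<pi>' b" using \<open>?val p q\<close> False by (simp add: full_def b)
        show ?thesis
        proof (rule go[of p "Suc q", OF nf])
          show "next_path n leaf \<pi>' = \<pi>(b := (p, Suc q))"
          proof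
            fix c
            show "next_path n leaf \<pi>' c = (\<pi>(b := (p, Suc q))) c"
              using fl nf zero above \<open>?val p q\<close> b lf
              by (cases c b rule: linorder_cases) (auto simp: advance_def)
          qed
          show "(n - 1 - p) * n + (n - 1 - Suc q) < ?m" using False less.prems by simp
          show "?goal \<longleftrightarrow> (\<forall>q''. Suc q \<le> q'' \<and> q'' < n \<longrightarrow> ?val p q'') \<or> (\<exists>p''. p < p'' \<and> p'' < n \<and> (\<forall>q''<n. ?val p'' q''))"
            using \<open>?val p q\<close> by (metis Suc_leD Suc_le_eq le_neq_implies_less)
        qed (use False less.prems in auto)
      qed
    next
      case False
      have first: "\<not> (\<forall>q'. q \<le> q' \<and> q' < n \<longrightarrow> ?val p q')" using False less.prems by blast
      show ?thesis
      proof (cases "Suc p = n")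
        case True
        have "\<not> ?goal" using first True by (metis less_antisym not_less_eq)
        with False True show ?thesis by (intro stop) (simp_all add: full_def b)
      next
        case pn: False
        have nf: "\<not> full n (?val p q) \<pi>' b" using False pn by (simp add: full_def b)
        show ?thesis
        proof (rule go[of "Suc p" 0, OF nf])
          show "next_path n leaf \<pi>' = \<pi>(b := (Suc p, 0))"
          proof
            fix c
            show "next_path n leaf \<pi>' c = (\<pi>(b := (Suc p, 0))) c"
              using fl nf zero above False b lf
              by (cases c b rule: linorder_cases) (auto simp: advance_def)
          qed
          have "n - 1 - p = Suc (n - 1 - Suc p)" using pn less.prems by simp
          then show "(n - 1 - Suc p) * n + (n - 1 - 0) < ?m" using assms(2) by simp
          show "?goal \<longleftrightarrow> (\<forall>q''. 0 \<le> q'' \<and> q'' < n \<longrightarrow> ?val (Suc p) q'') \<or> (\<exists>p''. Suc p < p'' \<and> p'' < n \<and> (\<forall>q''<n. ?val p'' q''))"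
            using first pn less.prems by (metis Suc_lessD Suc_lessI le0 lessI)
        qed (use pn less.prems in auto)
      qed
    qed
  qed
  from this[of 0 0] obtain k \<pi>' where k: "k < Suc ((n - 1) * n + (n - 1)) * ?N"
    and ex: "explores n leaf (Suc b) k (\<pi>(b := (0, 0))) \<pi>'
      ((\<forall>q'. 0 \<le> q' \<and> q' < n \<longrightarrow> ?val 0 q') \<or> (\<exists>p'. 0 < p' \<and> p' < n \<and> (\<forall>q'<n. ?val p' q')))"
    using assms(2) by auto
  have "\<pi>(b := (0, 0)) = \<pi>" using Suc.prems by auto
  moreover have "((\<forall>q'. 0 \<le> q' \<and> q' < n \<longrightarrow> ?val 0 q') \<or> (\<exists>p'. 0 < p' \<and> p' < n \<and> (\<forall>q'<n. ?val p' q')))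
      \<longleftrightarrow> tree_value n leaf (Suc b) \<pi>"
    using assms(2) by (simp, metis gr0I)
  moreover have "Suc ((n - 1) * n + (n - 1)) = n * n" using assms(2) by (cases n) auto
  ultimately have "k < n ^ (2 * Suc b)" "explores n leaf (Suc b) k \<pi> \<pi>' (tree_value n leaf (Suc b) \<pi>)"
    using k ex by (simp_all only:) (simp add: power_add power2_eq_square ac_simps)
  then show ?case by blast
qed

section \<open>Formulas about words\<close>

definition ex :: "nat \<Rightarrow> (nat \<Rightarrow> form) \<Rightarrow> form" where
  "ex k F = Neg (CardLe (F k) (Base (\<lambda>_. False) 0))"

definition all :: "nat \<Rightarrow> (nat \<Rightarrow> form) \<Rightarrow> form" where
  "all k F = Neg (ex k (\<lambda>x. Neg (F x)))"

definition disj :: "form \<Rightarrow> form \<Rightarrow> form" where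
  "disj f g = Neg (Conj (Neg f) (Neg g))"

definition imp :: "form \<Rightarrow> form \<Rightarrow> form" where
  "imp f g = Neg (Conj f (Neg g))"

definition iff :: "form \<Rightarrow> form \<Rightarrow> form" where
  "iff f g = Conj (imp f g) (imp g f)"

definition leq :: "nat \<Rightarrow> nat \<Rightarrow> form" where
  "leq x y = Neg (Less y x)"

abbreviation symbol :: "nat \<Rightarrow> nat \<Rightarrow> form" where
  "symbol a x \<equiv> Base (\<lambda>b. b mod 6 = a) x"

text \<open>
  Variables 0 and 1 are the sets of marked query and target positions; all others are singletons.
\<close>

definition env :: "nat set \<Rightarrow> nat set \<Rightarrow> (nat \<Rightarrow> nat) \<Rightarrow> nat \<Rightarrow> nat set" where
  "env X Y e v = (if v = 0 then X else if v = 1 then Y else {e v})"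

definition holds :: "nat list \<Rightarrow> nat set \<Rightarrow> nat set \<Rightarrow> nat \<Rightarrow> (nat \<Rightarrow> nat) \<Rightarrow> form \<Rightarrow> bool" where
  "holds B X Y k e f \<longleftrightarrow> sat B k (env X Y e) f"

lemma env_upd: "2 \<le> k \<Longrightarrow> (env X Y e)(k := {p}) = env X Y (e(k := p))"
  by (rule ext) (auto simp: env_def)

lemma holds_simps [simp]:
  "2 \<le> x \<Longrightarrow> e x < length B \<Longrightarrow> holds B X Y k e (Base f x) \<longleftrightarrow> f (B ! e x)"
  "2 \<le> x \<Longrightarrow> e x < length B \<Longrightarrow> holds B X Y k e (In 0 x) \<longleftrightarrow> e x \<in> X"
  "2 \<le> x \<Longrightarrow> e x < length B \<Longrightarrow> holds B X Y k e (In (Suc 0) x) \<longleftrightarrow> e x \<in> Y"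
  "2 \<le> x \<Longrightarrow> 2 \<le> y \<Longrightarrow> e x < length B \<Longrightarrow> holds B X Y k e (In x y) \<longleftrightarrow> e x = e y"
  "2 \<le> x \<Longrightarrow> 2 \<le> y \<Longrightarrow> e y < length B \<Longrightarrow> holds B X Y k e (Less x y) \<longleftrightarrow> e x < e y"
  "holds B X Y k e (Neg \<phi>) \<longleftrightarrow> \<not> holds B X Y k e \<phi>"
  "holds B X Y k e (Conj \<phi> \<psi>) \<longleftrightarrow> holds B X Y k e \<phi> \<and> holds B X Y k e \<psi>"
  by (auto simp: holds_def env_def)

lemma holds_connectives [simp]:
  "holds B X Y k e (disj \<phi> \<psi>) \<longleftrightarrow> holds B X Y k e \<phi> \<or> holds B X Y k e \<psi>"
  "holds B X Y k e (imp \<phi> \<psi>) \<longleftrightarrow> (holds B X Y k e \<phi> \<longrightarrow> holds B X Y k e \<psi>)"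
  "holds B X Y k e (iff \<phi> \<psi>) \<longleftrightarrow> (holds B X Y k e \<phi> \<longleftrightarrow> holds B X Y k e \<psi>)"
  "2 \<le> x \<Longrightarrow> 2 \<le> y \<Longrightarrow> e x < length B \<Longrightarrow> holds B X Y k e (leq x y) \<longleftrightarrow> e x \<le> e y"
  by (auto simp: disj_def imp_def iff_def leq_def)

lemma wf_connectives [simp]:
  "wf_form k (disj \<phi> \<psi>) \<longleftrightarrow> wf_form k \<phi> \<and> wf_form k \<psi>"
  "wf_form k (imp \<phi> \<psi>) \<longleftrightarrow> wf_form k \<phi> \<and> wf_form k \<psi>"
  "wf_form k (iff \<phi> \<psi>) \<longleftrightarrow> wf_form k \<phi> \<and> wf_form k \<psi>"
  "wf_form k (leq x y) \<longleftrightarrow> x < k \<and> y < k"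
  by (auto simp: disj_def imp_def iff_def leq_def)

lemma holds_CardLe [simp]:
  "2 \<le> k \<Longrightarrow> holds B X Y k e (CardLe f g) \<longleftrightarrow>
     card {p. p < length B \<and> holds B X Y (Suc k) (e(k := p)) f} \<le> card {p. p < length B \<and> holds B X Y (Suc k) (e(k := p)) g}"
  by (simp add: holds_def env_upd)

lemma holds_ex [simp]:
  "2 \<le> k \<Longrightarrow> holds B X Y k e (ex k F) \<longleftrightarrow> (\<exists>p<length B. holds B X Y (Suc k) (e(k := p)) (F k))"
  by (auto simp: holds_def env_upd ex_def)

lemma holds_all [simp]:
  "2 \<le> k \<Longrightarrow> holds B X Y k e (all k F) \<longleftrightarrow> (\<forall>p<length B. holds B X Y (Suc k) (e(k := p)) (F k))"
  by (auto simp: all_def)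

lemma wf_quantifiers [simp]:
  "wf_form k (ex k F) \<longleftrightarrow> wf_form (Suc k) (F k)" "wf_form k (all k F) \<longleftrightarrow> wf_form (Suc k) (F k)"
  by (simp_all add: ex_def all_def)

text \<open>Residues modulo 6 forget the field, so dictionary words can be compared with listed
  words. The residue 0 is covered: it is the one for which all five tests fail.\<close>

definition sym_eq :: "nat \<Rightarrow> nat \<Rightarrow> form" where
  "sym_eq x y = Conj (iff (symbol 1 x) (symbol 1 y)) (Conj (iff (symbol 2 x) (symbol 2 y))
     (Conj (iff (symbol 3 x) (symbol 3 y)) (Conj (iff (symbol 4 x) (symbol 4 y)) (iff (symbol 5 x) (symbol 5 y)))))"

lemma less_six_eq_iff:
  "(a::nat) < 6 \<Longrightarrow> b < 6 \<Longrightarrow> (a = 1 \<longleftrightarrow> b = 1) \<and> (a = 2 \<longleftrightarrow> b = 2) \<and> (a = 3 \<longleftrightarrow> b = 3) \<and>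
    (a = 4 \<longleftrightarrow> b = 4) \<and> (a = 5 \<longleftrightarrow> b = 5) \<longleftrightarrow> a = b"
  by presburger

lemma holds_sym_eq [simp]:
  assumes "2 \<le> x" "2 \<le> y" "e x < length B" "e y < length B"
  shows "holds B X Y k e (sym_eq x y) \<longleftrightarrow> B ! e x mod 6 = B ! e y mod 6"
proof -
  let ?x = "B ! e x mod 6" and ?y = "B ! e y mod 6"
  have eq: "holds B X Y k e (sym_eq x y) \<longleftrightarrow> (?x = 1 \<longleftrightarrow> ?y = 1) \<and> (?x = 2 \<longleftrightarrow> ?y = 2) \<and>
      (?x = 3 \<longleftrightarrow> ?y = 3) \<and> (?x = 4 \<longleftrightarrow> ?y = 4) \<and> (?x = 5 \<longleftrightarrow> ?y = 5)"
    unfolding sym_eq_def using assms by (simp only: holds_simps holds_connectives)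
  show ?thesis unfolding eq by (rule less_six_eq_iff) simp_all
qed

lemma wf_sym_eq [simp]: "x < k \<Longrightarrow> y < k \<Longrightarrow> wf_form k (sym_eq x y)"
  by (simp add: sym_eq_def)

definition successor :: "nat \<Rightarrow> nat \<Rightarrow> nat \<Rightarrow> form" where
  "successor k x y = Conj (Less x y) (Neg (ex k (\<lambda>z. Conj (Less x z) (Less z y))))"

lemma holds_successor [simp]:
  assumes "2 \<le> x" "2 \<le> y" "x < k" "y < k" "e x < length B" "e y < length B"
  shows "holds B X Y k e (successor k x y) \<longleftrightarrow> e y = Suc (e x)"
proof -
  have "holds B X Y k e (successor k x y) \<longleftrightarrow> e x < e y \<and> \<not> (\<exists>z<length B. e x < z \<and> z < e y)"
    using assms by (simp add: successor_def cong: conj_cong)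
  also have "\<dots> \<longleftrightarrow> e y = Suc (e x)"
  proof
    assume "e x < e y \<and> \<not> (\<exists>z<length B. e x < z \<and> z < e y)"
    moreover from this have "\<not> Suc (e x) < e y" using assms(6) by (metis lessI less_trans)
    ultimately show "e y = Suc (e x)" by linarith
  qed auto
  finally show ?thesis .
qed

lemma wf_successor [simp]: "x < k \<Longrightarrow> y < k \<Longrightarrow> wf_form k (successor k x y)"
  by (simp add: successor_def)

definition in_range :: "(nat \<Rightarrow> bool) \<Rightarrow> nat \<Rightarrow> nat \<Rightarrow> nat \<Rightarrow> form" where
  "in_range f x y z = Conj (leq x z) (Conj (Less z y) (Base f z))"

text \<open>With the constantly true predicate this compares distances, with the predicate for
  letter terminators it compares indices of letters.\<close>

definition same_count :: "(nat \<Rightarrow> bool) \<Rightarrow> nat \<Rightarrow> nat \<Rightarrow> nat \<Rightarrow> nat \<Rightarrow> nat \<Rightarrow> form" where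
  "same_count f k x y x' y' = Conj (CardLe (in_range f x y k) (in_range f x' y' k))
     (CardLe (in_range f x' y' k) (in_range f x y k))"

lemma card_range:
  assumes "y \<le> length xs"
  shows "card {p. p < length xs \<and> x \<le> p \<and> p < y \<and> f (xs ! p)} = length (filter f (take (y - x) (drop x xs)))"
proof -
  have "{p. p < length xs \<and> x \<le> p \<and> p < y \<and> f (xs ! p)} =
      (+) x ` {i. i < length (take (y - x) (drop x xs)) \<and> f (take (y - x) (drop x xs) ! i)}"
  proof (intro set_eqI iffI)
    fix p assume "p \<in> {p. p < length xs \<and> x \<le> p \<and> p < y \<and> f (xs ! p)}"
    then show "p \<in> (+) x ` {i. i < length (take (y - x) (drop x xs)) \<and> f (take (y - x) (drop x xs) ! i)}"
      by (intro image_eqI[of _ _ "p - x"]) auto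
  qed (use assms in auto)
  then show ?thesis by (simp add: card_image length_filter_conv_card)
qed

lemma holds_same_count:
  assumes "2 \<le> x" "2 \<le> y" "2 \<le> x'" "2 \<le> y'" "x < k" "y < k" "x' < k" "y' < k"
    "e x < length B" "e y < length B" "e x' < length B" "e y' < length B"
  shows "holds B X Y k e (same_count f k x y x' y') \<longleftrightarrow>
    length (filter f (take (e y - e x) (drop (e x) B))) = length (filter f (take (e y' - e x') (drop (e x') B)))"
proof -
  have "{p. p < length B \<and> holds B X Y (Suc k) (e(k := p)) (in_range f x y k)} =
      {p. p < length B \<and> e x \<le> p \<and> p < e y \<and> f (B ! p)}"
    if "2 \<le> x" "2 \<le> y" "x < k" "y < k" "e x < length B" "e y < length B" for x y
    using that by (auto simp: in_range_def)
  then show ?thesis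
    using assms by (auto simp: same_count_def card_range)
qed

lemma wf_same_count [simp]:
  "x < k \<Longrightarrow> y < k \<Longrightarrow> x' < k \<Longrightarrow> y' < k \<Longrightarrow> wf_form k (same_count f k x y x' y')"
  by (simp add: same_count_def in_range_def)

section \<open>Letters and words on the tape\<close>

definition syms :: "nat list \<Rightarrow> nat list" where
  "syms B = map (\<lambda>b. b mod 6) B"

lemma length_syms [simp]: "length (syms B) = length B"
  by (simp add: syms_def)

lemma nth_syms [simp]: "i < length B \<Longrightarrow> syms B ! i = B ! i mod 6"
  by (simp add: syms_def)

definition letter_at :: "nat list \<Rightarrow> nat \<Rightarrow> nat list" where
  "letter_at B p = takeWhile (\<lambda>a. a \<noteq> 3) (drop p (syms B))"

text \<open>The position \<open>z\<close> may be the terminator of the first letter. It has to be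
  matched too, which forces equal lengths, so this one-sided condition suffices.\<close>

definition letter_eq :: "nat \<Rightarrow> nat \<Rightarrow> nat \<Rightarrow> form" where
  "letter_eq k x y = all k (\<lambda>z. imp
     (Conj (leq x z) (Neg (ex (Suc z) (\<lambda>t. Conj (leq x t) (Conj (Less t z) (symbol 3 t))))))
     (ex (Suc z) (\<lambda>t. Conj (leq y t) (Conj (same_count (\<lambda>_. True) (Suc t) x z y t) (sym_eq z t)))))"

lemma takeWhile_eq_iff:
  assumes "3 \<in> set xs" "3 \<in> set ys"
  shows "takeWhile (\<lambda>a. a \<noteq> 3) xs = takeWhile (\<lambda>a. a \<noteq> (3::nat)) ys \<longleftrightarrow>
    (\<forall>i<length xs. (\<forall>j<i. xs ! j \<noteq> 3) \<longrightarrow> i < length ys \<and> ys ! i = xs ! i)"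
  using assms
proof (induction xs arbitrary: ys)
  case (Cons a xs)
  obtain b zs where ys: "ys = b # zs" using Cons.prems by (cases ys) auto
  let ?R = "\<lambda>xs ys. \<forall>i<length xs. (\<forall>j<i. xs ! j \<noteq> 3) \<longrightarrow> i < length ys \<and> ys ! i = (xs ! i :: nat)"
  have split: "(\<forall>i<Suc n. Q i) \<longleftrightarrow> Q 0 \<and> (\<forall>i<n. Q (Suc i))" for Q n
    by (metis less_Suc_eq_0_disj)
  have R: "?R (a # xs) ys \<longleftrightarrow> b = a \<and> (a \<noteq> 3 \<longrightarrow> ?R xs zs)"
    unfolding ys by (auto simp: split)
  show ?case
  proof (cases "a = 3 \<or> b = 3")
    case True
    then show ?thesis unfolding R by (auto simp: ys)
  next
    case False
    then have "takeWhile (\<lambda>a. a \<noteq> 3) xs = takeWhile (\<lambda>a. a \<noteq> 3) zs \<longleftrightarrow> ?R xs zs"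
      using Cons.prems by (intro Cons.IH) (auto simp: ys)
    then show ?thesis using False unfolding R by (auto simp: ys)
  qed
qed simp

lemma holds_letter_eq:
  assumes "2 \<le> x" "2 \<le> y" "x < k" "y < k" "e x < length B" "e y < length B"
    and "3 \<in> set (drop (e x) (syms B))" "3 \<in> set (drop (e y) (syms B))"
  shows "holds B X Y k e (letter_eq k x y) \<longleftrightarrow> letter_at B (e x) = letter_at B (e y)"
proof -
  let ?N = "length B"
  have "holds B X Y k e (letter_eq k x y) \<longleftrightarrow>
    (\<forall>z<?N. e x \<le> z \<and> \<not> (\<exists>t<?N. e x \<le> t \<and> t < z \<and> B ! t mod 6 = 3) \<longrightarrow>
      (\<exists>t<?N. e y \<le> t \<and> z - e x = t - e y \<and> B ! z mod 6 = B ! t mod 6))"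
    using assms by (simp add: letter_eq_def holds_same_count cong: conj_cong)
  also have "\<dots> \<longleftrightarrow> (\<forall>i<?N - e x. (\<forall>j<i. drop (e x) (syms B) ! j \<noteq> 3) \<longrightarrow>
      i < ?N - e y \<and> drop (e y) (syms B) ! i = drop (e x) (syms B) ! i)" (is "?L \<longleftrightarrow> ?R")
  proof
    assume L: ?L
    show ?R
    proof (intro allI impI)
      fix i assume i: "i < ?N - e x" "\<forall>j<i. drop (e x) (syms B) ! j \<noteq> 3"
      have "\<not> (\<exists>t<?N. e x \<le> t \<and> t < e x + i \<and> B ! t mod 6 = 3)"
      proof
        assume "\<exists>t<?N. e x \<le> t \<and> t < e x + i \<and> B ! t mod 6 = 3"
        then obtain t where "t < ?N" "e x \<le> t" "t < e x + i" "B ! t mod 6 = 3" by blast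
        moreover from this have "t - e x < i" by linarith
        ultimately show False using i(2)[rule_format, of "t - e x"] by simp
      qed
      moreover have "e x + i < ?N" "e x \<le> e x + i" using i(1) by simp_all
      ultimately obtain t where "t < ?N" "e y \<le> t" "e x + i - e x = t - e y" "B ! (e x + i) mod 6 = B ! t mod 6"
        using L by blast
      then show "i < ?N - e y \<and> drop (e y) (syms B) ! i = drop (e x) (syms B) ! i"
        using i(1) by simp
    qed
  next
    assume R: ?R
    show ?L
    proof (intro allI impI, elim conjE)
      fix z assume z: "z < ?N" "e x \<le> z" "\<not> (\<exists>t<?N. e x \<le> t \<and> t < z \<and> B ! t mod 6 = 3)"
      have "\<forall>j<z - e x. drop (e x) (syms B) ! j \<noteq> 3"
        using z by (auto simp: less_diff_conv)
      moreover have "z - e x < ?N - e x" using z by simp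
      ultimately have "z - e x < ?N - e y \<and> drop (e y) (syms B) ! (z - e x) = drop (e x) (syms B) ! (z - e x)"
        using R by blast
      then show "\<exists>t<?N. e y \<le> t \<and> z - e x = t - e y \<and> B ! z mod 6 = B ! t mod 6"
        using z by (intro exI[of _ "e y + (z - e x)"]) auto
    qed
  qed
  also have "\<dots> \<longleftrightarrow> letter_at B (e x) = letter_at B (e y)"
    unfolding letter_at_def using takeWhile_eq_iff[OF assms(7,8)] by simp
  finally show ?thesis .
qed

lemma wf_letter_eq [simp]: "x < k \<Longrightarrow> y < k \<Longrightarrow> wf_form k (letter_eq k x y)"
  by (simp add: letter_eq_def)

lemma set_binary: "set (binary a) \<subseteq> {1, 2}"
proof (induction a rule: less_induct)
  case (less a)
  show ?case
  proof (cases "a = 0")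
    case False
    then show ?thesis using less[of "a div 2"] by (subst binary.simps) auto
  qed (simp add: binary.simps)
qed

lemma digits_value_binary: "digits_value (binary a) = a"
proof (induction a rule: less_induct)
  case (less a)
  show ?case
  proof (cases "a = 0")
    case False
    then show ?thesis using less[of "a div 2"] by (subst binary.simps) auto
  qed (simp add: binary.simps)
qed

lemma binary_inj: "binary a = binary b \<longleftrightarrow> a = b"
  using digits_value_binary by metis

lemma enc_letters_simps [simp]:
  "enc_letters [] = []" "enc_letters (a # u) = binary a @ 3 # enc_letters u"
  "enc_letters (u @ v) = enc_letters u @ enc_letters v"
  by (simp_all add: enc_letters_def)

lemma set_enc_letters: "set (enc_letters u) \<subseteq> {1, 2, 3}"
  using set_binary by (induction u) auto

definition word_at :: "nat list \<Rightarrow> nat \<Rightarrow> nat list \<Rightarrow> bool" where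
  "word_at B s u \<longleftrightarrow> (\<exists>r. drop s (syms B) = enc_letters u @ 4 # r)"

definition letter_pos :: "nat list \<Rightarrow> nat \<Rightarrow> nat" where
  "letter_pos u i = length (enc_letters (take i u))"

lemma letter_pos_simps [simp]:
  "letter_pos u 0 = 0" "letter_pos (a # u) (Suc i) = Suc (length (binary a) + letter_pos u i)"
  by (simp_all add: letter_pos_def)

text \<open>Strict because of the terminators; the digits alone would not do, as the letter 0 has
  none.\<close>

lemma letter_pos_mono: "i < j \<Longrightarrow> j \<le> length u \<Longrightarrow> letter_pos u i < letter_pos u j"
proof (induction u arbitrary: i j)
  case (Cons a u)
  then show ?case by (cases i; cases j) auto
qed simp

lemma letter_pos_eq_iff: "i < length u \<Longrightarrow> j < length u \<Longrightarrow> letter_pos u i = letter_pos u j \<longleftrightarrow> i = j"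
  using letter_pos_mono[of i j u] letter_pos_mono[of j i u] by (cases i j rule: linorder_cases) auto

lemma letter_pos_le_iff: "i < length u \<Longrightarrow> j < length u \<Longrightarrow> letter_pos u i \<le> letter_pos u j \<longleftrightarrow> i \<le> j"
  using letter_pos_mono[of i j u] letter_pos_mono[of j i u] by (cases i j rule: linorder_cases) auto

text \<open>Stated for an arbitrary terminator since it is used on two levels: for the letters of a
  word and for the words of a list.\<close>

lemma terminated_starts:
  assumes "\<And>c. t \<notin> set (h c)" "i < length (concat (map (\<lambda>c. h c @ [t]) cs))"
  shows "(i = 0 \<or> concat (map (\<lambda>c. h c @ [t]) cs) ! (i - 1) = t) \<longleftrightarrow>
    (\<exists>j<length cs. i = length (concat (map (\<lambda>c. h c @ [t]) (take j cs))))"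
  using assms(2)
proof (induction cs arbitrary: i)
  case (Cons a u)
  let ?l = "Suc (length (h a))" and ?enc = "\<lambda>cs. concat (map (\<lambda>c. h c @ [t]) cs)"
  show ?case
  proof (cases "i < ?l")
    case True
    have "?enc (a # u) ! (i - 1) \<noteq> t" if "i \<noteq> 0"
    proof -
      have "i - 1 < length (h a)" using True that by simp
      then have "?enc (a # u) ! (i - 1) \<in> set (h a)" by (simp add: nth_append)
      then show ?thesis using assms(1)[of a] by auto
    qed
    moreover have z: "i = 0 \<longleftrightarrow> (\<exists>j<length (a # u). i = length (?enc (take j (a # u))))"
      using True by (auto intro: exI[of _ 0]) (case_tac j; simp)
    ultimately show ?thesis unfolding z[symmetric] by (cases "i = 0") simp_all
  next
    case False
    then obtain i' where i: "i = ?l + i'" by (metis le_Suc_ex not_less)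
    have i': "i' < length (?enc u)" using Cons.prems i by simp
    have "(i = 0 \<or> ?enc (a # u) ! (i - 1) = t) \<longleftrightarrow> (i' = 0 \<or> ?enc u ! (i' - 1) = t)"
      by (cases i') (simp_all add: i nth_append)
    also have "\<dots> \<longleftrightarrow> (\<exists>j<length u. i' = length (?enc (take j u)))" by (rule Cons.IH[OF i'])
    also have "\<dots> \<longleftrightarrow> (\<exists>j<length (a # u). i = length (?enc (take j (a # u))))"
      using i' by (cases u) (auto simp: i Ex_less_Suc2)
    finally show ?thesis .
  qed
qed simp

lemma letter_starts:
  assumes "i < length (enc_letters u)"
  shows "(i = 0 \<or> enc_letters u ! (i - 1) = 3) \<longleftrightarrow> (\<exists>j<length u. i = letter_pos u j)"
proof -
  have "3 \<notin> set (binary a)" for a using set_binary[of a] by auto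
  then show ?thesis
    using terminated_starts[of 3 binary i u] assms unfolding letter_pos_def enc_letters_def by blast
qed

text \<open>The terminators 3 and 4 occur in no digit block, so a word can be parsed in only one
  way. This makes \<open>the_word\<close> well defined.\<close>

lemma enc_letters_prefix_code: "enc_letters u @ 4 # r = enc_letters v @ 4 # r' \<Longrightarrow> u = v"
proof (induction u arbitrary: v)
  case Nil
  then show ?case
  proof (cases v)
    case (Cons b v)
    then have "4 \<in> set (enc_letters (b # v))" using Nil by (cases "binary b") auto
    then show ?thesis using set_enc_letters[of "b # v"] by auto
  qed simp
next
  case (Cons a u)
  have split: "binary a = binary b \<and> r1 = r2" if "binary a @ 3 # r1 = binary b @ 3 # r2" for b r1 r2
  proof -
    have tw: "takeWhile (\<lambda>x. x \<noteq> 3) (binary c @ 3 # r) = binary c" for c r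
      using set_binary[of c] by (auto simp: takeWhile_append)
    have "binary a = binary b" using that tw by metis
    then show ?thesis using that by simp
  qed
  show ?case
  proof (cases v)
    case Nil
    then have "4 \<in> set (enc_letters (a # u))" using Cons.prems by (cases "binary a") auto
    then show ?thesis using set_enc_letters[of "a # u"] by auto
  next
    case v: (Cons b v')
    then show ?thesis using split[of "enc_letters u @ 4 # r" b "enc_letters v' @ 4 # r'"] Cons
      by (simp add: binary_inj)
  qed
qed

definition the_word :: "nat list \<Rightarrow> nat \<Rightarrow> nat list" where
  "the_word B s = (SOME u. word_at B s u)"

lemma the_word_eq: "word_at B s u \<Longrightarrow> the_word B s = u"
  unfolding the_word_def
  by (rule some_equality) (auto simp: word_at_def dest: enc_letters_prefix_code)

lemma word_at_bound: "word_at B s u \<Longrightarrow> s + length (enc_letters u) < length B"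
proof -
  assume "word_at B s u"
  then obtain r where "drop s (syms B) = enc_letters u @ 4 # r" by (auto simp: word_at_def)
  from arg_cong[OF this, of length] show ?thesis by simp
qed

lemma word_at_nth:
  assumes "word_at B s u" "i < length (enc_letters u)"
  shows "syms B ! (s + i) = enc_letters u ! i"
proof -
  obtain r where r: "drop s (syms B) = enc_letters u @ 4 # r" using assms by (auto simp: word_at_def)
  have "syms B ! (s + i) = drop s (syms B) ! i" using word_at_bound[OF assms(1)] by simp
  then show ?thesis using assms(2) by (simp add: r nth_append)
qed

lemma word_at_end:
  assumes "word_at B s u"
  shows "syms B ! (s + length (enc_letters u)) = 4"
proof -
  obtain r where r: "drop s (syms B) = enc_letters u @ 4 # r" using assms by (auto simp: word_at_def)
  have "syms B ! (s + length (enc_letters u)) = drop s (syms B) ! length (enc_letters u)"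
    using word_at_bound[OF assms(1)] by simp
  then show ?thesis by (simp add: r)
qed

lemma word_at_letter:
  assumes "word_at B s u" "i < length u"
  shows "s + letter_pos u i < length B" "3 \<in> set (drop (s + letter_pos u i) (syms B))"
    "letter_at B (s + letter_pos u i) = binary (u ! i)"
    "take (letter_pos u i) (drop s (syms B)) = enc_letters (take i u)"
proof -
  obtain r where r: "drop s (syms B) = enc_letters u @ 4 # r" using assms by (auto simp: word_at_def)
  have u: "u = take i u @ u ! i # drop (Suc i) u" using assms(2) by (simp add: id_take_nth_drop)
  have enc: "enc_letters u = enc_letters (take i u) @ binary (u ! i) @ 3 # enc_letters (drop (Suc i) u)"
    by (subst u) (simp del: append_take_drop_id)
  show "take (letter_pos u i) (drop s (syms B)) = enc_letters (take i u)"
    unfolding r enc by (simp add: letter_pos_def)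
  have "drop (s + letter_pos u i) (syms B) = drop (letter_pos u i) (drop s (syms B))"
    by (simp add: add.commute)
  also have "\<dots> = binary (u ! i) @ 3 # enc_letters (drop (Suc i) u) @ 4 # r"
    unfolding r enc by (simp add: letter_pos_def)
  finally have d: "drop (s + letter_pos u i) (syms B) = binary (u ! i) @ 3 # enc_letters (drop (Suc i) u) @ 4 # r" .
  then show "3 \<in> set (drop (s + letter_pos u i) (syms B))" by simp
  show "s + letter_pos u i < length B"
    using d by (metis append_is_Nil_conv drop_all length_syms list.distinct(1) not_less)
  show "letter_at B (s + letter_pos u i) = binary (u ! i)"
    unfolding letter_at_def d using set_binary[of "u ! i"] by (auto simp: takeWhile_append)
qed

text \<open>Characterizes the positions \<open>z\<close> at which a letter of the word at
  \<open>s\<close> begins. Testing \<open>z\<close> itself for 4 excludes the cell after the last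
  letter.\<close>

definition in_word :: "nat \<Rightarrow> nat \<Rightarrow> nat \<Rightarrow> form" where
  "in_word k s z = Conj (leq s z) (Conj (Neg (symbol 4 z))
     (Conj (Neg (ex k (\<lambda>t. Conj (leq s t) (Conj (Less t z) (symbol 4 t)))))
       (disj (In s z) (ex k (\<lambda>t. Conj (successor (Suc t) t z) (symbol 3 t))))))"

lemma holds_in_word:
  assumes "2 \<le> s" "s < k" "2 \<le> z" "z < k" "e s < length B" "e z < length B" and u: "word_at B (e s) u"
  shows "holds B X Y k e (in_word k s z) \<longleftrightarrow> (\<exists>i<length u. e z = e s + letter_pos u i)"
proof -
  let ?N = "length B" and ?L = "length (enc_letters u)"
  have bd: "e s + ?L < ?N" using word_at_bound[OF u] .
  have end4: "B ! (e s + ?L) mod 6 = 4" using word_at_end[OF u] bd by simp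
  have in4: "B ! (e s + i) mod 6 \<noteq> 4" if "i < ?L" for i
  proof -
    have "enc_letters u ! i \<in> set (enc_letters u)" using that by simp
    then have "enc_letters u ! i \<noteq> 4" using set_enc_letters[of u] by auto
    then show ?thesis using word_at_nth[OF u that] bd that by simp
  qed
  have "holds B X Y k e (in_word k s z) \<longleftrightarrow>
    e s \<le> e z \<and> B ! e z mod 6 \<noteq> 4 \<and> \<not> (\<exists>t<?N. e s \<le> t \<and> t < e z \<and> B ! t mod 6 = 4) \<and>
      (e s = e z \<or> (\<exists>t<?N. e z = Suc t \<and> B ! t mod 6 = 3))"
    using assms(1-6) by (simp add: in_word_def cong: conj_cong)
  also have "\<dots> \<longleftrightarrow> (\<exists>i<?L. e z = e s + i \<and> (i = 0 \<or> enc_letters u ! (i - 1) = 3))" (is "?l \<longleftrightarrow> ?r")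
  proof
    assume l: ?l
    define i where "i = e z - e s"
    have i: "e z = e s + i" using l by (simp add: i_def)
    have "i < ?L"
    proof (rule ccontr)
      assume "\<not> i < ?L"
      then have "e s + ?L = e z \<or> e s + ?L < e z" using i by auto
      then show False using l end4 bd by (metis le_add1)
    qed
    moreover have "i = 0 \<or> enc_letters u ! (i - 1) = 3"
    proof (cases i)
      case (Suc j)
      then have "B ! (e s + j) mod 6 = 3" using l i by auto
      then show ?thesis using word_at_nth[OF u, of j] \<open>i < ?L\<close> bd Suc by simp
    qed simp
    ultimately show ?r using i by blast
  next
    assume ?r
    then obtain i where i: "i < ?L" "e z = e s + i" "i = 0 \<or> enc_letters u ! (i - 1) = 3" by blast
    have "\<not> (\<exists>t<?N. e s \<le> t \<and> t < e z \<and> B ! t mod 6 = 4)"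
    proof
      assume "\<exists>t<?N. e s \<le> t \<and> t < e z \<and> B ! t mod 6 = 4"
      then obtain t where "e s \<le> t" "t < e z" "B ! t mod 6 = 4" by blast
      moreover from this have "t - e s < ?L" using i by linarith
      ultimately show False using in4[of "t - e s"] by simp
    qed
    moreover have "e s = e z \<or> (\<exists>t<?N. e z = Suc t \<and> B ! t mod 6 = 3)"
    proof (cases i)
      case (Suc j)
      then have "enc_letters u ! j = 3" using i(3) by simp
      then have "B ! (e s + j) mod 6 = 3" using word_at_nth[OF u, of j] i(1) bd Suc by simp
      then show ?thesis using i Suc bd by (intro disjI2 exI[of _ "e s + j"]) simp
    qed (use i in simp)
    ultimately show ?l using i in4[OF i(1)] by simp
  qed
  also have "\<dots> \<longleftrightarrow> (\<exists>i<length u. e z = e s + letter_pos u i)"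
  proof -
    have "letter_pos u j < ?L" if "j < length u" for j
      using letter_pos_mono[of j "length u" u] that by (simp add: letter_pos_def)
    moreover have "(i = 0 \<or> enc_letters u ! (i - 1) = 3) \<longleftrightarrow> (\<exists>j<length u. i = letter_pos u j)" if "i < ?L" for i
      using letter_starts[OF that] .
    ultimately show ?thesis by (simp cong: conj_cong) blast
  qed
  finally show ?thesis .
qed

lemma wf_in_word [simp]: "s < k \<Longrightarrow> z < k \<Longrightarrow> wf_form k (in_word k s z)"
  by (simp add: in_word_def)

section \<open>The oracle as a formula\<close>

text \<open>Equal indices do not mean equal offsets, as letters differ in length; the index of a
  letter is the number of terminators between the start of its word and the letter.\<close>

definition green :: "nat \<Rightarrow> nat \<Rightarrow> nat \<Rightarrow> nat \<Rightarrow> form" where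
  "green k s z s' = ex k (\<lambda>t. Conj (in_word (Suc t) s' t)
     (Conj (same_count (\<lambda>b. b mod 6 = 3) (Suc t) s z s' t) (letter_eq (Suc t) z t)))"

lemma count_terminators:
  assumes "word_at B s u" "i < length u"
  shows "length (filter (\<lambda>b. b mod 6 = 3) (take (letter_pos u i) (drop s B))) = i"
proof -
  have "length (filter (\<lambda>b. b mod 6 = 3) (take (letter_pos u i) (drop s B))) =
      length (filter (\<lambda>a. a = 3) (take (letter_pos u i) (drop s (syms B))))"
    by (simp add: syms_def drop_map take_map filter_map o_def)
  also have "\<dots> = length (filter (\<lambda>a. a = 3) (enc_letters (take i u)))"
    by (simp only: word_at_letter(4)[OF assms])
  also have "\<dots> = length (take i u)"
  proof -
    have "filter (\<lambda>a. a = 3) (binary a) = []" for a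
      using set_binary[of a] by (auto simp: filter_empty_conv)
    then have "length (filter (\<lambda>a. a = 3) (enc_letters v)) = length v" for v
      by (induction v) auto
    then show ?thesis .
  qed
  finally show ?thesis using assms(2) by simp
qed

lemma holds_letter_eq_letters:
  assumes "2 \<le> x" "2 \<le> y" "x < k" "y < k" "word_at B s u" "word_at B s' w" "i < length u" "j < length w"
    "e x = s + letter_pos u i" "e y = s' + letter_pos w j"
  shows "holds B X Y k e (letter_eq k x y) \<longleftrightarrow> u ! i = w ! j"
  using holds_letter_eq[of x y k e B X Y] assms word_at_letter[OF assms(5,7)] word_at_letter[OF assms(6,8)]
  by (simp add: binary_inj)

lemma holds_green:
  assumes "2 \<le> s" "s < k" "2 \<le> z" "z < k" "2 \<le> s'" "s' < k"
    and u: "word_at B (e s) u" and w: "word_at B (e s') w" and i: "i < length u" "e z = e s + letter_pos u i"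
  shows "holds B X Y k e (green k s z s') \<longleftrightarrow> i < length w \<and> u ! i = w ! i"
proof -
  have es: "e s < length B" "e s' < length B"
    using word_at_bound[OF u] word_at_bound[OF w] by simp_all
  have ez: "e z < length B" using word_at_letter(1)[OF u i(1)] i by simp
  have inner: "holds B X Y (Suc k) (e(k := t)) (Conj (in_word (Suc k) s' k)
      (Conj (same_count (\<lambda>b. b mod 6 = 3) (Suc k) s z s' k) (letter_eq (Suc k) z k))) \<longleftrightarrow>
    (\<exists>j<length w. t = e s' + letter_pos w j \<and> i = j \<and> u ! i = w ! j)" if t: "t < length B" for t
  proof -
    have "holds B X Y (Suc k) (e(k := t)) (in_word (Suc k) s' k) \<longleftrightarrow> (\<exists>j<length w. t = e s' + letter_pos w j)"
      using holds_in_word[of s' "Suc k" k "e(k := t)" B w X Y] assms es t by simp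
    moreover have "holds B X Y (Suc k) (e(k := t)) (same_count (\<lambda>b. b mod 6 = 3) (Suc k) s z s' k) \<longleftrightarrow> i = j"
      "holds B X Y (Suc k) (e(k := t)) (letter_eq (Suc k) z k) \<longleftrightarrow> u ! i = w ! j"
      if "j < length w" "t = e s' + letter_pos w j" for j
    proof -
      show "holds B X Y (Suc k) (e(k := t)) (same_count (\<lambda>b. b mod 6 = 3) (Suc k) s z s' k) \<longleftrightarrow> i = j"
        using assms es ez t that count_terminators[OF u i(1)] count_terminators[OF w that(1)]
        by (subst holds_same_count) auto
      show "holds B X Y (Suc k) (e(k := t)) (letter_eq (Suc k) z k) \<longleftrightarrow> u ! i = w ! j"
        using assms that by (intro holds_letter_eq_letters[OF _ _ _ _ u w i(1) that(1)]) auto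
    qed
    ultimately show ?thesis unfolding holds_simps by blast
  qed
  have "holds B X Y k e (green k s z s') \<longleftrightarrow> (\<exists>t<length B. \<exists>j<length w. t = e s' + letter_pos w j \<and> i = j \<and> u ! i = w ! j)"
    unfolding green_def using assms(1,2) inner by (simp only: holds_ex cong: conj_cong)
  also have "\<dots> \<longleftrightarrow> i < length w \<and> u ! i = w ! i"
    using word_at_letter(1)[OF w] by blast
  finally show ?thesis .
qed

lemma wf_green [simp]: "s < k \<Longrightarrow> z < k \<Longrightarrow> s' < k \<Longrightarrow> wf_form k (green k s z s')"
  by (simp add: green_def)

text \<open>
  The second set counts the letters of the target that are not green. As \<open>green\<close> is symmetric in the
  two words, it is used with the words exchanged.
\<close>

definition yellow :: "nat \<Rightarrow> nat \<Rightarrow> nat \<Rightarrow> nat \<Rightarrow> form" where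
  "yellow k s z s' = CardLe
     (Conj (in_word (Suc k) s k) (Conj (leq k z) (Conj (letter_eq (Suc k) k z) (Neg (green (Suc k) s k s')))))
     (Conj (in_word (Suc k) s' k) (Conj (letter_eq (Suc k) k z) (Neg (green (Suc k) s' k s))))"

text \<open>Distinct indices have distinct positions, so a cardinality of positions, the only kind
  that formulas can express, is a cardinality of indices.\<close>

lemma card_letters:
  assumes "word_at B s u"
  shows "card {p. p < length B \<and> (\<exists>j<length u. p = s + letter_pos u j \<and> Q j)} = card {j. j < length u \<and> Q j}"
proof -
  have "{p. p < length B \<and> (\<exists>j<length u. p = s + letter_pos u j \<and> Q j)} = (\<lambda>j. s + letter_pos u j) ` {j. j < length u \<and> Q j}"
    using word_at_letter(1)[OF assms] by auto
  moreover have "inj_on (\<lambda>j. s + letter_pos u j) {j. j < length u \<and> Q j}"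
    by (auto simp: inj_on_def letter_pos_eq_iff)
  ultimately show ?thesis by (simp add: card_image)
qed

lemma holds_yellow:
  assumes "2 \<le> s" "s < k" "2 \<le> z" "z < k" "2 \<le> s'" "s' < k"
    and u: "word_at B (e s) u" and w: "word_at B (e s') w" and i: "i < length u" "e z = e s + letter_pos u i"
    and len: "length w = length u"
  shows "holds B X Y k e (yellow k s z s') \<longleftrightarrow>
    card {j. j \<le> i \<and> u ! i = u ! j \<and> u ! j \<noteq> w ! j} \<le> card {j. j < length w \<and> w ! j = u ! i \<and> w ! j \<noteq> u ! j}"
proof -
  have es: "e s < length B" "e s' < length B"
    using word_at_bound[OF u] word_at_bound[OF w] by simp_all
  have ez: "e z < length B" using word_at_letter(1)[OF u i(1)] i by simp
  have 1: "holds B X Y (Suc k) (e(k := p))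
      (Conj (in_word (Suc k) s k) (Conj (leq k z) (Conj (letter_eq (Suc k) k z) (Neg (green (Suc k) s k s'))))) \<longleftrightarrow>
    (\<exists>j<length u. p = e s + letter_pos u j \<and> j \<le> i \<and> u ! j = u ! i \<and> u ! j \<noteq> w ! j)" if p: "p < length B" for p
  proof -
    have "holds B X Y (Suc k) (e(k := p)) (in_word (Suc k) s k) \<longleftrightarrow> (\<exists>j<length u. p = e s + letter_pos u j)"
      using holds_in_word[of s "Suc k" k "e(k := p)" B u X Y] assms es p by simp
    moreover have "holds B X Y (Suc k) (e(k := p)) (leq k z) \<longleftrightarrow> j \<le> i"
      "holds B X Y (Suc k) (e(k := p)) (letter_eq (Suc k) k z) \<longleftrightarrow> u ! j = u ! i"
      "holds B X Y (Suc k) (e(k := p)) (green (Suc k) s k s') \<longleftrightarrow> u ! j = w ! j"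
      if j: "j < length u" "p = e s + letter_pos u j" for j
    proof -
      show "holds B X Y (Suc k) (e(k := p)) (leq k z) \<longleftrightarrow> j \<le> i"
        using assms p j by (simp add: letter_pos_le_iff)
      show "holds B X Y (Suc k) (e(k := p)) (letter_eq (Suc k) k z) \<longleftrightarrow> u ! j = u ! i"
        using assms j by (intro holds_letter_eq_letters[OF _ _ _ _ u u j(1) i(1)]) auto
      show "holds B X Y (Suc k) (e(k := p)) (green (Suc k) s k s') \<longleftrightarrow> u ! j = w ! j"
        using holds_green[of s "Suc k" k s' B "e(k := p)" u w j X Y] assms j by simp
    qed
    ultimately show ?thesis unfolding holds_simps by blast
  qed
  have 2: "holds B X Y (Suc k) (e(k := p))
      (Conj (in_word (Suc k) s' k) (Conj (letter_eq (Suc k) k z) (Neg (green (Suc k) s' k s)))) \<longleftrightarrow>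
    (\<exists>j<length w. p = e s' + letter_pos w j \<and> w ! j = u ! i \<and> w ! j \<noteq> u ! j)" if p: "p < length B" for p
  proof -
    have "holds B X Y (Suc k) (e(k := p)) (in_word (Suc k) s' k) \<longleftrightarrow> (\<exists>j<length w. p = e s' + letter_pos w j)"
      using holds_in_word[of s' "Suc k" k "e(k := p)" B w X Y] assms es p by simp
    moreover have "holds B X Y (Suc k) (e(k := p)) (letter_eq (Suc k) k z) \<longleftrightarrow> w ! j = u ! i"
      "holds B X Y (Suc k) (e(k := p)) (green (Suc k) s' k s) \<longleftrightarrow> w ! j = u ! j"
      if j: "j < length w" "p = e s' + letter_pos w j" for j
    proof -
      show "holds B X Y (Suc k) (e(k := p)) (letter_eq (Suc k) k z) \<longleftrightarrow> w ! j = u ! i"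
        using assms j by (intro holds_letter_eq_letters[OF _ _ _ _ w u j(1) i(1)]) auto
      show "holds B X Y (Suc k) (e(k := p)) (green (Suc k) s' k s) \<longleftrightarrow> w ! j = u ! j"
        using holds_green[of s' "Suc k" k s B "e(k := p)" w u j X Y] assms j by simp
    qed
    ultimately show ?thesis unfolding holds_simps by blast
  qed
  have "holds B X Y k e (yellow k s z s') \<longleftrightarrow>
    card {p. p < length B \<and> (\<exists>j<length u. p = e s + letter_pos u j \<and> j \<le> i \<and> u ! j = u ! i \<and> u ! j \<noteq> w ! j)} \<le>
    card {p. p < length B \<and> (\<exists>j<length w. p = e s' + letter_pos w j \<and> w ! j = u ! i \<and> w ! j \<noteq> u ! j)}"
  proof -
    have k: "2 \<le> k" using assms(1,2) by simp
    show ?thesis unfolding yellow_def holds_CardLe[OF k] by (simp only: 1 2 cong: conj_cong)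
  qed
  also have "\<dots> \<longleftrightarrow> card {j. j < length u \<and> j \<le> i \<and> u ! j = u ! i \<and> u ! j \<noteq> w ! j} \<le>
      card {j. j < length w \<and> w ! j = u ! i \<and> w ! j \<noteq> u ! j}"
    by (simp only: card_letters[OF u] card_letters[OF w])
  also have "{j. j < length u \<and> j \<le> i \<and> u ! j = u ! i \<and> u ! j \<noteq> w ! j} = {j. j \<le> i \<and> u ! i = u ! j \<and> u ! j \<noteq> w ! j}"
    using i(1) by auto
  finally show ?thesis .
qed

lemma wf_yellow [simp]: "s < k \<Longrightarrow> z < k \<Longrightarrow> s' < k \<Longrightarrow> wf_form k (yellow k s z s')"
  by (simp add: yellow_def)

text \<open>The response itself is never written down. Two responses agree iff at each letter of the
  query both targets are green or neither is, and in the latter case the counting conditions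
  agree.\<close>

definition same_response :: "nat \<Rightarrow> nat \<Rightarrow> nat \<Rightarrow> nat \<Rightarrow> form" where
  "same_response k s x y = all k (\<lambda>z. imp (in_word (Suc z) s z)
     (Conj (iff (green (Suc z) s z x) (green (Suc z) s z y))
       (imp (Neg (green (Suc z) s z x)) (iff (yellow (Suc z) s z x) (yellow (Suc z) s z y)))))"

lemma holds_same_response:
  assumes "2 \<le> s" "s < k" "2 \<le> x" "x < k" "2 \<le> y" "y < k"
    and u: "word_at B (e s) u" and w: "word_at B (e x) w" and t: "word_at B (e y) t"
    and len: "length w = length u" "length t = length u"
  shows "holds B X Y k e (same_response k s x y) \<longleftrightarrow> wordle_oracle w u = wordle_oracle t u"
proof -
  have es: "e s < length B" using word_at_bound[OF u] by simp
  define Y' where "Y' v i \<longleftrightarrow> card {j. j \<le> i \<and> u ! i = u ! j \<and> u ! j \<noteq> v ! j} \<le> card {j. j < length v \<and> v ! j = u ! i \<and> v ! j \<noteq> u ! j}" for v i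
  have inner: "holds B X Y (Suc k) (e(k := z)) (imp (in_word (Suc k) s k)
     (Conj (iff (green (Suc k) s k x) (green (Suc k) s k y))
       (imp (Neg (green (Suc k) s k x)) (iff (yellow (Suc k) s k x) (yellow (Suc k) s k y))))) \<longleftrightarrow>
     (\<forall>i<length u. z = e s + letter_pos u i \<longrightarrow> ((u ! i = w ! i) = (u ! i = t ! i)) \<and>
       (u ! i \<noteq> w ! i \<longrightarrow> Y' w i = Y' t i))" if z: "z < length B" for z
  proof -
    have "holds B X Y (Suc k) (e(k := z)) (in_word (Suc k) s k) \<longleftrightarrow> (\<exists>j<length u. z = e s + letter_pos u j)"
      using holds_in_word[of s "Suc k" k "e(k := z)" B u X Y] assms es z by simp
    moreover have "holds B X Y (Suc k) (e(k := z)) (green (Suc k) s k x) \<longleftrightarrow> u ! i = w ! i"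
      "holds B X Y (Suc k) (e(k := z)) (green (Suc k) s k y) \<longleftrightarrow> u ! i = t ! i"
      "holds B X Y (Suc k) (e(k := z)) (yellow (Suc k) s k x) \<longleftrightarrow> Y' w i"
      "holds B X Y (Suc k) (e(k := z)) (yellow (Suc k) s k y) \<longleftrightarrow> Y' t i"
      if i: "i < length u" "z = e s + letter_pos u i" for i
      using holds_green[of s "Suc k" k x B "e(k := z)" u w i X Y] holds_green[of s "Suc k" k y B "e(k := z)" u t i X Y]
        holds_yellow[of s "Suc k" k x B "e(k := z)" u w i X Y] holds_yellow[of s "Suc k" k y B "e(k := z)" u t i X Y]
        assms i by (simp_all add: Y'_def)
    ultimately show ?thesis unfolding holds_simps holds_connectives by blast
  qed
  have k: "2 \<le> k" using assms by simp
  have "holds B X Y k e (same_response k s x y) \<longleftrightarrow> (\<forall>z<length B. \<forall>i<length u. z = e s + letter_pos u i \<longrightarrow>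
      ((u ! i = w ! i) = (u ! i = t ! i)) \<and> (u ! i \<noteq> w ! i \<longrightarrow> Y' w i = Y' t i))"
    unfolding same_response_def holds_all[OF k] using inner by simp
  also have "\<dots> \<longleftrightarrow> (\<forall>i<length u. ((u ! i = w ! i) = (u ! i = t ! i)) \<and> (u ! i \<noteq> w ! i \<longrightarrow> Y' w i = Y' t i))"
    using word_at_letter(1)[OF u] by blast
  also have "\<dots> \<longleftrightarrow> (\<forall>i<length u. wordle_oracle w u ! i = wordle_oracle t u ! i)"
  proof -
    have "wordle_oracle v u ! i = (if u ! i = v ! i then 2 else if Y' v i then 1 else 0)" if "i < length u" for v i
      using that by (cases "u ! i = v ! i") (simp_all add: wordle_oracle_def Y'_def)
    then show ?thesis by (intro all_cong1 imp_cong refl) (simp split: if_splits)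
  qed
  also have "\<dots> \<longleftrightarrow> wordle_oracle w u = wordle_oracle t u"
    by (simp add: list_eq_iff_nth_eq)
  finally show ?thesis .
qed

lemma wf_same_response [simp]: "s < k \<Longrightarrow> x < k \<Longrightarrow> y < k \<Longrightarrow> wf_form k (same_response k s x y)"
  by (simp add: same_response_def)

definition same_word :: "nat \<Rightarrow> nat \<Rightarrow> nat \<Rightarrow> form" where
  "same_word k s x = all k (\<lambda>z. imp (in_word (Suc z) s z) (green (Suc z) s z x))"

lemma holds_same_word:
  assumes "2 \<le> s" "s < k" "2 \<le> x" "x < k"
    and u: "word_at B (e s) u" and w: "word_at B (e x) w" and len: "length w = length u"
  shows "holds B X Y k e (same_word k s x) \<longleftrightarrow> u = w"
proof -
  have es: "e s < length B" using word_at_bound[OF u] by simp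
  have k: "2 \<le> k" using assms by simp
  have inner: "holds B X Y (Suc k) (e(k := z)) (imp (in_word (Suc k) s k) (green (Suc k) s k x)) \<longleftrightarrow>
     (\<forall>i<length u. z = e s + letter_pos u i \<longrightarrow> u ! i = w ! i)" if z: "z < length B" for z
  proof -
    have "holds B X Y (Suc k) (e(k := z)) (in_word (Suc k) s k) \<longleftrightarrow> (\<exists>j<length u. z = e s + letter_pos u j)"
      using holds_in_word[of s "Suc k" k "e(k := z)" B u X Y] assms es z by simp
    moreover have "holds B X Y (Suc k) (e(k := z)) (green (Suc k) s k x) \<longleftrightarrow> u ! i = w ! i"
      if i: "i < length u" "z = e s + letter_pos u i" for i
      using holds_green[of s "Suc k" k x B "e(k := z)" u w i X Y] assms i by simp
    ultimately show ?thesis unfolding holds_connectives by blast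
  qed
  have "holds B X Y k e (same_word k s x) \<longleftrightarrow> (\<forall>z<length B. \<forall>i<length u. z = e s + letter_pos u i \<longrightarrow> u ! i = w ! i)"
    unfolding same_word_def holds_all[OF k] using inner by simp
  also have "\<dots> \<longleftrightarrow> (\<forall>i<length u. u ! i = w ! i)"
    using word_at_letter(1)[OF u] by blast
  also have "\<dots> \<longleftrightarrow> u = w" using len by (simp add: list_eq_iff_nth_eq)
  finally show ?thesis .
qed

lemma wf_same_word [simp]: "s < k \<Longrightarrow> x < k \<Longrightarrow> wf_form k (same_word k s x)"
  by (simp add: same_word_def)

section \<open>Formulas about blocks\<close>

text \<open>\<open>29 = 5 + 6 * 4\<close> is the terminator of the last field and occurs only at the
  end of a block.\<close>

abbreviation last_cell :: "nat \<Rightarrow> form" where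
  "last_cell x \<equiv> Base (\<lambda>b. b = 29) x"

definition earlier_block :: "nat \<Rightarrow> nat \<Rightarrow> nat \<Rightarrow> form" where
  "earlier_block k x y = ex k (\<lambda>t. Conj (last_cell t) (Conj (leq x t) (Less t y)))"

definition same_block :: "nat \<Rightarrow> nat \<Rightarrow> nat \<Rightarrow> form" where
  "same_block k x y = Conj (Neg (earlier_block k x y)) (Neg (earlier_block k y x))"

definition first_cell :: "nat \<Rightarrow> nat \<Rightarrow> form" where
  "first_cell k x = all k (\<lambda>t. imp (successor (Suc t) t x) (last_cell t))"

text \<open>All marks in earlier blocks are at the last cell: the counter step of
  \<open>advance\<close> reaches the block of \<open>x\<close>.\<close>

definition carry :: "nat \<Rightarrow> nat \<Rightarrow> nat \<Rightarrow> form" where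
  "carry v k x = all k (\<lambda>t. imp (Conj (In v t) (earlier_block (Suc t) t x)) (last_cell t))"

definition own_full :: "nat \<Rightarrow> nat \<Rightarrow> nat \<Rightarrow> form" where
  "own_full v k x = ex k (\<lambda>t. Conj (In v t) (Conj (same_block (Suc t) t x) (last_cell t)))"

text \<open>The exclusion of the last cell prevents a mark from moving into the next block.\<close>

definition shifted :: "nat \<Rightarrow> nat \<Rightarrow> nat \<Rightarrow> form" where
  "shifted v k x = ex k (\<lambda>t. Conj (successor (Suc t) t x) (Conj (In v t) (Neg (last_cell t))))"

definition ite :: "form \<Rightarrow> form \<Rightarrow> form \<Rightarrow> form" where
  "ite c f g = Conj (imp c f) (imp (Neg c) g)"

definition overflow :: "bool \<Rightarrow> form" where
  "overflow v = all 2 (\<lambda>t. imp (In (if v then 1 else 0) t) (last_cell t))"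

text \<open>This and \<open>new_target\<close> spell out \<open>advance\<close>: without a carry the
  mark stays; with a carry a full coordinate is reset, and otherwise the mark that the leaf value
  \<open>v\<close> selects moves by one cell. If a query moves, the target of its round
  restarts.\<close>

definition new_query :: "bool \<Rightarrow> form" where
  "new_query v = (if v then ite (carry 1 3 2) (ite (own_full 1 3 2) (first_cell 3 2) (In 0 2)) (In 0 2)
     else ite (carry 0 3 2) (ite (own_full 0 3 2) (first_cell 3 2) (shifted 0 3 2)) (In 0 2))"

definition new_target :: "bool \<Rightarrow> form" where
  "new_target v = (if v then ite (carry 1 3 2) (ite (own_full 1 3 2) (first_cell 3 2) (shifted 1 3 2)) (In 1 2)
     else ite (carry 0 3 2) (first_cell 3 2) (In 1 2))"

text \<open>A word begins after the terminator of the preceding word or field. The symbol 5 is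
  excluded because the end of a field also follows such a terminator.\<close>

definition word_start :: "nat \<Rightarrow> nat \<Rightarrow> nat \<Rightarrow> form" where
  "word_start f k x = Conj (Base (\<lambda>b. b div 6 = f \<and> b mod 6 \<noteq> 5) x)
     (ex k (\<lambda>t. Conj (successor (Suc t) t x) (Base (\<lambda>b. b mod 6 \<in> {4, 5}) t)))"

text \<open>Marks belong to the same round iff they are in the same block. The possible survivor
  \<open>t\<close> may lie in any block, since each of them lists all words.\<close>

definition leaf_form :: form where
  "leaf_form = Conj (all 2 (\<lambda>p. imp (In 0 p) (word_start 2 (Suc p) p)))
     (imp (all 2 (\<lambda>q. imp (In 1 q) (word_start 3 (Suc q) q)))
       (Neg (ex 2 (\<lambda>t. Conj (word_start 3 (Suc t) t) (all (Suc t) (\<lambda>p. all (Suc p) (\<lambda>q.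
         imp (Conj (In 0 p) (Conj (In 1 q) (same_block (Suc q) p q)))
           (Conj (Neg (same_word (Suc q) p t)) (same_response (Suc q) p q t)))))))))"

lemma wf_block_forms:
  "wf_form 2 leaf_form" "wf_form 2 (overflow v)" "wf_form 3 (new_query v)" "wf_form 3 (new_target v)"
  "wf_form 3 (first_cell 3 2)"
  by (simp_all add: leaf_form_def overflow_def new_query_def new_target_def ite_def carry_def own_full_def
      shifted_def first_cell_def same_block_def earlier_block_def word_start_def)

lemma holds_ite [simp]:
  "holds B X Y k e (ite c f g) \<longleftrightarrow> (if holds B X Y k e c then holds B X Y k e f else holds B X Y k e g)"
  by (simp add: ite_def)

definition start_at :: "nat list \<Rightarrow> nat \<Rightarrow> nat \<Rightarrow> bool" where
  "start_at A f i \<longleftrightarrow> A ! i div 6 = f \<and> A ! i mod 6 \<noteq> 5 \<and> i > 0 \<and> A ! (i - 1) mod 6 \<in> {4, 5}"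

section \<open>Meaning of the formulas on \<open>g\<close> equal blocks\<close>

text \<open>\<open>A\<close> is one labelled copy of the input, and block \<open>b\<close> of its
  \<open>g\<close> copies belongs to round \<open>b\<close>. By \<open>first_A\<close> the first
  cell of a block lies in field 0; so it starts no word, although its predecessor is a field
  terminator of the preceding block.\<close>

locale blocks =
  fixes A :: "nat list" and g n :: nat and D W :: "nat list set" and d :: nat
  assumes length_A: "length A = n" and n_pos: "n > 0" and g_pos: "g > 0"
    and last_A: "i < n \<Longrightarrow> A ! i = 29 \<longleftrightarrow> Suc i = n"
    and first_A: "A ! 0 div 6 = 0"
    and word_at_A: "i < n \<Longrightarrow> start_at A 2 i \<or> start_at A 3 i \<Longrightarrow> word_at A i (the_word A i)"
    and D: "the_word A ` {i. i < n \<and> start_at A 2 i} = D"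
    and W: "the_word A ` {i. i < n \<and> start_at A 3 i} = W"
    and length_D: "u \<in> D \<Longrightarrow> length u = d" and W_sub: "W \<subseteq> D"
begin

definition B :: "nat list" where
  "B = concat (replicate g A)"

definition mark :: "(nat \<Rightarrow> nat) \<Rightarrow> nat set" where
  "mark f = {p. p < g * n \<and> p mod n = f (p div n)}"

lemma length_B [simp]: "length B = g * n"
  by (simp add: B_def length_concat sum_list_replicate length_A)

lemma drop_blocks: "b < h \<Longrightarrow> drop (b * n) (concat (replicate h A)) = concat (replicate (h - b) A)"
proof (induction b arbitrary: h)
  case (Suc b)
  then obtain h' where h: "h = Suc h'" by (cases h) auto
  have "drop (Suc b * n) (concat (replicate h A)) = drop (b * n) (concat (replicate h' A))"
    by (simp add: h length_A)
  then show ?case using Suc.IH[of h'] Suc.prems by (simp add: h)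
qed simp

lemma drop_B:
  assumes "p < g * n"
  shows "\<exists>r. drop p B = drop (p mod n) A @ r"
proof -
  have b: "p div n < g" using assms by (simp add: less_mult_imp_div_less)
  have "drop p B = drop (p mod n) (drop (p div n * n) B)"
    by (simp only: drop_drop mod_div_mult_eq)
  also have "drop (p div n * n) B = A @ concat (replicate (g - p div n - 1) A)"
    using drop_blocks[OF b] b by (cases "g - p div n") (auto simp: B_def)
  finally show ?thesis using n_pos by (simp add: length_A)
qed

lemma nth_B: "p < g * n \<Longrightarrow> B ! p = A ! (p mod n)"
proof -
  assume p: "p < g * n"
  obtain r where r: "drop p B = drop (p mod n) A @ r" using drop_B[OF p] by blast
  have m: "p mod n < length A" using n_pos by (simp add: length_A)
  have "B ! p = drop p B ! 0" using p by (subst nth_drop) simp_all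
  also have "\<dots> = drop (p mod n) A ! 0" unfolding r using m by (subst nth_append) simp
  also have "\<dots> = A ! (p mod n)" using m by (subst nth_drop) simp_all
  finally show ?thesis .
qed

lemma word_at_B: "p < g * n \<Longrightarrow> word_at A (p mod n) u \<Longrightarrow> word_at B p u"
proof -
  assume "p < g * n" "word_at A (p mod n) u"
  then obtain r r' where "drop p B = drop (p mod n) A @ r" "drop (p mod n) (syms A) = enc_letters u @ 4 # r'"
    using drop_B[of p] unfolding word_at_def by blast
  then have "drop p (syms B) = enc_letters u @ 4 # (r' @ syms r)"
    by (simp add: syms_def drop_map)
  then show ?thesis unfolding word_at_def by blast
qed

lemma last_B: "p < g * n \<Longrightarrow> B ! p = 29 \<longleftrightarrow> Suc (p mod n) = n"
  using last_A[of "p mod n"] n_pos by (simp add: nth_B)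

lemma Suc_mod_div:
  "Suc (p mod n) \<noteq> n \<Longrightarrow> Suc p mod n = Suc (p mod n) \<and> Suc p div n = p div n"
  "Suc (p mod n) = n \<Longrightarrow> Suc p mod n = 0 \<and> Suc p div n = Suc (p div n)"
  by (simp_all add: mod_Suc div_Suc)

lemma earlier_block_iff:
  assumes "q < g * n"
  shows "(\<exists>t<g * n. Suc (t mod n) = n \<and> p \<le> t \<and> t < q) \<longleftrightarrow> p div n < q div n"
proof
  assume "\<exists>t<g * n. Suc (t mod n) = n \<and> p \<le> t \<and> t < q"
  then obtain t where t: "Suc (t mod n) = n" "p \<le> t" "t < q" by blast
  have "p div n \<le> t div n" using t(2) by (rule div_le_mono)
  also have "\<dots> < Suc t div n" using Suc_mod_div(2)[OF t(1)] by simp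
  also have "\<dots> \<le> q div n" using t(3) by (intro div_le_mono) simp
  finally show "p div n < q div n" .
next
  assume lt: "p div n < q div n"
  \<comment> \<open>The last cell of the block of \<open>p\<close>.\<close>
  define t where "t = p div n * n + (n - 1)"
  have "t mod n = (n - 1) mod n" unfolding t_def by (rule mod_mult_self3)
  then have tm: "Suc (t mod n) = n" using n_pos by simp
  have "p mod n < n" using n_pos by simp
  then have "p \<le> t" using div_mult_mod_eq[of p n] unfolding t_def by linarith
  moreover have "t < q"
  proof -
    have "Suc (p div n) * n \<le> q div n * n" using lt by (intro mult_le_mono1) simp
    then show ?thesis using n_pos div_mult_mod_eq[of q n] unfolding t_def mult_Suc by linarith
  qed
  moreover have "t < g * n" using \<open>t < q\<close> assms by (rule less_trans)
  ultimately show "\<exists>t<g * n. Suc (t mod n) = n \<and> p \<le> t \<and> t < q"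
    using tm by blast
qed

context
  fixes X Y :: "nat set" and k :: nat and e :: "nat \<Rightarrow> nat"
begin

lemma holds_earlier_block:
  assumes "2 \<le> x" "2 \<le> y" "x < k" "y < k" "e x < g * n" "e y < g * n"
  shows "holds B X Y k e (earlier_block k x y) \<longleftrightarrow> e x div n < e y div n"
  unfolding earlier_block_iff[OF assms(6), symmetric] earlier_block_def
  using assms by (simp add: last_B cong: conj_cong)

lemma holds_same_block:
  assumes "2 \<le> x" "2 \<le> y" "x < k" "y < k" "e x < g * n" "e y < g * n"
  shows "holds B X Y k e (same_block k x y) \<longleftrightarrow> e x div n = e y div n"
  using assms holds_earlier_block[OF assms] holds_earlier_block[of y x]
  by (auto simp: same_block_def)

lemma holds_first_cell:
  assumes "2 \<le> x" "x < k" "e x < g * n"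
  shows "holds B X Y k e (first_cell k x) \<longleftrightarrow> e x mod n = 0"
proof -
  have "holds B X Y k e (first_cell k x) \<longleftrightarrow> (\<forall>t<g * n. e x = Suc t \<longrightarrow> Suc (t mod n) = n)"
    unfolding first_cell_def using assms by (simp add: last_B cong: imp_cong)
  also have "\<dots> \<longleftrightarrow> e x mod n = 0"
  proof (cases "e x")
    case (Suc t)
    have "Suc t mod n = 0 \<longleftrightarrow> Suc (t mod n) = n" using Suc_mod_div[of t] by (metis nat.distinct(1))
    then show ?thesis using assms(3) unfolding Suc by auto
  qed simp
  finally show ?thesis .
qed

end

lemma holds_In:
  assumes "2 \<le> x" "e x < length B'"
  shows "holds B' X Y k e (In (if v then 1 else 0) x) \<longleftrightarrow> e x \<in> (if v then Y else X)"
  using assms by auto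

text \<open>Each block \<open>b\<close> contains exactly one marked position,
  \<open>b * n + f b\<close>, so quantifying over marks is quantifying over rounds.\<close>

lemma block_ex:
  assumes "\<forall>b<g. f b < n"
  shows "(\<exists>t<g * n. t \<in> mark f \<and> R (t div n) (t mod n)) \<longleftrightarrow> (\<exists>b<g. R b (f b))"
proof
  assume "\<exists>t<g * n. t \<in> mark f \<and> R (t div n) (t mod n)"
  then obtain t where t: "t < g * n" "t mod n = f (t div n)" "R (t div n) (t mod n)"
    by (auto simp: mark_def)
  have "t div n < g" using t(1) by (rule less_mult_imp_div_less)
  with t show "\<exists>b<g. R b (f b)" by metis
next
  assume "\<exists>b<g. R b (f b)"
  then obtain b where b: "b < g" "R b (f b)" by blast
  have "f b < n" using assms b by blast
  moreover have "b * n + f b < g * n"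
    using mult_le_mono1[of "Suc b" g n] b(1) \<open>f b < n\<close> by simp
  ultimately show "\<exists>t<g * n. t \<in> mark f \<and> R (t div n) (t mod n)"
    using b by (intro exI[of _ "b * n + f b"]) (simp add: mark_def)
qed

lemma block_all:
  assumes "\<forall>b<g. f b < n"
  shows "(\<forall>t<g * n. t \<in> mark f \<longrightarrow> R (t div n) (t mod n)) \<longleftrightarrow> (\<forall>b<g. R b (f b))"
  using block_ex[OF assms, of "\<lambda>b i. \<not> R b i"] by blast

context
  fixes X Y :: "nat set" and k x :: nat and e :: "nat \<Rightarrow> nat" and v :: bool and f :: "nat \<Rightarrow> nat"
  assumes x: "2 \<le> x" "x < k" "e x < g * n" and f: "\<forall>b<g. f b < n" and XY: "(if v then Y else X) = mark f"
begin

lemma holds_carry: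
  "holds B X Y k e (carry (if v then 1 else 0) k x) \<longleftrightarrow> (\<forall>b<e x div n. Suc (f b) = n)"
proof -
  have "holds B X Y k e (carry (if v then 1 else 0) k x) \<longleftrightarrow>
      (\<forall>t<g * n. t \<in> mark f \<longrightarrow> t div n < e x div n \<longrightarrow> Suc (t mod n) = n)"
    unfolding carry_def using x
    by (simp add: holds_In XY last_B holds_earlier_block cong: imp_cong del: One_nat_def if_split) blast
  also have "\<dots> \<longleftrightarrow> (\<forall>b<g. b < e x div n \<longrightarrow> Suc (f b) = n)"
    using block_all[OF f, of "\<lambda>b i. b < e x div n \<longrightarrow> Suc i = n"] by simp
  also have "\<dots> \<longleftrightarrow> (\<forall>b<e x div n. Suc (f b) = n)"
    using x(3) less_mult_imp_div_less by (metis less_trans)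
  finally show ?thesis .
qed

lemma holds_own_full:
  "holds B X Y k e (own_full (if v then 1 else 0) k x) \<longleftrightarrow> Suc (f (e x div n)) = n"
proof -
  have "holds B X Y k e (own_full (if v then 1 else 0) k x) \<longleftrightarrow>
      (\<exists>t<g * n. t \<in> mark f \<and> t div n = e x div n \<and> Suc (t mod n) = n)"
    unfolding own_full_def using x
    by (simp add: holds_In XY last_B holds_same_block cong: conj_cong del: One_nat_def if_split)
  also have "\<dots> \<longleftrightarrow> (\<exists>b<g. b = e x div n \<and> Suc (f b) = n)"
    by (rule block_ex[OF f, of "\<lambda>b i. b = e x div n \<and> Suc i = n"])
  also have "\<dots> \<longleftrightarrow> Suc (f (e x div n)) = n"
    using x(3) less_mult_imp_div_less by blast
  finally show ?thesis .
qed

lemma holds_shifted: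
  "holds B X Y k e (shifted (if v then 1 else 0) k x) \<longleftrightarrow> e x mod n = Suc (f (e x div n))"
proof -
  have "holds B X Y k e (shifted (if v then 1 else 0) k x) \<longleftrightarrow>
      (\<exists>t<g * n. e x = Suc t \<and> t \<in> mark f \<and> Suc (t mod n) \<noteq> n)"
    unfolding shifted_def using x
    by (simp add: holds_In XY last_B cong: conj_cong del: One_nat_def if_split)
  also have "\<dots> \<longleftrightarrow> (\<exists>t. e x = Suc t \<and> t mod n = f (t div n) \<and> Suc (t mod n) \<noteq> n)"
    using x(3) by (auto simp: mark_def)
  also have "\<dots> \<longleftrightarrow> e x mod n = Suc (f (e x div n))"
  proof (cases "e x")
    case (Suc t)
    then show ?thesis using Suc_mod_div[of t] by (cases "Suc (t mod n) = n") auto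
  qed simp
  finally show ?thesis .
qed

end

definition good_path :: "path \<Rightarrow> bool" where
  "good_path \<pi> \<longleftrightarrow> (\<forall>b<g. fst (\<pi> b) < n \<and> snd (\<pi> b) < n)"

abbreviation qmark :: "path \<Rightarrow> nat set" where
  "qmark \<pi> \<equiv> mark (\<lambda>b. fst (\<pi> b))"

abbreviation tmark :: "path \<Rightarrow> nat set" where
  "tmark \<pi> \<equiv> mark (\<lambda>b. snd (\<pi> b))"

lemma good_advance: "good_path \<pi> \<Longrightarrow> good_path (advance n v \<pi>)"
  using n_pos by (auto simp: good_path_def advance_def full_def Suc_lessI)

lemma holds_overflow:
  assumes "good_path \<pi>"
  shows "holds B (qmark \<pi>) (tmark \<pi>) 2 e (overflow v) \<longleftrightarrow> (\<forall>b<g. full n v \<pi> b)"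
proof -
  define f where "f b = (if v then snd (\<pi> b) else fst (\<pi> b))" for b
  have f: "\<forall>b<g. f b < n" using assms by (auto simp: f_def good_path_def)
  have XY: "(if v then tmark \<pi> else qmark \<pi>) = mark f" by (auto simp: f_def[abs_def])
  have "holds B (qmark \<pi>) (tmark \<pi>) 2 e (overflow v) \<longleftrightarrow> (\<forall>t<g * n. t \<in> mark f \<longrightarrow> Suc (t mod n) = n)"
    unfolding overflow_def by (simp add: holds_In XY last_B cong: imp_cong del: One_nat_def if_split)
  also have "\<dots> \<longleftrightarrow> (\<forall>b<g. Suc (f b) = n)"
    using block_all[OF f, of "\<lambda>b i. Suc i = n"] .
  finally show ?thesis by (simp add: f_def full_def)
qed

lemma holds_new_marks:
  assumes "good_path \<pi>"
  shows "{p. p < g * n \<and> holds B (qmark \<pi>) (tmark \<pi>) 3 (\<lambda>_. p) (new_query v)} = qmark (advance n v \<pi>)" (is ?query)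
    and "{p. p < g * n \<and> holds B (qmark \<pi>) (tmark \<pi>) 3 (\<lambda>_. p) (new_target v)} = tmark (advance n v \<pi>)" (is ?target)
proof -
  define f where "f b = (if v then snd (\<pi> b) else fst (\<pi> b))" for b
  have f: "\<forall>b<g. f b < n" using assms by (auto simp: f_def good_path_def)
  have XY: "(if v then tmark \<pi> else qmark \<pi>) = mark f" by (auto simp: f_def[abs_def])
  have fl: "full n v \<pi> b \<longleftrightarrow> Suc (f b) = n" for b by (simp add: full_def f_def)
  have r: "holds B (qmark \<pi>) (tmark \<pi>) 3 (\<lambda>_. p) (carry (if v then 1 else 0) 3 2) \<longleftrightarrow> (\<forall>b<p div n. full n v \<pi> b)"
    "holds B (qmark \<pi>) (tmark \<pi>) 3 (\<lambda>_. p) (own_full (if v then 1 else 0) 3 2) \<longleftrightarrow> full n v \<pi> (p div n)"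
    "holds B (qmark \<pi>) (tmark \<pi>) 3 (\<lambda>_. p) (shifted (if v then 1 else 0) 3 2) \<longleftrightarrow> p mod n = Suc (f (p div n))"
    "holds B (qmark \<pi>) (tmark \<pi>) 3 (\<lambda>_. p) (first_cell 3 2) \<longleftrightarrow> p mod n = 0"
    "holds B (qmark \<pi>) (tmark \<pi>) 3 (\<lambda>_. p) (In 0 2) \<longleftrightarrow> p mod n = fst (\<pi> (p div n))"
    "holds B (qmark \<pi>) (tmark \<pi>) 3 (\<lambda>_. p) (In (Suc 0) 2) \<longleftrightarrow> p mod n = snd (\<pi> (p div n))"
    if "p < g * n" for p
  proof -
    show "holds B (qmark \<pi>) (tmark \<pi>) 3 (\<lambda>_. p) (carry (if v then 1 else 0) 3 2) \<longleftrightarrow> (\<forall>b<p div n. full n v \<pi> b)"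
      unfolding fl by (rule holds_carry[OF _ _ _ f XY]) (use that in simp_all)
    show "holds B (qmark \<pi>) (tmark \<pi>) 3 (\<lambda>_. p) (own_full (if v then 1 else 0) 3 2) \<longleftrightarrow> full n v \<pi> (p div n)"
      unfolding fl by (rule holds_own_full[OF _ _ _ f XY]) (use that in simp_all)
    show "holds B (qmark \<pi>) (tmark \<pi>) 3 (\<lambda>_. p) (shifted (if v then 1 else 0) 3 2) \<longleftrightarrow> p mod n = Suc (f (p div n))"
      by (rule holds_shifted[OF _ _ _ f XY]) (use that in simp_all)
    show "holds B (qmark \<pi>) (tmark \<pi>) 3 (\<lambda>_. p) (first_cell 3 2) \<longleftrightarrow> p mod n = 0"
      by (rule holds_first_cell) (use that in simp_all)
    show "holds B (qmark \<pi>) (tmark \<pi>) 3 (\<lambda>_. p) (In 0 2) \<longleftrightarrow> p mod n = fst (\<pi> (p div n))"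
      "holds B (qmark \<pi>) (tmark \<pi>) 3 (\<lambda>_. p) (In (Suc 0) 2) \<longleftrightarrow> p mod n = snd (\<pi> (p div n))"
      using that by (simp_all add: mark_def)
  qed
  have "holds B (qmark \<pi>) (tmark \<pi>) 3 (\<lambda>_. p) (new_query v) \<longleftrightarrow> p mod n = fst (advance n v \<pi> (p div n))"
    if "p < g * n" for p
    using r[OF that] by (cases v; simp add: new_query_def advance_def f_def; blast)
  then show ?query by (auto simp only: mark_def)
  have "holds B (qmark \<pi>) (tmark \<pi>) 3 (\<lambda>_. p) (new_target v) \<longleftrightarrow> p mod n = snd (advance n v \<pi> (p div n))"
    if "p < g * n" for p
    using r[OF that] by (cases v; simp add: new_target_def advance_def f_def; blast)
  then show ?target by (auto simp only: mark_def)
qed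

lemma holds_word_start:
  assumes "2 \<le> x" "x < k" "e x < g * n" "f > 0"
  shows "holds B X Y k e (word_start f k x) \<longleftrightarrow> start_at A f (e x mod n)"
proof -
  have "holds B X Y k e (word_start f k x) \<longleftrightarrow> A ! (e x mod n) div 6 = f \<and> A ! (e x mod n) mod 6 \<noteq> 5 \<and>
      (\<exists>t<g * n. e x = Suc t \<and> A ! (t mod n) mod 6 \<in> {4, 5})"
    unfolding word_start_def using assms by (simp add: nth_B cong: conj_cong)
  also have "\<dots> \<longleftrightarrow> start_at A f (e x mod n)"
  proof (cases "e x mod n = 0")
    case True
    then show ?thesis using first_A assms(4) by (simp add: start_at_def)
  next
    case False
    then obtain t where t: "e x = Suc t" by (cases "e x") auto
    then have "e x mod n = Suc (t mod n)" using False Suc_mod_div[of t] by auto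
    then show ?thesis using t assms(3) by (auto simp: start_at_def)
  qed
  finally show ?thesis .
qed

lemma holds_leaf_form:
  assumes "good_path \<pi>"
  shows "holds B (qmark \<pi>) (tmark \<pi>) 2 e leaf_form \<longleftrightarrow>
    game_leaf g (start_at A 2) (start_at A 3) (the_word A) W \<pi>"
proof -
  let ?X = "qmark \<pi>" and ?Y = "tmark \<pi>"
  have fq: "\<forall>b<g. fst (\<pi> b) < n" and ft: "\<forall>b<g. snd (\<pi> b) < n" using assms by (auto simp: good_path_def)
  have "holds B ?X ?Y 2 e (all 2 (\<lambda>p. imp (In 0 p) (word_start 2 (Suc p) p))) \<longleftrightarrow>
      (\<forall>p<g * n. p \<in> ?X \<longrightarrow> start_at A 2 (p mod n))"
    by (simp add: holds_word_start cong: imp_cong)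
  then have Q: "holds B ?X ?Y 2 e (all 2 (\<lambda>p. imp (In 0 p) (word_start 2 (Suc p) p))) \<longleftrightarrow> (\<forall>b<g. start_at A 2 (fst (\<pi> b)))"
    using block_all[OF fq, of "\<lambda>b i. start_at A 2 i"] by (simp only:)
  have "holds B ?X ?Y 2 e (all 2 (\<lambda>p. imp (In 1 p) (word_start 3 (Suc p) p))) \<longleftrightarrow>
      (\<forall>p<g * n. p \<in> ?Y \<longrightarrow> start_at A 3 (p mod n))"
    by (simp add: holds_word_start cong: imp_cong)
  then have T: "holds B ?X ?Y 2 e (all 2 (\<lambda>p. imp (In 1 p) (word_start 3 (Suc p) p))) \<longleftrightarrow> (\<forall>b<g. start_at A 3 (snd (\<pi> b)))"
    using block_all[OF ft, of "\<lambda>b i. start_at A 3 i"] by (simp only:)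
  let ?inner = "\<lambda>t b. the_word A (fst (\<pi> b)) \<noteq> t \<and>
      wordle_oracle (the_word A (snd (\<pi> b))) (the_word A (fst (\<pi> b))) = wordle_oracle t (the_word A (fst (\<pi> b)))"
  \<comment> \<open>Only with all marks at word starts do the formulas about words have their
    meaning; otherwise the outer parts of \<open>leaf_form\<close> decide.\<close>
  have E: "holds B ?X ?Y 2 e (ex 2 (\<lambda>t. Conj (word_start 3 (Suc t) t) (all (Suc t) (\<lambda>p. all (Suc p) (\<lambda>q.
         imp (Conj (In 0 p) (Conj (In 1 q) (same_block (Suc q) p q)))
           (Conj (Neg (same_word (Suc q) p t)) (same_response (Suc q) p q t)))))))
    \<longleftrightarrow> (\<exists>t\<in>W. \<forall>b<g. ?inner t b)"
    if vq: "\<forall>b<g. start_at A 2 (fst (\<pi> b))" and vt: "\<forall>b<g. start_at A 3 (snd (\<pi> b))"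
  proof -
    have at: "word_at B p (the_word A (p mod n))" "length (the_word A (p mod n)) = d"
      if "p < g * n" "start_at A 2 (p mod n) \<or> start_at A 3 (p mod n)" for p
    proof -
      have m: "p mod n < n" using n_pos by simp
      show "word_at B p (the_word A (p mod n))" using word_at_B[OF that(1) word_at_A[OF m that(2)]] .
      have "the_word A (p mod n) \<in> D" using that(2) m D W W_sub by blast
      then show "length (the_word A (p mod n)) = d" by (rule length_D)
    qed
    have start: "start_at A 2 (p mod n)" if "p \<in> ?X" for p
      using that vq by (auto simp: mark_def dest: less_mult_imp_div_less)
    have start': "start_at A 3 (p mod n)" if "p \<in> ?Y" for p
      using that vt by (auto simp: mark_def dest: less_mult_imp_div_less)
    let ?p = "Suc 2" and ?q = "Suc (Suc 2)"
    have inner: "holds B ?X ?Y (Suc ?q) (e(2 := t, ?p := p, ?q := q))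
        (imp (Conj (In 0 ?p) (Conj (In 1 ?q) (same_block (Suc ?q) ?p ?q)))
          (Conj (Neg (same_word (Suc ?q) ?p 2)) (same_response (Suc ?q) ?p ?q 2)))
      \<longleftrightarrow> (p \<in> ?X \<longrightarrow> q \<in> ?Y \<longrightarrow> p div n = q div n \<longrightarrow> the_word A (p mod n) \<noteq> the_word A (t mod n) \<and>
        wordle_oracle (the_word A (q mod n)) (the_word A (p mod n)) = wordle_oracle (the_word A (t mod n)) (the_word A (p mod n)))"
      if t: "t < g * n" "start_at A 3 (t mod n)" and p: "p < g * n" and q: "q < g * n" for t p q
    proof (cases "p \<in> ?X \<and> q \<in> ?Y")
      case True
      have "holds B ?X ?Y (Suc ?q) (e(2 := t, ?p := p, ?q := q)) (same_word (Suc ?q) ?p 2) \<longleftrightarrow> the_word A (p mod n) = the_word A (t mod n)"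
        using at[of p] at[of t] start True t p by (intro holds_same_word) auto
      moreover have "holds B ?X ?Y (Suc ?q) (e(2 := t, ?p := p, ?q := q)) (same_response (Suc ?q) ?p ?q 2) \<longleftrightarrow>
        wordle_oracle (the_word A (q mod n)) (the_word A (p mod n)) = wordle_oracle (the_word A (t mod n)) (the_word A (p mod n))"
        using at[of p] at[of t] at[of q] start start' True t p q by (intro holds_same_response) auto
      ultimately show ?thesis using p q True by (simp add: holds_same_block)
    next
      case False
      then show ?thesis using p q by auto
    qed
    \<comment> \<open>Pairs of marks in a common block are the pairs of one round: \<open>q\<close>
      is eliminated first, then \<open>p\<close>.\<close>
    have row: "(\<forall>p<g * n. \<forall>q<g * n. p \<in> ?X \<longrightarrow> q \<in> ?Y \<longrightarrow> p div n = q div n \<longrightarrow> R (p mod n) (q mod n)) \<longleftrightarrow>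
        (\<forall>b<g. R (fst (\<pi> b)) (snd (\<pi> b)))" for R
    proof -
      have "(\<forall>q<g * n. q \<in> ?Y \<longrightarrow> p div n = q div n \<longrightarrow> R (p mod n) (q mod n)) \<longleftrightarrow> R (p mod n) (snd (\<pi> (p div n)))"
        if "p < g * n" for p
        using block_all[OF ft, of "\<lambda>b i. p div n = b \<longrightarrow> R (p mod n) i"] that less_mult_imp_div_less[OF that] by auto
      then have "(\<forall>p<g * n. \<forall>q<g * n. p \<in> ?X \<longrightarrow> q \<in> ?Y \<longrightarrow> p div n = q div n \<longrightarrow> R (p mod n) (q mod n)) \<longleftrightarrow>
          (\<forall>p<g * n. p \<in> ?X \<longrightarrow> R (p mod n) (snd (\<pi> (p div n))))"
        by blast
      then show ?thesis using block_all[OF fq, of "\<lambda>b i. R i (snd (\<pi> b))"] by simp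
    qed
    have "holds B ?X ?Y 2 e (ex 2 (\<lambda>t. Conj (word_start 3 (Suc t) t) (all (Suc t) (\<lambda>p. all (Suc p) (\<lambda>q.
         imp (Conj (In 0 p) (Conj (In 1 q) (same_block (Suc q) p q)))
           (Conj (Neg (same_word (Suc q) p t)) (same_response (Suc q) p q t)))))))
      \<longleftrightarrow> (\<exists>t<g * n. start_at A 3 (t mod n) \<and> (\<forall>p<g * n. \<forall>q<g * n. p \<in> ?X \<longrightarrow> q \<in> ?Y \<longrightarrow> p div n = q div n \<longrightarrow>
        the_word A (p mod n) \<noteq> the_word A (t mod n) \<and>
        wordle_oracle (the_word A (q mod n)) (the_word A (p mod n)) = wordle_oracle (the_word A (t mod n)) (the_word A (p mod n))))"
    proof -
      have 2: "(2::nat) \<le> 2" "2 \<le> Suc 2" "2 \<le> Suc (Suc 2)" by simp_all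
      have "holds B ?X ?Y (Suc 2) (e(2 := t)) (word_start 3 (Suc 2) 2) \<longleftrightarrow> start_at A 3 (t mod n)" if "t < g * n" for t
        using that by (simp add: holds_word_start)
      moreover have "holds B ?X ?Y (Suc 2) (e(2 := t)) (all (Suc 2) (\<lambda>p. all (Suc p) (\<lambda>q.
         imp (Conj (In 0 p) (Conj (In 1 q) (same_block (Suc q) p q)))
           (Conj (Neg (same_word (Suc q) p 2)) (same_response (Suc q) p q 2))))) \<longleftrightarrow>
        (\<forall>p<g * n. \<forall>q<g * n. p \<in> ?X \<longrightarrow> q \<in> ?Y \<longrightarrow> p div n = q div n \<longrightarrow>
        the_word A (p mod n) \<noteq> the_word A (t mod n) \<and>
        wordle_oracle (the_word A (q mod n)) (the_word A (p mod n)) = wordle_oracle (the_word A (t mod n)) (the_word A (p mod n)))"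
        if "t < g * n" "start_at A 3 (t mod n)" for t
        unfolding holds_all[OF 2(2)] holds_all[OF 2(3)] length_B
        by (simp only: inner[OF that] cong: imp_cong)
      ultimately show ?thesis unfolding holds_ex[OF 2(1)] length_B holds_simps by blast
    qed
    also have "\<dots> \<longleftrightarrow> (\<exists>t<g * n. start_at A 3 (t mod n) \<and> (\<forall>b<g. ?inner (the_word A (t mod n)) b))"
      using row[of "\<lambda>i j. the_word A i \<noteq> the_word A (t mod n) \<and>
        wordle_oracle (the_word A j) (the_word A i) = wordle_oracle (the_word A (t mod n)) (the_word A i)" for t]
      by (simp only:)
    also have "\<dots> \<longleftrightarrow> (\<exists>t\<in>W. \<forall>b<g. ?inner t b)"
    proof -
      \<comment> \<open>Every offset already occurs in block 0, which exists as \<open>g\<close> is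
        positive.\<close>
      have "\<exists>s<g * n. s mod n = i" if "i < n" for i
      proof -
        have "n \<le> g * n" using g_pos by (cases g) auto
        then show ?thesis using less_le_trans[OF that, of "g * n"] that by (intro exI[of _ i]) simp
      qed
      then have "(\<exists>t<g * n. start_at A 3 (t mod n) \<and> R (the_word A (t mod n))) \<longleftrightarrow>
          (\<exists>i<n. start_at A 3 i \<and> R (the_word A i))" for R
        using n_pos by (metis mod_less_divisor)
      moreover have "(\<exists>t\<in>W. R t) \<longleftrightarrow> (\<exists>i<n. start_at A 3 i \<and> R (the_word A i))" for R
        unfolding W[symmetric] by blast
      ultimately show ?thesis by (simp only:)
    qed
    finally show ?thesis .
  qed
  show ?thesis
    unfolding leaf_form_def game_leaf_def holds_simps holds_connectives Q T using E by blast
qed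

end

section \<open>Encoded instances\<close>

lemma set_enc_words: "set (enc_words us) \<subseteq> {1..4}"
proof -
  have "a \<in> {1..4}" if "a \<in> set (enc_letters u)" for a u using set_enc_letters[of u] that by auto
  then show ?thesis by (auto simp: enc_words_def)
qed

text \<open>Before the field the field number is wrong, and after it only a terminator may carry the
  number. Inside, the first cell qualifies because \<open>P\<close> ends with a terminator.\<close>

lemma start_at_field:
  assumes A: "A = P @ map (\<lambda>a. a + 6 * f) E @ Q" and P: "P \<noteq> []" "last P mod 6 = 5" "\<forall>c\<in>set P. c div 6 \<noteq> f"
    and Q: "\<forall>c\<in>set Q. c div 6 = f \<longrightarrow> c mod 6 = 5" and E: "set E \<subseteq> {1..4}" and i: "i < length A"
  shows "start_at A f i \<longleftrightarrow> (\<exists>j<length E. i = length P + j \<and> (j = 0 \<or> E ! (j - 1) = 4))"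
proof -
  consider "i < length P" | j where "i = length P + j" "j < length E" | j where "i = length P + length E + j" "j < length Q"
    using i unfolding A by (auto, metis add.assoc add_less_cancel_left le_Suc_ex not_less)
  then show ?thesis
  proof cases
    case 1
    then have "A ! i \<in> set P" by (simp add: A nth_append)
    then show ?thesis using P(3) 1 by (auto simp: start_at_def)
  next
    case 2
    have small: "E ! k \<in> {1..4}" if "k < length E" for k using E that by (meson nth_mem subsetD)
    have Ai: "A ! (length P + k) = E ! k + 6 * f" if "k < length E" for k using that by (simp add: A nth_append)
    have 6: "(E ! k + 6 * f) div 6 = f" "(E ! k + 6 * f) mod 6 = E ! k" if "k < length E" for k
      using small[OF that] by auto
    have "start_at A f i \<longleftrightarrow> i > 0 \<and> A ! (i - 1) mod 6 \<in> {4, 5}"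
      using 2 Ai[OF 2(2)] 6[OF 2(2)] small[OF 2(2)] by (auto simp: start_at_def)
    also have "\<dots> \<longleftrightarrow> (j = 0 \<or> E ! (j - 1) = 4)"
    proof (cases j)
      case 0
      then show ?thesis using P(1,2) 2 by (simp add: A nth_append last_conv_nth)
    next
      case (Suc k)
      then have "k < length E" using 2 by simp
      then show ?thesis using Suc 2 Ai[of k] 6[of k] small[of k] by auto
    qed
    finally show ?thesis using 2 by auto
  next
    case 3
    then have "A ! i \<in> set Q" by (simp add: A nth_append)
    then show ?thesis using Q 3 by (auto simp: start_at_def)
  qed
qed

lemma start_words:
  assumes A: "A = P @ map (\<lambda>a. a + 6 * f) (enc_words us) @ Q" and P: "P \<noteq> []" "last P mod 6 = 5" "\<forall>c\<in>set P. c div 6 \<noteq> f"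
    and Q: "\<forall>c\<in>set Q. c div 6 = f \<longrightarrow> c mod 6 = 5"
  shows "i < length A \<Longrightarrow> start_at A f i \<Longrightarrow> word_at A i (the_word A i)"
    and "the_word A ` {i. i < length A \<and> start_at A f i} = set us"
proof -
  have syms: "map (\<lambda>b. b mod 6) (map (\<lambda>a. a + 6 * f) (enc_words us)) = enc_words us"
    using set_enc_words[of us] by (auto intro!: map_idI)
  have start: "start_at A f i \<longleftrightarrow> (\<exists>j<length us. i = length P + length (enc_words (take j us)))" if "i < length A" for i
  proof -
    have "4 \<notin> set (enc_letters u)" for u using set_enc_letters[of u] by auto
    then have "(\<exists>k<length (enc_words us). i = length P + k \<and> (k = 0 \<or> enc_words us ! (k - 1) = 4)) \<longleftrightarrow>
        (\<exists>k<length (enc_words us). i = length P + k \<and> (\<exists>j<length us. k = length (enc_words (take j us))))"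
      using terminated_starts[of 4 enc_letters _ us] unfolding enc_words_def by (metis (no_types, lifting))
    also have "\<dots> \<longleftrightarrow> (\<exists>j<length us. i = length P + length (enc_words (take j us)))"
    proof -
      have "length (enc_words (take j us)) < length (enc_words us)" if "j < length us" for j
      proof -
        have "enc_words us = enc_words (take j us) @ enc_words (drop j us)"
          unfolding enc_words_def by (metis append_take_drop_id concat_append map_append)
        moreover have "enc_words (drop j us) \<noteq> []"
          using that by (cases "drop j us") (auto simp: enc_words_def)
        ultimately show ?thesis by simp
      qed
      then show ?thesis by blast
    qed
    finally show ?thesis using start_at_field[OF A P Q set_enc_words that] by simp
  qed
  have at: "word_at A (length P + length (enc_words (take j us))) (us ! j)"
    "length P + length (enc_words (take j us)) < length A" if "j < length us" for j
  proof -
    have us: "us = take j us @ us ! j # drop (Suc j) us" using that by (simp add: id_take_nth_drop)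
    have enc: "enc_words us = enc_words (take j us) @ enc_letters (us ! j) @ 4 # enc_words (drop (Suc j) us)"
      by (subst us) (simp add: enc_words_def del: append_take_drop_id)
    have "syms A = map (\<lambda>b. b mod 6) P @ enc_words us @ map (\<lambda>b. b mod 6) Q"
      using syms by (simp add: A syms_def)
    then show "word_at A (length P + length (enc_words (take j us))) (us ! j)"
      unfolding word_at_def enc by simp
    then show "length P + length (enc_words (take j us)) < length A"
      using word_at_bound by fastforce
  qed
  show "word_at A i (the_word A i)" if "i < length A" "start_at A f i"
    using start[OF that(1)] that(2) at(1) the_word_eq by metis
  show "the_word A ` {i. i < length A \<and> start_at A f i} = set us"
  proof (intro equalityI subsetI)
    fix u assume "u \<in> the_word A ` {i. i < length A \<and> start_at A f i}"
    then obtain j where "j < length us" "u = the_word A (length P + length (enc_words (take j us)))"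
      using start by auto
    then show "u \<in> set us" using at(1) the_word_eq by (metis nth_mem)
  next
    fix u assume "u \<in> set us"
    then obtain j where j: "j < length us" "u = us ! j" by (auto simp: in_set_conv_nth)
    show "u \<in> the_word A ` {i. i < length A \<and> start_at A f i}"
      using start at[OF j(1)] j the_word_eq[OF at(1)[OF j(1)]]
      by (intro image_eqI[of _ _ "length P + length (enc_words (take j us))"]) auto
  qed
qed

lemma labels_skip:
  assumes "5 \<notin> set E" "f < 4"
  shows "labels f (E @ 5 # r) = map (\<lambda>a. a + 6 * f) E @ (5 + 6 * f) # labels (Suc f) r"
  using assms by (induction E) (auto simp: label_def next_field_def)

lemma labels_last: "5 \<notin> set E \<Longrightarrow> labels 4 (E @ [5]) = replicate (length E) 25 @ [29]"
  by (induction E) (auto simp: label_def next_field_def)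

lemma blocks_encoding:
  assumes WI: "wordle_instance WI"
    and as: "set as = alphabet WI" and ds: "set ds = dictionary WI" and ws: "set ws = word_list WI"
    and x: "x = enc_letters as @ 5 # binary (dimension WI) @ 5 # enc_words ds @ 5 # enc_words ws @ 5 #
      binary (game_length WI) @ [5]"
  shows "blocks (labels 0 x) (game_length WI) (length x) (dictionary WI) (word_list WI) (dimension WI)"
proof -
  let ?A = "labels 0 x"
  define E0 where "E0 = enc_letters as"
  define E1 where "E1 = binary (dimension WI)"
  define L where "L = length (binary (game_length WI))"
  have sets: "set E0 \<subseteq> {1..4}" "set E1 \<subseteq> {1..4}" "set (enc_words us) \<subseteq> {1..4}" "set (binary k) \<subseteq> {1..4}" for us k
    using set_enc_letters[of as] set_binary[of "dimension WI"] set_enc_words[of us] set_binary[of k]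
    by (auto simp: E0_def E1_def)
  have no5: "5 \<notin> set E0" "5 \<notin> set E1" "5 \<notin> set (enc_words us)" "5 \<notin> set (binary k)" for us k
    using sets(1,2) sets(3)[of us] sets(4)[of k] by auto
  have four: "Suc (Suc (Suc (Suc 0))) = 4" by simp
  \<comment> \<open>11, 17, 23 and 29 are the terminator 5 in the fields 1 to 4; 25 is the common
    label of the digits of the game length.\<close>
  have A: "?A = E0 @ 5 # map (\<lambda>a. a + 6) E1 @ 11 # map (\<lambda>a. a + 12) (enc_words ds) @ 17 #
      map (\<lambda>a. a + 18) (enc_words ws) @ 23 # replicate L 25 @ [29]"
    unfolding x E0_def[symmetric] E1_def[symmetric]
    by (simp add: labels_skip no5 four labels_last L_def)
  have div: "b div 6 = 0" if "b \<in> set E0" for b using sets(1) that by auto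
  have div1: "(b + 6) div 6 = 1" if "b \<in> set E1" for b
  proof -
    have "b < 6" using sets(2) that by auto
    then show ?thesis by simp
  qed
  have divw: "(b + 6 * f) div 6 = f" if "b \<in> set (enc_words us)" for b us f
  proof -
    have "b < 6" using sets(3)[of us] that by auto
    then show ?thesis by simp
  qed
  note D = start_words[of ?A "E0 @ 5 # map (\<lambda>a. a + 6) E1 @ [11]" 2 ds
      "17 # map (\<lambda>a. a + 18) (enc_words ws) @ 23 # replicate L 25 @ [29]"]
  note W = start_words[of ?A "E0 @ 5 # map (\<lambda>a. a + 6) E1 @ 11 # map (\<lambda>a. a + 12) (enc_words ds) @ [17]" 3 ws
      "23 # replicate L 25 @ [29]"]
  have D': "?A = (E0 @ 5 # map (\<lambda>a. a + 6) E1 @ [11]) @ map (\<lambda>a. a + 6 * 2) (enc_words ds) @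
      17 # map (\<lambda>a. a + 18) (enc_words ws) @ 23 # replicate L 25 @ [29]"
    "\<forall>c\<in>set (E0 @ 5 # map (\<lambda>a. a + 6) E1 @ [11]). c div 6 \<noteq> 2"
    "\<forall>c\<in>set (17 # map (\<lambda>a. a + 18) (enc_words ws) @ 23 # replicate L 25 @ [29]). c div 6 = 2 \<longrightarrow> c mod 6 = 5"
    using div div1 divw[of _ ws 3] by (auto simp: A)
  have W': "?A = (E0 @ 5 # map (\<lambda>a. a + 6) E1 @ 11 # map (\<lambda>a. a + 12) (enc_words ds) @ [17]) @
      map (\<lambda>a. a + 6 * 3) (enc_words ws) @ 23 # replicate L 25 @ [29]"
    "\<forall>c\<in>set (E0 @ 5 # map (\<lambda>a. a + 6) E1 @ 11 # map (\<lambda>a. a + 12) (enc_words ds) @ [17]). c div 6 \<noteq> 3"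
    "\<forall>c\<in>set (23 # replicate L 25 @ [29 :: nat]). c div 6 = 3 \<longrightarrow> c mod 6 = 5"
    using div div1 divw[of _ ds 2] by (auto simp: A)
  have no29: "29 \<notin> set (E0 @ 5 # map (\<lambda>a. a + 6) E1 @ 11 # map (\<lambda>a. a + 12) (enc_words ds) @ 17 #
      map (\<lambda>a. a + 18) (enc_words ws) @ 23 # replicate L 25)" (is "29 \<notin> set ?F")
    using sets(1,2) sets(3)[of ds] sets(3)[of ws] by fastforce
  have AF: "?A = ?F @ [29]" by (simp add: A)
  show ?thesis
  proof
    show "length ?A = length x" by simp
    show "length x > 0" by (simp add: x)
    show "game_length WI > 0" using WI by (simp add: wordle_instance_def)
    fix i
    show "?A ! i = 29 \<longleftrightarrow> Suc i = length x" if "i < length x"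
    proof -
      have l: "length x = Suc (length ?F)" using length_labels[of 0 x] unfolding AF by (simp only: length_append_singleton)
      show ?thesis
      proof (cases "i < length ?F")
        case True
        then have "?A ! i \<in> set ?F" unfolding AF by (metis nth_append nth_mem)
        then show ?thesis using True no29 l by (metis Suc_inject less_irrefl)
      next
        case False
        then have "i = length ?F" using that l by linarith
        then show ?thesis using l unfolding AF by (metis nth_append_length)
      qed
    qed
    show "word_at ?A i (the_word ?A i)" if "i < length x" "start_at ?A 2 i \<or> start_at ?A 3 i"
      using D(1)[OF D'(1) _ _ D'(2,3)] W(1)[OF W'(1) _ _ W'(2,3)] that by auto
  next
    show "?A ! 0 div 6 = 0" using div by (cases E0) (auto simp: A)
    show "the_word ?A ` {i. i < length x \<and> start_at ?A 2 i} = dictionary WI"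
      using D(2)[OF D'(1) _ _ D'(2,3)] ds by simp
    show "the_word ?A ` {i. i < length x \<and> start_at ?A 3 i} = word_list WI"
      using W(2)[OF W'(1) _ _ W'(2,3)] ws by simp
    show "length u = dimension WI" if "u \<in> dictionary WI" for u
      using WI that by (auto simp: wordle_instance_def)
    show "word_list WI \<subseteq> dictionary WI"
      using WI by (simp add: wordle_instance_def)
  qed
qed

section \<open>The deciding program and its running time\<close>

text \<open>The search is over as soon as all coordinates are full with respect to the current leaf
  value, when a further advance would overflow.\<close>

definition guard_form :: form where
  "guard_form = Neg (ite leaf_form (overflow True) (overflow False))"

definition advance_prog :: prog where
  "advance_prog = Cond (checker 2 leaf_form)
     (update (new_query True) (new_target True)) (update (new_query False) (new_target False))"

text \<open>The first update puts both marks of every round on the first cell of its block, the path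
  of zeros. At the end the last leaf is evaluated once more; by \<open>exploration\<close> its value
  is the value of the game.\<close>

definition decide :: prog where
  "decide = seq (update (first_cell 3 2) (first_cell 3 2))
     (seq (Loop (checker 2 guard_form) advance_prog)
       (checker 2 leaf_form))"

definition update_cost :: "form \<Rightarrow> form \<Rightarrow> nat \<Rightarrow> nat" where
  "update_cost f h N = N * (cost f N + 3) + N * (cost h N + 3) + 5"

definition round_cost :: "nat \<Rightarrow> nat" where
  "round_cost N = cost guard_form N + cost leaf_form N +
     update_cost (new_query True) (new_target True) N + update_cost (new_query False) (new_target False) N"

lemma boundable_decide: "boundable decide"
  unfolding decide_def advance_prog_def by (intro boundable boundable_update boundable_checker)

lemma sat_marks: "wf_form 2 f \<Longrightarrow> sat B 2 (marks X Y) f \<longleftrightarrow> holds B X Y 2 e f"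
  unfolding holds_def by (rule sat_cong) (auto simp: marks_def env_def less_2_cases_iff)

lemma sat_marks_pos: "wf_form 3 f \<Longrightarrow> sat B 3 ((marks X Y)(2 := {p})) f \<longleftrightarrow> holds B X Y 3 (\<lambda>_. p) f"
  unfolding holds_def by (rule sat_cong) (auto simp: marks_def env_def)

context blocks
begin

abbreviation leaf :: "path \<Rightarrow> bool" where
  "leaf \<equiv> game_leaf g (start_at A 2) (start_at A 3) (the_word A) W"

definition represents :: "(nat \<Rightarrow> nat set) \<Rightarrow> path \<Rightarrow> bool" where
  "represents F \<pi> \<longleftrightarrow> good_path \<pi> \<and> F 0 = qmark \<pi> \<and> F 3 = tmark \<pi>"

lemma B_nonempty: "B \<noteq> []"
  using length_B n_pos g_pos by (metis length_0_conv mult_eq_0_iff less_numeral_extra(3))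

lemma wf_guard: "wf_form 2 guard_form"
  using wf_block_forms by (simp add: guard_form_def ite_def)

lemma exec_leaf:
  assumes "represents F \<pi>"
  shows "\<exists>F' r. exec (checker 2 leaf_form) (cells_of B F) r (cells_of B F') (leaf \<pi>) \<and>
    r \<le> cost leaf_form (g * n) \<and> represents F' \<pi>"
proof -
  have "sat B 2 (marks (F 0) (F 3)) leaf_form \<longleftrightarrow> leaf \<pi>"
    using assms holds_leaf_form[of \<pi> "\<lambda>_. 0"]
    by (simp add: represents_def sat_marks[where e = "\<lambda>_. 0"] wf_block_forms)
  then show ?thesis
    using exec_check[OF B_nonempty wf_block_forms(1), of F] assms by (auto simp: represents_def)
qed

lemma exec_guard:
  assumes "represents F \<pi>"
  shows "\<exists>F' r. exec (checker 2 guard_form) (cells_of B F) r (cells_of B F') (\<exists>b<g. \<not> full n (leaf \<pi>) \<pi> b) \<and>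
    r \<le> cost guard_form (g * n) \<and> represents F' \<pi>"
proof -
  have good: "good_path \<pi>" using assms by (simp add: represents_def)
  have "sat B 2 (marks (F 0) (F 3)) guard_form \<longleftrightarrow> holds B (qmark \<pi>) (tmark \<pi>) 2 (\<lambda>_. 0) guard_form"
    using assms by (simp add: represents_def sat_marks[where e = "\<lambda>_. 0"] wf_guard)
  also have "\<dots> \<longleftrightarrow> (\<exists>b<g. \<not> full n (leaf \<pi>) \<pi> b)"
    by (cases "leaf \<pi>") (simp_all add: guard_form_def holds_leaf_form[OF good] holds_overflow[OF good])
  finally show ?thesis
    using exec_check[OF B_nonempty wf_guard, of F] assms by (auto simp: represents_def)
qed

lemma exec_advance:
  assumes "represents F \<pi>"
  shows "\<exists>F' r. exec (update (new_query v) (new_target v)) (cells_of B F) r (cells_of B F') False \<and>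
    r \<le> update_cost (new_query v) (new_target v) (g * n) \<and> represents F' (advance n v \<pi>)"
  using exec_update[OF B_nonempty wf_block_forms(3,4), of v v F] assms holds_new_marks[of \<pi> v] good_advance[of \<pi> v]
  by (auto simp: represents_def sat_marks_pos wf_block_forms update_cost_def)

lemma exec_init:
  "\<exists>F' r. exec (update (first_cell 3 2) (first_cell 3 2)) (cells_of B F) r (cells_of B F') False \<and>
    r \<le> update_cost (first_cell 3 2) (first_cell 3 2) (g * n) \<and> represents F' (\<lambda>_. (0, 0))"
proof -
  have "{p. p < length B \<and> sat B 3 ((marks (F 0) (F 3))(2 := {p})) (first_cell 3 2)} = mark (\<lambda>_. 0)"
    by (auto simp: sat_marks_pos wf_block_forms holds_first_cell mark_def)
  then show ?thesis
    using exec_update[OF B_nonempty wf_block_forms(5) wf_block_forms(5), of F] n_pos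
    by (auto simp: represents_def good_path_def update_cost_def)
qed

text \<open>\<open>k\<close> full rounds and one failing guard, hence the factor
  \<open>Suc k\<close>. Each round evaluates the leaf again after the guard, because the guard
  returns only whether to continue.\<close>

lemma exec_rounds:
  assumes "represents F \<pi>"
    and "\<forall>i<k. \<exists>c<g. \<not> full n (leaf ((next_path n leaf ^^ i) \<pi>)) ((next_path n leaf ^^ i) \<pi>) c"
    and "\<forall>c<g. full n (leaf ((next_path n leaf ^^ k) \<pi>)) ((next_path n leaf ^^ k) \<pi>) c"
  shows "\<exists>F' r. exec (Loop (checker 2 guard_form) advance_prog)
       (cells_of B F) r (cells_of B F') False \<and> r \<le> Suc k * round_cost (g * n) \<and> represents F' ((next_path n leaf ^^ k) \<pi>)"
  using assms
proof (induction k arbitrary: F \<pi>)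
  case 0
  obtain F' r where 1: "exec (checker 2 guard_form) (cells_of B F) r (cells_of B F') (\<exists>b<g. \<not> full n (leaf \<pi>) \<pi> b)"
    "r \<le> cost guard_form (g * n)" "represents F' \<pi>"
    using exec_guard[OF 0(1)] by blast
  have "(\<exists>b<g. \<not> full n (leaf \<pi>) \<pi> b) = False" using 0(3) by simp
  from exec.LoopF[OF 1(1)[unfolded this]] 1(2,3) show ?case
    by (fastforce simp: round_cost_def)
next
  case (Suc k)
  obtain F1 r1 where 1: "exec (checker 2 guard_form) (cells_of B F) r1 (cells_of B F1) (\<exists>b<g. \<not> full n (leaf \<pi>) \<pi> b)"
    "r1 \<le> cost guard_form (g * n)" "represents F1 \<pi>"
    using exec_guard[OF Suc.prems(1)] by blast
  obtain F2 r2 where 2: "exec (checker 2 leaf_form) (cells_of B F1) r2 (cells_of B F2) (leaf \<pi>)"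
    "r2 \<le> cost leaf_form (g * n)" "represents F2 \<pi>"
    using exec_leaf[OF 1(3)] by blast
  obtain F3 r3 where 3: "exec (update (new_query (leaf \<pi>)) (new_target (leaf \<pi>))) (cells_of B F2) r3 (cells_of B F3) False"
    "r3 \<le> update_cost (new_query (leaf \<pi>)) (new_target (leaf \<pi>)) (g * n)" "represents F3 (next_path n leaf \<pi>)"
    using exec_advance[OF 2(3)] by blast
  have "(if leaf \<pi> then update (new_query True) (new_target True) else update (new_query False) (new_target False)) =
      update (new_query (leaf \<pi>)) (new_target (leaf \<pi>))" by (cases "leaf \<pi>") auto
  then have body: "exec advance_prog (cells_of B F1) (r2 + r3) (cells_of B F3) False"
    using exec.Cond[OF 2(1), of "update (new_query True) (new_target True)" "update (new_query False) (new_target False)"] 3(1)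
    by (simp add: advance_prog_def)
  have shift: "(next_path n leaf ^^ i) (next_path n leaf \<pi>) = (next_path n leaf ^^ Suc i) \<pi>" for i
    by (induction i) simp_all
  obtain F' r' where IH: "exec (Loop (checker 2 guard_form) advance_prog) (cells_of B F3) r' (cells_of B F') False"
    "r' \<le> Suc k * round_cost (g * n)" "represents F' ((next_path n leaf ^^ k) (next_path n leaf \<pi>))"
    using Suc.IH[OF 3(3)] Suc.prems(2,3) unfolding shift by blast
  have "(\<exists>b<g. \<not> full n (leaf \<pi>) \<pi> b) = True" using Suc.prems(2) by fastforce
  from exec.LoopT[OF 1(1)[unfolded this] body IH(1)]
  have "exec (Loop (checker 2 guard_form) advance_prog) (cells_of B F) (r1 + (r2 + r3) + r') (cells_of B F') False" .
  moreover have "r1 + (r2 + r3) \<le> round_cost (g * n)"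
    using 1(2) 2(2) 3(2) by (cases "leaf \<pi>") (auto simp: round_cost_def)
  then have "r1 + (r2 + r3) + r' \<le> Suc (Suc k) * round_cost (g * n)" using IH(2) by simp
  ultimately show ?case using IH(3) unfolding shift by blast
qed

lemma exec_decide:
  "\<exists>T r. exec decide (map (\<lambda>b. (b, {})) B) r T (win D W g W) \<and>
    r \<le> (update_cost (first_cell 3 2) (first_cell 3 2) (g * n) + round_cost (g * n) + cost leaf_form (g * n)) * n ^ (2 * g)"
proof -
  let ?\<pi> = "\<lambda>_::nat. (0::nat, 0::nat)" and ?F = "\<lambda>_::nat. {} :: nat set"
  have start: "map (\<lambda>b. (b, {})) B = cells_of B ?F"
    by (rule nth_equalityI) (auto simp: cells_of_def)
  obtain F1 r1 where 1: "exec (update (first_cell 3 2) (first_cell 3 2)) (cells_of B ?F) r1 (cells_of B F1) False"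
    "r1 \<le> update_cost (first_cell 3 2) (first_cell 3 2) (g * n)" "represents F1 ?\<pi>"
    using exec_init by blast
  have zero: "\<forall>c<g. ?\<pi> c = (0, 0)" by simp
  obtain k \<pi>' where k: "k < n ^ (2 * g)" and ex: "explores n leaf g k ?\<pi> \<pi>' (tree_value n leaf g ?\<pi>)"
    using exploration[OF zero n_pos, of leaf] by blast
  have \<pi>': "\<pi>' = (next_path n leaf ^^ k) ?\<pi>" and lf: "leaf \<pi>' = tree_value n leaf g ?\<pi>"
    using ex by (auto simp: explores_def)
  have run: "\<forall>i<k. \<exists>c<g. \<not> full n (leaf ((next_path n leaf ^^ i) ?\<pi>)) ((next_path n leaf ^^ i) ?\<pi>) c"
    using ex unfolding explores_def by blast
  have stop: "\<forall>c<g. full n (leaf ((next_path n leaf ^^ k) ?\<pi>)) ((next_path n leaf ^^ k) ?\<pi>) c"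
    unfolding \<pi>'[symmetric] lf using ex unfolding explores_def by (elim conjE)
  obtain F2 r2 where 2: "exec (Loop (checker 2 guard_form) advance_prog)
       (cells_of B F1) r2 (cells_of B F2) False" "r2 \<le> Suc k * round_cost (g * n)" "represents F2 \<pi>'"
    using exec_rounds[OF 1(3) run stop] unfolding \<pi>'[symmetric] by blast
  obtain F3 r3 where 3: "exec (checker 2 leaf_form) (cells_of B F2) r3 (cells_of B F3) (leaf \<pi>')"
    "r3 \<le> cost leaf_form (g * n)"
    using exec_leaf[OF 2(3)] by blast
  have "leaf \<pi>' = win D W g W"
    unfolding lf by (rule tree_value_game[OF D W n_pos])
  then have "exec decide (cells_of B ?F) (r1 + (r2 + r3)) (cells_of B F3) (win D W g W)"
    using exec_seq[OF 1(1) exec_seq[OF 2(1) 3(1)]] unfolding decide_def by (simp only:)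
  moreover have "r1 + (r2 + r3) \<le>
      (update_cost (first_cell 3 2) (first_cell 3 2) (g * n) + round_cost (g * n) + cost leaf_form (g * n)) * n ^ (2 * g)"
  proof -
    have "1 \<le> n ^ (2 * g)" using n_pos by simp
    then have P: "z \<le> z * n ^ (2 * g)" for z using mult_le_mono2[of 1 "n ^ (2 * g)" z] by simp
    \<comment> \<open>\<open>k\<close> is less than the number of leaves, so the failing guard is
      still covered by it.\<close>
    have "r2 \<le> n ^ (2 * g) * round_cost (g * n)"
      using 2(2) mult_le_mono1[OF Suc_leI[OF k], of "round_cost (g * n)"] by (rule le_trans)
    then show ?thesis
      using le_trans[OF 1(2) P] le_trans[OF 3(2) P] unfolding distrib_right mult.commute[of "n ^ (2 * g)"]
      by linarith
  qed
  ultimately show ?thesis unfolding start by blast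
qed

end

text \<open>On \<open>N\<close> cells a sweep takes \<open>2 * N + 2\<close> steps;
  \<open>5 * N\<close> accounts for making the copies. The number of leaves is kept apart, as it is
  not polynomial.\<close>

lemma poly_bounded_decide:
  "poly_bounded (\<lambda>N. 5 * N + (update_cost (first_cell 3 2) (first_cell 3 2) N + round_cost N + cost leaf_form N) * (2 * N + 2))"
proof -
  have "poly_bounded (\<lambda>N. update_cost f h N)" for f h
    unfolding update_cost_def by (intro poly_bounded_intros poly_bounded_cost)
  then show ?thesis
    unfolding round_cost_def by (intro poly_bounded_intros poly_bounded_cost)
qed

theorem theorem3p1:
  shows "\<exists>(M::tm) (C::nat) (c::nat). turing_machine M \<and>
    (\<forall>(WI::wordle) (x::nat list). wordle_instance WI \<and> encodes x WI \<longrightarrow>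
       tm_halts M x \<and>
       (tm_accepts M x \<longleftrightarrow> (\<exists>\<sigma>. winning_strategy WI \<sigma>)) \<and>
       tm_time M x \<le> C * length x ^ (c * game_length WI) \<and>
       tm_space M x \<le> C * (game_length WI * length x))"
proof -
  obtain m where "bounded_prog m decide" using boundable_decide by (auto simp: boundable_def)
  from sweeping_machine[OF this] obtain M where M: "turing_machine M" and
    run: "\<And>x A B C D ds r T v. x = A @ 5 # B @ 5 # C @ 5 # D @ 5 # ds @ [5] \<and>
    5 \<notin> set (A @ B @ C @ D) \<and> set (A @ B @ C @ D) \<subseteq> {1..5} \<and> set ds \<subseteq> {1, 2} \<and> 0 < digits_value ds \<and>
    exec decide (map (\<lambda>b. (b, {})) (concat (replicate (digits_value ds) (labels 0 x)))) r T v \<Longrightarrow>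
    tm_halts M x \<and> (tm_accepts M x \<longleftrightarrow> v) \<and>
    tm_time M x \<le> digits_value ds * (2 * length x + 2) + digits_value ds * length x
      + r * (2 * (digits_value ds * length x) + 2) \<and>
    tm_space M x \<le> (length x + 2) + (digits_value ds * length x + 2)"
    by blast
  let ?R = "\<lambda>N. update_cost (first_cell 3 2) (first_cell 3 2) N + round_cost N + cost leaf_form N"
  obtain C e where C: "\<And>N. 5 * N + ?R N * (2 * N + 2) \<le> C * (N + 1) ^ e"
    using poly_bounded_decide by (auto simp: poly_bounded_def)
  \<comment> \<open>One constant serves both bounds: \<open>C\<close> for the time, 6 for the space.
    The exponent \<open>2 * e + 2\<close> consists of \<open>2 * e\<close> from the polynomial in
    \<open>N\<close> and 2 from the number of leaves.\<close>
  have "tm_halts M x \<and> (tm_accepts M x \<longleftrightarrow> (\<exists>\<sigma>. winning_strategy WI \<sigma>)) \<and>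
       tm_time M x \<le> (C + 6) * length x ^ ((2 * e + 2) * game_length WI) \<and>
       tm_space M x \<le> (C + 6) * (game_length WI * length x)"
    if WI: "wordle_instance WI" and "encodes x WI" for WI x
  proof -
    obtain as ds ws where as: "set as = alphabet WI" and ds: "set ds = dictionary WI" and ws: "set ws = word_list WI"
      and x: "x = enc_letters as @ 5 # binary (dimension WI) @ 5 # enc_words ds @ 5 # enc_words ws @ 5 #
        binary (game_length WI) @ [5]"
      using \<open>encodes x WI\<close> by (auto simp: encodes_def)
    let ?g = "game_length WI" and ?n = "length x"
    interpret blocks "labels 0 x" ?g ?n "dictionary WI" "word_list WI" "dimension WI"
      by (rule blocks_encoding[OF WI as ds ws x])
    \<comment> \<open>The encoding contains five field terminators.\<close>
    have n2: "?n \<ge> 2" by (simp add: x)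
    have g: "?g \<ge> 1" using g_pos by simp
    obtain T r where ex: "exec decide (map (\<lambda>b. (b, {})) B) r T (win (dictionary WI) (word_list WI) ?g (word_list WI))"
      and r: "r \<le> ?R (?g * ?n) * ?n ^ (2 * ?g)"
      using exec_decide by blast
    have sets: "set (enc_letters as @ binary (dimension WI) @ enc_words ds @ enc_words ws) \<subseteq> {1..4}"
      using set_enc_letters[of as] set_binary[of "dimension WI"] set_enc_words[of ds] set_enc_words[of ws] by auto
    have d: "digits_value (binary ?g) = ?g" by (rule digits_value_binary)
    have no5: "5 \<notin> set (enc_letters as @ binary (dimension WI) @ enc_words ds @ enc_words ws)"
      "set (enc_letters as @ binary (dimension WI) @ enc_words ds @ enc_words ws) \<subseteq> {1..5}"
      using sets by auto
    have pos: "0 < digits_value (binary ?g)" using g by (simp add: d)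
    have ex': "exec decide (map (\<lambda>b. (b, {})) (concat (replicate (digits_value (binary ?g)) (labels 0 x)))) r T
        (win (dictionary WI) (word_list WI) ?g (word_list WI))"
      using ex unfolding d B_def .
    have main: "tm_halts M x \<and> (tm_accepts M x \<longleftrightarrow> win (dictionary WI) (word_list WI) ?g (word_list WI)) \<and>
      tm_time M x \<le> ?g * (2 * ?n + 2) + ?g * ?n + r * (2 * (?g * ?n) + 2) \<and>
      tm_space M x \<le> (?n + 2) + (?g * ?n + 2)"
      using run[OF conjI[OF x conjI[OF no5(1) conjI[OF no5(2) conjI[OF set_binary conjI[OF pos ex']]]]]]
      unfolding d .
    let ?N = "?g * ?n" and ?P = "?n ^ (2 * ?g)"
    have gN: "?g \<le> ?N" "?n \<le> ?N" using n2 g by simp_all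
    have P: "1 \<le> ?P" using n2 by simp
    have "?g * (2 * ?n + 2) + ?g * ?n + r * (2 * ?N + 2) \<le> 5 * ?N + ?R ?N * ?P * (2 * ?N + 2)"
    proof -
      have "?g * (2 * ?n + 2) + ?g * ?n = 3 * ?N + 2 * ?g" by (simp add: algebra_simps)
      then have "?g * (2 * ?n + 2) + ?g * ?n \<le> 5 * ?N" using gN by linarith
      then show ?thesis using mult_le_mono1[OF r] by (rule add_mono)
    qed
    also have "\<dots> \<le> (5 * ?N + ?R ?N * (2 * ?N + 2)) * ?P"
    proof -
      have "5 * ?N \<le> 5 * ?N * ?P" using mult_le_mono2[OF P, of "5 * ?N"] by simp
      moreover have "(a + b * c) * p = a * p + b * p * c" for a b c p :: nat by (simp add: algebra_simps)
      ultimately show ?thesis by (simp only: add_le_mono1)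
    qed
    also have "\<dots> \<le> C * (?N + 1) ^ e * ?P" by (rule mult_le_mono1[OF C])
    also have "\<dots> \<le> C * ?P ^ e * ?P"
    proof -
      \<comment> \<open>\<open>?N + 1\<close> is at most \<open>(?g + 1) * ?n\<close>. Since
        \<open>?g + 1 \<le> 2 ^ ?g \<le> ?n ^ ?g\<close>, this is at most \<open>?P\<close>, which
        turns the polynomial in \<open>?N\<close> into a power of \<open>?n\<close> with exponent
        linear in \<open>?g\<close>.\<close>
      have "?g + 1 \<le> 2 ^ ?g" by (simp add: Suc_le_eq)
      also have "\<dots> \<le> ?n ^ ?g" using n2 by (rule power_mono) simp
      finally have "(?g + 1) * ?n \<le> ?n ^ ?g * ?n ^ ?g"
        by (rule mult_le_mono) (rule self_le_power, use n2 g in simp_all)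
      then have "?N + 1 \<le> ?P" using n2 by (simp add: mult_2 power_add)
      then show ?thesis by (intro mult_le_mono1 mult_le_mono2 power_mono) simp_all
    qed
    also have "\<dots> = C * ?n ^ ((2 * e + 2) * ?g)"
    proof -
      have "?P ^ e * ?P = ?n ^ (2 * ?g * e + 2 * ?g)" by (simp only: power_mult power_add)
      also have "2 * ?g * e + 2 * ?g = (2 * e + 2) * ?g" by (simp add: algebra_simps)
      finally show ?thesis by (simp only: mult.assoc)
    qed
    also have "\<dots> \<le> (C + 6) * ?n ^ ((2 * e + 2) * ?g)" by (rule mult_le_mono1) simp
    finally have "tm_time M x \<le> (C + 6) * ?n ^ ((2 * e + 2) * ?g)" using main by linarith
    moreover have "tm_space M x \<le> (C + 6) * ?N"
    proof -
      have "tm_space M x \<le> 6 * ?N" using main gN n2 by linarith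
      also have "\<dots> \<le> (C + 6) * ?N" by (rule mult_le_mono1) simp
      finally show ?thesis .
    qed
    ultimately show ?thesis using main winning_strategy_iff_win[OF WI] by blast
  qed
  then show ?thesis using M by blast
qed

end
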